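(* For every $c>1/2$ and $\varepsilon>0$ there exists $n_0$ such that for every $n\ge n_0$ the following holds: every $cn$-regular bipartite digraph $G$ on $2n$ vertices contains at least $(1-\varepsilon)cn$ edge-disjoint Hamilton cycles.
   Context: Digraphs are simple: no loops and no multiple edges, but both $(x,y)$ and $(y,x)$ may be edges. A digraph is $d$-regular if every vertex has in-degree and out-degree exactly $d$. A digraph is bipartite with bipartition $(V_1,V_2)$ if $V(G)=V_1\cup V_2$ and every edge has one endpoint in $V_1$ and one in $V_2$. A Hamilton cycle in a digraph is an ordering $v_1,\dots,v_N$ of all its vertices such that $(v_i,v_{i+1})$ is an edge for all $i$, with $v_{N+1}=v_1$. *)

theory Defs
  imports Complex_Main "HOL-Library.Disjoint_Sets" "Graph_Theory.Graph_Theory"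
begin

definition regular_digraph :: "nat \<Rightarrow> 'a pair_pre_digraph \<Rightarrow> bool" where
  "regular_digraph d G \<longleftrightarrow>
     (\<forall>v \<in> pverts G. in_degree (with_proj G) v = d \<and> out_degree (with_proj G) v = d)"

definition bipartition :: "'a pair_pre_digraph \<Rightarrow> 'a set \<Rightarrow> 'a set \<Rightarrow> bool" where
  "bipartition G V\<^sub>1 V\<^sub>2 \<longleftrightarrow>
     pverts G = V\<^sub>1 \<union> V\<^sub>2 \<and> V\<^sub>1 \<inter> V\<^sub>2 = {} \<and>
     (\<forall>(x, y) \<in> parcs G. (x \<in> V\<^sub>1 \<and> y \<in> V\<^sub>2) \<or> (x \<in> V\<^sub>2 \<and> y \<in> V\<^sub>1))"

definition bipartite :: "'a pair_pre_digraph \<Rightarrow> bool" where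
  "bipartite G \<longleftrightarrow> (\<exists>V\<^sub>1 V\<^sub>2. bipartition G V\<^sub>1 V\<^sub>2)"

text \<open>
  A list of vertices is read cyclically: the successor of its last entry is its first entry.
\<close>

definition cyclic_arcs :: "'a list \<Rightarrow> ('a \<times> 'a) set" where
  "cyclic_arcs vs = {(vs ! i, vs ! (Suc i mod length vs)) | i. i < length vs}"

definition hamilton_cycle :: "'a pair_pre_digraph \<Rightarrow> 'a list \<Rightarrow> bool" where
  "hamilton_cycle G vs \<longleftrightarrow>
     distinct vs \<and> set vs = pverts G \<and> cyclic_arcs vs \<subseteq> parcs G"

text \<open>
  Rotations of a vertex list describe the same cycle. They have equal arc sets, so for a
  nonempty digraph a family satisfying the following predicate never contains two of them,
  and its cardinality counts cycles.
\<close>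

definition edge_disjoint_hamilton_cycles :: "'a pair_pre_digraph \<Rightarrow> 'a list set \<Rightarrow> bool" where
  "edge_disjoint_hamilton_cycles G \<C> \<longleftrightarrow>
     finite \<C> \<and> (\<forall>C \<in> \<C>. hamilton_cycle G C) \<and> disjoint_family_on cyclic_arcs \<C>"

end

theory Submission
  imports Defs "HOL-Library.FuncSet" "HOL-Computational_Algebra.Primes" "HOL-Number_Theory.Cong"
    "HOL-Combinatorics.Transposition"
begin

text \<open>
  Write \<open>A\<close> and \<open>B\<close> for the two sides; both have size \<open>n\<close>. A Hamilton cycle is a pair of perfect
  matchings \<open>M\<close> from \<open>A\<close> to \<open>B\<close> and \<open>N\<close> from \<open>B\<close> to \<open>A\<close> whose composition is a single cycle. Split
  both sides at random into \<open>m\<close> blocks of equal size, where \<open>m\<close> is a large constant, so that all degrees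
  into blocks are almost equal. Between two blocks the arcs then contain almost all of their degree
  in disjoint perfect matchings (Ore-Ryser and \<open>c > 1/2\<close>).

  A few pairs of blocks are reserved. Every other pair is spent in block matchings, combined along
  patterns that visit the blocks in one cyclic order and use exactly one reserved pair \<open>A\<^sub>i\<close> to \<open>B\<^sub>j\<close>
  and one reserved pair \<open>B\<^sub>j\<close> to \<open>A\<^sub>l\<close>. Without the arcs out of \<open>A\<^sub>i\<close> such a pattern is a set of
  paths from \<open>B\<^sub>j\<close> to \<open>A\<^sub>i\<close>. A reserved pair is used so rarely that its degrees stay above
  half of the block size, hence Ghouila-Houri's theorem, applied to the digraph whose vertices are
  these paths, closes them up to one cycle. The fewer than \<open>m\<close> vertices left over by the division
  into blocks are exceptional vertices of low degree in this last step.
\<close>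

section \<open>Factors of bipartite graphs\<close>

text \<open>Two perfect matchings usually compose to many cycles, and local repairs would endanger
  the disjointness of the families. Connectivity is therefore forced on the level of blocks. Block
  indices are residues modulo a prime m, and in the pattern (s, i, u, k) a generic step to the other
  side and back adds 2u to the index. As 0 < 2u < m, this shift has a single orbit, so every walk
  enters block i and only the arcs out of it need care. A pair is reserved if its indices differ by
  some u in {1..w}. A pattern is the shift by s altered at two blocks; outside its reserved pairs
  only four differences occur, and keeping them out of {1..w} costs at most 4w^2 of the m shifts, so
  m is taken large against w^2. The bound for the load of a reserved pair is smaller by a factor w
  than that of a generic pair, and w of order 1/(c - 1/2) keeps its degrees above half. The
  hypothesis c > 1/2 enters twice: in Ghouila-Houri, and in the factors, since degrees that vary
  slightly around half of the block size may admit no perfect matching.\<close>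

definition covers :: "nat \<Rightarrow> 'a set \<Rightarrow> 'b set \<Rightarrow> ('a \<times> 'b) set \<Rightarrow> bool" where
  "covers k X Y H \<longleftrightarrow> (\<forall>S\<subseteq>X. \<forall>T\<subseteq>Y. k * (card S + card T) \<le> card (H \<inter> S \<times> T) + k * card X)"

text \<open>The bound demanded by \<open>covers\<close> is the min-cut condition for a k-factor:
  with |X| = |Y| it says that S sends at least k (|S| - |Y - T|) edges into T. The submodularity
  shown here makes rectangles with equality closed under uncrossing.\<close>

lemma card_rectangle_uncross:
  assumes "finite H"
  shows "card (H \<inter> (S \<inter> S') \<times> (T \<union> T')) + card (H \<inter> (S \<union> S') \<times> (T \<inter> T'))
         \<le> card (H \<inter> S \<times> T) + card (H \<inter> S' \<times> T')"
proof -
  let ?P = "H \<inter> S \<times> T" and ?P' = "H \<inter> S' \<times> T'"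
  let ?Q = "H \<inter> (S \<inter> S') \<times> (T \<union> T')" and ?Q' = "H \<inter> (S \<union> S') \<times> (T \<inter> T')"
  have "card ?Q + card ?Q' = card (?Q \<union> ?Q') + card (?Q \<inter> ?Q')"
    by (rule card_Un_Int) (use assms in auto)
  also have "\<dots> \<le> card (?P \<union> ?P') + card (?P \<inter> ?P')"
    using assms by (intro add_mono card_mono) auto
  also have "\<dots> = card ?P + card ?P'"
    by (rule card_Un_Int[symmetric]) (use assms in auto)
  finally show ?thesis .
qed

lemma card_fst_section:
  "card (H \<inter> {x} \<times> T) = card {y \<in> T. (x, y) \<in> H}"
  by (rule bij_betw_same_card[of snd]) (force simp: bij_betw_def inj_on_def)

lemma card_snd_section:
  "card (H \<inter> S \<times> {y}) = card {x \<in> S. (x, y) \<in> H}"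
  by (rule bij_betw_same_card[of fst]) (force simp: bij_betw_def inj_on_def)

lemma card_arcs_fst:
  assumes "finite S" "finite T"
  shows "card (H \<inter> S \<times> T) = (\<Sum>x\<in>S. card {y \<in> T. (x, y) \<in> H})"
proof -
  have "H \<inter> S \<times> T = (SIGMA x:S. {y \<in> T. (x, y) \<in> H})" by auto
  then show ?thesis using assms by simp
qed

lemma card_arcs_snd:
  assumes "finite S" "finite T"
  shows "card (H \<inter> S \<times> T) = (\<Sum>y\<in>T. card {x \<in> S. (x, y) \<in> H})"
proof -
  have "card (H \<inter> S \<times> T) = card (H\<inverse> \<inter> T \<times> S)"
    by (rule bij_betw_same_card[of prod.swap]) (force simp: bij_betw_def inj_on_def)
  then show ?thesis using card_arcs_fst[OF assms(2,1), of "H\<inverse>"] by simp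
qed

text \<open>A minimal subgraph satisfying the covering condition is the desired factor: each of its edges lies in a
  tight rectangle, and tight rectangles can be uncrossed to one that contains all edges at a vertex.\<close>

lemma ore_ryser:
  assumes fin: "finite X" "finite Y" and eq: "card X = card Y" and sub: "E \<subseteq> X \<times> Y"
    and cov: "covers k X Y E"
  shows "\<exists>H\<subseteq>E. (\<forall>x\<in>X. card {y \<in> Y. (x, y) \<in> H} = k) \<and> (\<forall>y\<in>Y. card {x \<in> X. (x, y) \<in> H} = k)"
proof -
  have finE: "finite E" using fin sub finite_subset by blast
  let ?\<F> = "{H. H \<subseteq> E \<and> covers k X Y H}"
  have "finite ?\<F>" by (rule finite_subset[of _ "Pow E"]) (use finE in auto)
  moreover have "?\<F> \<noteq> {}" using cov by blast
  ultimately obtain H where H: "H \<in> ?\<F>" and Hmin': "\<forall>H'\<in>?\<F>. H' \<subseteq> H \<longrightarrow> H = H'"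
    using finite_has_minimal[of ?\<F>] by blast
  have Hmin: "H' = H" if "H' \<in> ?\<F>" "H' \<subseteq> H" for H' using Hmin' that by blast
  have HE: "H \<subseteq> E" and Hc: "covers k X Y H" using H by auto
  have finH: "finite H" using HE finE finite_subset by blast
  have P: "k * (card S + card T) \<le> card (H \<inter> S \<times> T) + k * card X" if "S \<subseteq> X" "T \<subseteq> Y" for S T
    using Hc that unfolding covers_def by blast
  define tight where "tight S T \<longleftrightarrow> S \<subseteq> X \<and> T \<subseteq> Y \<and> k * (card S + card T) = card (H \<inter> S \<times> T) + k * card X" for S T
  \<comment> \<open>Deleting the edge breaks the condition at some rectangle. The edge must lie in
    it and counts only one, so equality held before.\<close>
  have ex_tight: "\<exists>S T. tight S T \<and> x \<in> S \<and> y \<in> T" if xy: "(x, y) \<in> H" for x y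
  proof -
    have "\<not> covers k X Y (H - {(x, y)})" using Hmin[of "H - {(x,y)}"] HE xy by blast
    then obtain S T where ST: "S \<subseteq> X" "T \<subseteq> Y"
      and lt: "card ((H - {(x, y)}) \<inter> S \<times> T) + k * card X < k * (card S + card T)"
      unfolding covers_def by (auto simp: not_le)
    have xS: "x \<in> S \<and> y \<in> T"
    proof (rule ccontr)
      assume "\<not> (x \<in> S \<and> y \<in> T)"
      then have "(H - {(x, y)}) \<inter> S \<times> T = H \<inter> S \<times> T" by auto
      then show False using lt P[OF ST] by simp
    qed
    have "(H - {(x, y)}) \<inter> S \<times> T = (H \<inter> S \<times> T) - {(x, y)}" by auto
    then have "card ((H - {(x, y)}) \<inter> S \<times> T) = card (H \<inter> S \<times> T) - 1"
      using finH xy xS by simp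
    then have "k * (card S + card T) \<le> card (H \<inter> S \<times> T) + k * card X"
      "card (H \<inter> S \<times> T) - 1 + k * card X < k * (card S + card T)" using lt P[OF ST] by auto
    then have "tight S T" unfolding tight_def using ST by simp
    then show ?thesis using xS by blast
  qed
  \<comment> \<open>The sizes of the uncrossed rectangles have the same total, so both of their
    inequalities \<open>P\<close> must be equalities.\<close>
  have meet: "tight (S \<inter> S') (T \<union> T')" if t: "tight S T" "tight S' T'" for S S' T T'
  proof -
    have sub: "S \<subseteq> X" "T \<subseteq> Y" "S' \<subseteq> X" "T' \<subseteq> Y" using t unfolding tight_def by auto
    then have f: "finite S" "finite T" "finite S'" "finite T'" using fin finite_subset by metis+
    have a: "card S + card S' = card (S \<inter> S') + card (S \<union> S')" "card T + card T' = card (T \<inter> T') + card (T \<union> T')"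
      using card_Un_Int[OF f(1,3)] card_Un_Int[OF f(2,4)] by linarith+
    have "k * (card (S \<inter> S') + card (T \<union> T')) \<le> card (H \<inter> (S \<inter> S') \<times> (T \<union> T')) + k * card X"
      by (rule P) (use sub in auto)
    moreover have "k * (card (S \<union> S') + card (T \<inter> T')) \<le> card (H \<inter> (S \<union> S') \<times> (T \<inter> T')) + k * card X"
      by (rule P) (use sub in auto)
    moreover have "k * (card S + card T) + k * (card S' + card T') =
       k * (card (S \<inter> S') + card (T \<union> T')) + k * (card (S \<union> S') + card (T \<inter> T'))"
    proof -
      have "k * (card S + card T) + k * (card S' + card T') = k * ((card S + card S') + (card T + card T'))"
        by (simp add: algebra_simps)
      also have "\<dots> = k * ((card (S \<inter> S') + card (S \<union> S')) + (card (T \<inter> T') + card (T \<union> T')))" by (simp only: a)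
      finally show ?thesis by (simp add: algebra_simps)
    qed
    ultimately show ?thesis
      using t card_rectangle_uncross[OF finH, of S S' T T'] sub unfolding tight_def by auto
  qed
  \<comment> \<open>Uncrossing the tight rectangles of all edges at x gives a tight one with x in S
    and all neighbours of x in T. Removing x from S takes k from the left side and the whole degree
    of x from the right, so \<open>P\<close> for the smaller rectangle bounds the degree by
    k.\<close>
  have degx: "card {y \<in> Y. (x, y) \<in> H} = k" if x: "x \<in> X" for x
  proof -
    let ?N = "{y \<in> Y. (x, y) \<in> H}"
    have ge: "k \<le> card ?N" using P[of "{x}" Y] x eq by (simp add: card_fst_section)
    have ex: "\<exists>S T. tight S T \<and> x \<in> S \<and> F \<subseteq> T" if "finite F" "F \<noteq> {}" "F \<subseteq> ?N" for F
      using that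
    proof (induction rule: finite_ne_induct)
      case (singleton y) then show ?case using ex_tight[of x y] by auto
    next
      case (insert y F)
      then obtain S T where 1: "tight S T" "x \<in> S" "F \<subseteq> T" by auto
      obtain S' T' where 2: "tight S' T'" "x \<in> S'" "y \<in> T'" using ex_tight[of x y] insert by auto
      show ?case using meet[OF 1(1) 2(1)] 1 2 by blast
    qed
    have "card ?N \<le> k"
    proof (cases "?N = {}")
      case True then show ?thesis by (metis card.empty le0)
    next
      case False
      have "finite ?N" using fin by simp
      from ex[OF this False order.refl] obtain S T where t: "tight S T" "x \<in> S" "?N \<subseteq> T" by auto
      have sub: "S \<subseteq> X" "T \<subseteq> Y" using t unfolding tight_def by auto
      then have f: "finite S" "finite T" using fin finite_subset by metis+
      have N: "{y \<in> T. (x, y) \<in> H} = ?N" using t sub by auto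
      have "card (H \<inter> S \<times> T) = card (H \<inter> (S - {x}) \<times> T) + card ?N"
        using f t(2) by (simp add: card_arcs_fst sum.remove[of S x] N)
      moreover have "k * (card (S - {x}) + card T) \<le> card (H \<inter> (S - {x}) \<times> T) + k * card X"
        by (rule P) (use sub in auto)
      moreover have cS: "card S = Suc (card (S - {x}))" by (rule card.remove) (use f t(2) in auto)
      moreover have "k * (card S + card T) = card (H \<inter> S \<times> T) + k * card X" using t(1) tight_def by blast
      moreover have "k * (card S + card T) = k + k * (card (S - {x}) + card T)" unfolding cS by simp
      ultimately show ?thesis by linarith
    qed
    then show ?thesis using ge by (rule le_antisym)
  qed
  \<comment> \<open>All degrees on this side are at least k and they sum to k |X| = k |Y|, so none
    exceeds k.\<close>
  have degy: "card {x \<in> X. (x, y) \<in> H} = k" if y: "y \<in> Y" for y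
  proof -
    have ge: "k \<le> card {x \<in> X. (x, y) \<in> H}" if "y \<in> Y" for y
      using P[of X "{y}"] that by (simp add: card_snd_section)
    have "(\<Sum>y\<in>Y. card {x \<in> X. (x, y) \<in> H}) = (\<Sum>x\<in>X. card {y \<in> Y. (x, y) \<in> H})"
      using card_arcs_fst[OF fin, of H] card_arcs_snd[OF fin, of H] by simp
    also have "\<dots> = (\<Sum>y\<in>Y. k)" using degx eq by simp
    finally show ?thesis using sum_mono_inv[of "\<lambda>_. k" Y "\<lambda>y. card {x \<in> X. (x, y) \<in> H}"] ge fin y by auto
  qed
  show ?thesis using HE degx degy by blast
qed

lemma regular_covers:
  assumes fin: "finite X" "finite Y" and eq: "card X = card Y"
    and dx: "\<forall>x\<in>X. card {y \<in> Y. (x, y) \<in> H} = k" and dy: "\<forall>y\<in>Y. card {x \<in> X. (x, y) \<in> H} = k"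
    and "k \<ge> 1"
  shows "covers 1 X Y H"
  unfolding covers_def
proof (intro allI impI)
  fix S T assume ST: "S \<subseteq> X" "T \<subseteq> Y"
  then have f: "finite S" "finite T" using fin finite_subset by metis+
  have "k * card S = (\<Sum>x\<in>S. card {y \<in> Y. (x, y) \<in> H})" using dx ST by (simp add: subset_iff)
  also have "\<dots> = card (H \<inter> S \<times> Y)" using f fin by (simp add: card_arcs_fst)
  also have "\<dots> = card ((H \<inter> S \<times> T) \<union> (H \<inter> S \<times> (Y - T)))" using ST by (intro arg_cong[of _ _ card]) auto
  also have "\<dots> \<le> card (H \<inter> S \<times> T) + card (H \<inter> S \<times> (Y - T))" by (rule card_Un_le)
  also have "card (H \<inter> S \<times> (Y - T)) \<le> card (H \<inter> X \<times> (Y - T))"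
    using ST fin by (intro card_mono) auto
  also have "\<dots> = (\<Sum>y\<in>Y-T. card {x \<in> X. (x, y) \<in> H})" using fin by (simp add: card_arcs_snd)
  also have "\<dots> = k * card (Y - T)" using dy by simp
  finally have le: "k * card S \<le> card (H \<inter> S \<times> T) + k * card (Y - T)" by simp
  have c: "card (Y - T) + card T = card X" using ST fin f eq by (simp add: card_Diff_subset card_mono)
  show "1 * (card S + card T) \<le> card (H \<inter> S \<times> T) + 1 * card X"
  proof (cases "card S \<le> card (Y - T)")
    case True then show ?thesis using c by simp
  next
    case False
    have "card S - card (Y - T) \<le> k * (card S - card (Y - T))" using \<open>k \<ge> 1\<close> by simp
    also have "\<dots> = k * card S - k * card (Y - T)" by (simp add: diff_mult_distrib2)
    finally have "card S - card (Y - T) \<le> card (H \<inter> S \<times> T)" using le by linarith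
    then show ?thesis using c False by arith
  qed
qed

section \<open>Disjoint perfect matchings in regular and in nearly regular bipartite graphs\<close>

lemma one_regular_fun:
  assumes fin: "finite X" "finite Y" and sub: "M \<subseteq> X \<times> Y"
    and dx: "\<forall>x\<in>X. card {y \<in> Y. (x, y) \<in> M} = 1" and dy: "\<forall>y\<in>Y. card {x \<in> X. (x, y) \<in> M} = 1"
  obtains f where "bij_betw f X Y" "\<And>x y. x \<in> X \<Longrightarrow> y \<in> Y \<Longrightarrow> (x, y) \<in> M \<longleftrightarrow> y = f x"
proof -
  have "\<exists>y. {z \<in> Y. (x, z) \<in> M} = {y}" if "x \<in> X" for x using dx that by (simp add: card_1_singleton_iff)
  then obtain f where f: "\<And>x. x \<in> X \<Longrightarrow> {z \<in> Y. (x, z) \<in> M} = {f x}" by metis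
  have "\<exists>x. {z \<in> X. (z, y) \<in> M} = {x}" if "y \<in> Y" for y using dy that by (simp add: card_1_singleton_iff)
  then obtain g where g: "\<And>y. y \<in> Y \<Longrightarrow> {z \<in> X. (z, y) \<in> M} = {g y}" by metis
  have fY: "f x \<in> Y" "(x, f x) \<in> M" if "x \<in> X" for x using f[OF that] by auto
  have gX: "g y \<in> X" "(g y, y) \<in> M" if "y \<in> Y" for y using g[OF that] by auto
  have fU: "z = f x" if "x \<in> X" "z \<in> Y" "(x, z) \<in> M" for x z
  proof -
    have "z \<in> {z \<in> Y. (x, z) \<in> M}" using that by simp
    then show ?thesis using f[OF that(1)] by simp
  qed
  have gU: "z = g y" if "y \<in> Y" "z \<in> X" "(z, y) \<in> M" for y z
  proof -
    have "z \<in> {z \<in> X. (z, y) \<in> M}" using that by simp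
    then show ?thesis using g[OF that(1)] by simp
  qed
  have "g (f x) = x" if "x \<in> X" for x using gU[of "f x" x] fY[OF that] that by simp
  moreover have "f (g y) = y" if "y \<in> Y" for y using fU[of "g y" y] gX[OF that] that by simp
  ultimately have "bij_betw f X Y"
    by (intro bij_betw_byWitness[where f' = g]) (auto simp: fY gX)
  moreover have "(x, y) \<in> M \<longleftrightarrow> y = f x" if "x \<in> X" "y \<in> Y" for x y using fU[OF that] fY[OF that(1)] by auto
  ultimately show ?thesis using that by blast
qed

text \<open>A perfect matching exists by \<open>regular_covers\<close>, and removing it leaves a
  regular graph of degree one less.\<close>

lemma regular_disjoint_matchings:
  assumes fin: "finite X" "finite Y" and eq: "card X = card Y"
    and "H \<subseteq> X \<times> Y" and "\<forall>x\<in>X. card {y \<in> Y. (x, y) \<in> H} = k" and "\<forall>y\<in>Y. card {x \<in> X. (x, y) \<in> H} = k"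
  shows "\<exists>f :: nat \<Rightarrow> 'a \<Rightarrow> 'b. (\<forall>i<k. bij_betw (f i) X Y \<and> (\<forall>x\<in>X. (x, f i x) \<in> H)) \<and>
     (\<forall>i<k. \<forall>j<k. i \<noteq> j \<longrightarrow> (\<forall>x\<in>X. f i x \<noteq> f j x))"
  using assms(4-)
proof (induction k arbitrary: H)
  case 0 then show ?case by auto
next
  case (Suc k)
  have "covers 1 X Y H" by (rule regular_covers[OF fin eq Suc(3,4)]) simp
  from ore_ryser[OF fin eq Suc(2) this] obtain M where M: "M \<subseteq> H"
    "\<forall>x\<in>X. card {y \<in> Y. (x, y) \<in> M} = 1" "\<forall>y\<in>Y. card {x \<in> X. (x, y) \<in> M} = 1" by blast
  obtain g where g: "bij_betw g X Y" "\<And>x y. x \<in> X \<Longrightarrow> y \<in> Y \<Longrightarrow> (x, y) \<in> M \<longleftrightarrow> y = g x"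
    using one_regular_fun[OF fin _ M(2,3)] M(1) Suc(2) by blast
  have gM: "(x, g x) \<in> M" if "x \<in> X" for x using g(2)[OF that, of "g x"] bij_betwE[OF g(1)] that by blast
  have "card {y \<in> Y. (x, y) \<in> H - M} = k" if "x \<in> X" for x
  proof -
    have "{y \<in> Y. (x, y) \<in> H - M} = {y \<in> Y. (x, y) \<in> H} - {y \<in> Y. (x, y) \<in> M}" by auto
    then show ?thesis using M Suc(3) that fin by (simp add: card_Diff_subset Collect_mono_iff subset_iff)
  qed
  moreover have "card {x \<in> X. (x, y) \<in> H - M} = k" if "y \<in> Y" for y
  proof -
    have "{x \<in> X. (x, y) \<in> H - M} = {x \<in> X. (x, y) \<in> H} - {x \<in> X. (x, y) \<in> M}" by auto
    then show ?thesis using M Suc(4) that fin by (simp add: card_Diff_subset Collect_mono_iff subset_iff)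
  qed
  ultimately have "\<exists>f :: nat \<Rightarrow> 'a \<Rightarrow> 'b. (\<forall>i<k. bij_betw (f i) X Y \<and> (\<forall>x\<in>X. (x, f i x) \<in> H - M)) \<and>
     (\<forall>i<k. \<forall>j<k. i \<noteq> j \<longrightarrow> (\<forall>x\<in>X. f i x \<noteq> f j x))"
    by (intro Suc(1)) (use Suc(2) in auto)
  then obtain f :: "nat \<Rightarrow> 'a \<Rightarrow> 'b" where
    f: "\<forall>i<k. bij_betw (f i) X Y \<and> (\<forall>x\<in>X. (x, f i x) \<in> H - M)"
    "\<forall>i<k. \<forall>j<k. i \<noteq> j \<longrightarrow> (\<forall>x\<in>X. f i x \<noteq> f j x)" by (elim exE conjE)
  have ne: "f i x \<noteq> g x" if "i < k" "x \<in> X" for i x using f(1) gM[OF that(2)] that by force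
  define F where "F = f(k := g)"
  have "bij_betw (F i) X Y \<and> (\<forall>x\<in>X. (x, F i x) \<in> H)" if "i < Suc k" for i
  proof (cases "i = k")
    case True then show ?thesis using g(1) gM M(1) unfolding F_def by auto
  next
    case False then show ?thesis using f(1) that unfolding F_def by auto
  qed
  moreover have "F i x \<noteq> F j x" if "i < Suc k" "j < Suc k" "i \<noteq> j" "x \<in> X" for i j x
    using that f(2) ne[of j x] ne[of i x] unfolding F_def by (auto simp: less_Suc_eq)
  ultimately show ?case by blast
qed

text \<open>With s = |S| + |T| - N the claim is that at least k s edges run from S to T. Counting
  the edges that leave S gives at least (c + \<tau>) N s - 2 \<tau> N |S|, which is enough unless s
  is tiny compared with |S|. In that case |S| \<le> |T| forces |T| \<ge> N/2, and as c > 1/2 every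
  vertex of S keeps at least (b - \<tau>) N neighbours in T.\<close>

lemma near_regular_covers:
  fixes c e \<tau> N :: real
  assumes fin: "finite X" "finite Y" and eq: "card X = card Y" and N: "N = real (card X)"
    and c: "c \<ge> 1/2 + b" "b > 0" "e > 0" "e \<le> 1" "5 * \<tau> \<le> e * b" "\<tau> \<ge> 0"
    and dx: "\<And>x. x \<in> X \<Longrightarrow> (c - \<tau>) * N \<le> card {y \<in> Y. (x, y) \<in> H}"
    and dy: "\<And>y. y \<in> Y \<Longrightarrow> card {x \<in> X. (x, y) \<in> H} \<le> (c + \<tau>) * N"
    and k: "real k \<le> (1 - e) * c * N" "real k \<le> N"
    and ST: "S \<subseteq> X" "T \<subseteq> Y" and le: "card S \<le> card T"
  shows "k * (card S + card T) \<le> card (H \<inter> S \<times> T) + k * card X"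
proof -
  have f: "finite S" "finite T" using fin ST finite_subset by metis+
  define s where "s = real (card S) + real (card T) - N"
  have cT: "real (card (Y - T)) = N - real (card T)"
    using ST fin f eq N by (simp add: card_Diff_subset card_mono of_nat_diff)
  have N0: "N \<ge> 0" using N by simp
  have goal: "real k * s \<le> card (H \<inter> S \<times> T)"
  proof (cases "s \<le> 0")
    case True then show ?thesis by (meson mult_nonneg_nonpos of_nat_0_le_iff order_trans)
  next
    case False
    have "(c - \<tau>) * N - (N - card T) \<le> card {y \<in> T. (x, y) \<in> H}" if "x \<in> S" for x
    proof -
      have "{y \<in> Y. (x, y) \<in> H} \<subseteq> {y \<in> T. (x, y) \<in> H} \<union> (Y - T)" by auto
      then have "card {y \<in> Y. (x, y) \<in> H} \<le> card ({y \<in> T. (x, y) \<in> H} \<union> (Y - T))"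
        using f fin by (intro card_mono) auto
      also have "\<dots> \<le> card {y \<in> T. (x, y) \<in> H} + card (Y - T)" by (rule card_Un_le)
      finally have "real (card {y \<in> Y. (x, y) \<in> H}) \<le> card {y \<in> T. (x, y) \<in> H} + (N - card T)"
        using cT by linarith
      moreover have "(c - \<tau>) * N \<le> card {y \<in> Y. (x, y) \<in> H}" using dx that ST by auto
      ultimately show ?thesis by linarith
    qed
    then have "(\<Sum>x\<in>S. (c - \<tau>) * N - (N - card T)) \<le> (\<Sum>x\<in>S. real (card {y \<in> T. (x, y) \<in> H}))"
      by (intro sum_mono) auto
    then have A: "card S * ((c - \<tau>) * N - (N - card T)) \<le> card (H \<inter> S \<times> T)"
      using f by (simp add: card_arcs_fst)
    have "(\<Sum>x\<in>S. (c - \<tau>) * N) \<le> (\<Sum>x\<in>S. real (card {y \<in> Y. (x, y) \<in> H}))"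
      using dx ST by (intro sum_mono) auto
    then have "card S * ((c - \<tau>) * N) \<le> card (H \<inter> S \<times> Y)" using f fin by (simp add: card_arcs_fst)
    also have "card (H \<inter> S \<times> Y) \<le> card ((H \<inter> S \<times> T) \<union> (H \<inter> X \<times> (Y - T)))"
      using ST fin f by (intro card_mono) auto
    also have "\<dots> \<le> card (H \<inter> S \<times> T) + card (H \<inter> X \<times> (Y - T))" by (rule card_Un_le)
    finally have B0: "card S * ((c - \<tau>) * N) \<le> card (H \<inter> S \<times> T) + real (card (H \<inter> X \<times> (Y - T)))" by simp
    have "real (card (H \<inter> X \<times> (Y - T))) = (\<Sum>y\<in>Y-T. real (card {x \<in> X. (x, y) \<in> H}))"
      using fin by (simp add: card_arcs_snd)
    also have "\<dots> \<le> (\<Sum>y\<in>Y-T. (c + \<tau>) * N)" using dy by (intro sum_mono) auto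
    finally have B: "card S * ((c - \<tau>) * N) \<le> card (H \<inter> S \<times> T) + (N - card T) * ((c + \<tau>) * N)"
      using cT B0 by simp
    then have B': "(c + \<tau>) * N * s - 2 * \<tau> * N * card S \<le> card (H \<inter> S \<times> T)"
      unfolding s_def by (simp add: algebra_simps)
    show ?thesis
    proof (cases "2 * \<tau> * card S \<le> e * c * s")
      case True
      have "real k * s \<le> (1 - e) * c * N * s" using k False by (intro mult_right_mono) auto
      also have "\<dots> \<le> (c + \<tau>) * N * s - 2 * \<tau> * card S * N"
      proof -
        have "2 * \<tau> * card S * N \<le> e * c * s * N" using True N0 by (rule mult_right_mono)
        moreover have "0 \<le> \<tau> * N * s" using c N0 False by auto
        ultimately show ?thesis by (simp add: algebra_simps)
      qed
      also have "\<dots> \<le> card (H \<inter> S \<times> T)" using B' by (simp add: algebra_simps)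
      finally show ?thesis .
    next
      case F2: False
      have "e * (1/2) * s \<le> e * c * s" using c False by (intro mult_right_mono mult_left_mono) auto
      then have es: "e * s \<le> 4 * \<tau> * card S" using F2 by linarith
      have "b * N \<le> (c - 1/2) * N" using c N0 by (intro mult_right_mono) auto
      moreover have "real (card S) \<le> (N + s) / 2" using le unfolding s_def by simp
      ultimately have D: "(b - \<tau>) * N \<le> (c - \<tau>) * N - (N - card T)"
        using False unfolding s_def by (simp add: algebra_simps)
      \<comment> \<open>The origin of the factor 5 in the hypothesis on \<tau>: four from
        \<open>es\<close>, one from this bound.\<close>
      have "e * \<tau> \<le> \<tau>" using c by (simp add: mult_left_le_one_le)
      then have t: "4 * \<tau> \<le> e * (b - \<tau>)" using c by (simp add: algebra_simps)
      have "k * (e * s) \<le> k * (4 * \<tau> * card S)" using es by (intro mult_left_mono) auto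
      then have "e * (k * s) \<le> k * (4 * \<tau> * card S)" by (simp add: mult.left_commute)
      also have "\<dots> \<le> N * (4 * \<tau> * card S)" using k c by (intro mult_right_mono) auto
      also have "\<dots> \<le> N * (e * (b - \<tau>) * card S)" using t N0 by (intro mult_left_mono mult_right_mono) auto
      also have "\<dots> = e * (card S * ((b - \<tau>) * N))" by simp
      also have "\<dots> \<le> e * (card S * ((c - \<tau>) * N - (N - card T)))" using D c by (intro mult_left_mono) auto
      also have "\<dots> \<le> e * card (H \<inter> S \<times> T)" using A c by (intro mult_left_mono) auto
      finally show ?thesis using c by simp
    qed
  qed
  have "real (k * (card S + card T)) \<le> real (card (H \<inter> S \<times> T) + k * card X)"
    using goal N unfolding s_def by (simp add: algebra_simps)
  then show ?thesis by linarith
qed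

lemma near_regular_disjoint_matchings:
  fixes c e \<tau> N :: real and H :: "('a \<times> 'b) set"
  assumes fin: "finite X" "finite Y" and eq: "card X = card Y" and N: "N = real (card X)"
    and c: "c \<ge> 1/2 + b" "b > 0" "e > 0" "e \<le> 1" "5 * \<tau> \<le> e * b" "\<tau> \<ge> 0"
    and dx: "\<And>x. x \<in> X \<Longrightarrow> (c - \<tau>) * N \<le> card {y \<in> Y. (x, y) \<in> H} \<and> card {y \<in> Y. (x, y) \<in> H} \<le> (c + \<tau>) * N"
    and dy: "\<And>y. y \<in> Y \<Longrightarrow> (c - \<tau>) * N \<le> card {x \<in> X. (x, y) \<in> H} \<and> card {x \<in> X. (x, y) \<in> H} \<le> (c + \<tau>) * N"
    and k: "real k \<le> (1 - e) * c * N" "real k \<le> N"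
  shows "\<exists>f :: nat \<Rightarrow> 'a \<Rightarrow> 'b. (\<forall>i<k. bij_betw (f i) X Y \<and> (\<forall>x\<in>X. (x, f i x) \<in> H)) \<and>
     (\<forall>i<k. \<forall>j<k. i \<noteq> j \<longrightarrow> (\<forall>x\<in>X. f i x \<noteq> f j x))"
proof -
  let ?H = "H \<inter> X \<times> Y"
  have "covers k X Y ?H" unfolding covers_def
  proof (intro allI impI)
    fix S T assume ST: "S \<subseteq> X" "T \<subseteq> Y"
    have r: "?H \<inter> S \<times> T = H \<inter> S \<times> T" using ST by auto
    show "k * (card S + card T) \<le> card (?H \<inter> S \<times> T) + k * card X"
    proof (cases "card S \<le> card T")
      case True
      show ?thesis unfolding r
        by (rule near_regular_covers[OF fin eq N c _ _ k ST True]) (use dx dy in auto)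
    next
      case False
      have "k * (card T + card S) \<le> card (H\<inverse> \<inter> T \<times> S) + k * card Y"
        by (rule near_regular_covers[OF fin(2,1) eq[symmetric] _ c _ _ k ST(2,1)])
          (use dx dy eq N False in auto)
      moreover have "card (H\<inverse> \<inter> T \<times> S) = card (H \<inter> S \<times> T)"
        by (rule bij_betw_same_card[of prod.swap]) (force simp: bij_betw_def inj_on_def)
      ultimately show ?thesis unfolding r using eq by (simp add: add.commute)
    qed
  qed
  from ore_ryser[OF fin eq _ this] obtain H' where H': "H' \<subseteq> ?H"
    "\<forall>x\<in>X. card {y \<in> Y. (x, y) \<in> H'} = k" "\<forall>y\<in>Y. card {x \<in> X. (x, y) \<in> H'} = k" by auto
  have "\<exists>f :: nat \<Rightarrow> 'a \<Rightarrow> 'b. (\<forall>i<k. bij_betw (f i) X Y \<and> (\<forall>x\<in>X. (x, f i x) \<in> H')) \<and>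
     (\<forall>i<k. \<forall>j<k. i \<noteq> j \<longrightarrow> (\<forall>x\<in>X. f i x \<noteq> f j x))"
    by (rule regular_disjoint_matchings[OF fin eq _ H'(2,3)]) (use H'(1) in auto)
  then show ?thesis using H'(1) by blast
qed

section \<open>Equitable partitions with uniform degrees\<close>

lemma mod_shift_eq_iff:
  fixes m :: nat
  assumes "t < m" "k < m" "j < m"
  shows "(t + k) mod m = j \<longleftrightarrow> t = (j + (m - k)) mod m"
proof
  assume a: "(t + k) mod m = j"
  have "(j + (m - k)) mod m = (t + k + (m - k)) mod m" unfolding a[symmetric] by (simp add: mod_add_left_eq)
  also have "t + k + (m - k) = t + m" using assms by simp
  finally show "t = (j + (m - k)) mod m" using assms by simp
next
  assume a: "t = (j + (m - k)) mod m"
  have "(t + k) mod m = (j + (m - k) + k) mod m" unfolding a by (simp add: mod_add_left_eq)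
  also have "j + (m - k) + k = j + m" using assms by simp
  finally show "(t + k) mod m = j" using assms by simp
qed

text \<open>The exponent of a Chernoff bound, where u is a mean and u + \<tau> n the threshold. For
  x = \<tau>/4 the gain x \<tau> n = \<tau>^2 n/4 beats the second order loss x^2 (u + \<tau> n),
  which is at most \<tau>^2 n/8.\<close>

lemma exp_moment_exponent:
  fixes x \<tau> u n :: real
  assumes x: "x = \<tau> / 4" and t: "0 < \<tau>" "\<tau> \<le> 1" and u: "0 \<le> u" "u \<le> n"
  shows "exp (x * u) \<le> exp (- (\<tau>\<^sup>2 * n / 8)) * exp (ln (1 + x) * (u + \<tau> * n))"
proof -
  have "x - x\<^sup>2 \<le> ln (1 + x)" using assms by (intro ln_one_plus_pos_lower_bound) auto
  then have "(x - x\<^sup>2) * (u + \<tau> * n) \<le> ln (1 + x) * (u + \<tau> * n)" using assms by (intro mult_right_mono) auto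
  moreover have "x * u + \<tau>\<^sup>2 * n / 8 \<le> (x - x\<^sup>2) * (u + \<tau> * n)"
  proof -
    have "\<tau>\<^sup>2 * u \<le> \<tau>\<^sup>2 * n" using u by (intro mult_left_mono) auto
    moreover have "\<tau> * (\<tau>\<^sup>2 * n) \<le> 1 * (\<tau>\<^sup>2 * n)" using t u by (intro mult_right_mono) auto
    moreover have "(x - x\<^sup>2) * (u + \<tau> * n) - x * u - \<tau>\<^sup>2 * n / 8
      = \<tau>\<^sup>2 * n / 4 - \<tau>\<^sup>2 * n / 8 - \<tau>\<^sup>2 * u / 16 - \<tau> * (\<tau>\<^sup>2 * n) / 16"
      unfolding x by (simp add: field_simps power2_eq_square)
    moreover have "0 \<le> \<tau>\<^sup>2 * n" using u by auto
    ultimately show ?thesis by linarith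
  qed
  ultimately have "x * u \<le> - (\<tau>\<^sup>2 * n / 8) + ln (1 + x) * (u + \<tau> * n)" by linarith
  then show ?thesis by (simp flip: exp_add)
qed

text \<open>Arrange A as n rows of m elements and shift every row cyclically by an independent random amount
  \<open>h g\<close>; the blocks are the columns. The exponential moments of the block sizes are then products over
  the rows, and averaging them over all \<open>h\<close> shows that some \<open>h\<close> is good.\<close>

lemma random_equipartition:
  fixes \<tau> :: real and A :: "'a set"
  assumes m: "m > 0" and t: "0 < \<tau>" "\<tau> \<le> 1"
    and A: "finite A" "card A = m * n" and \<S>: "finite \<S>" "\<And>U. U \<in> \<S> \<Longrightarrow> U \<subseteq> A"
    and small: "card \<S> * m * exp (- (\<tau>\<^sup>2 * n / 8)) < 1"
  shows "\<exists>f :: 'a \<Rightarrow> nat. (\<forall>a\<in>A. f a < m) \<and> (\<forall>j<m. card {a \<in> A. f a = j} = n) \<and>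
      (\<forall>U\<in>\<S>. \<forall>j<m. real (card {a \<in> U. f a = j}) \<le> real (card U) / m + \<tau> * n)"
proof -
  have "card ({..<n} \<times> {..<m}) = card A" using A by (simp add: mult.commute)
  then obtain e where e: "bij_betw e ({..<n} \<times> {..<m}) A"
    using finite_same_card_bij[of "{..<n} \<times> {..<m}" A] A by auto
  \<comment> \<open>\<open>T j k\<close> is the position in a row that the shift by k carries to
    column j. Thus \<open>Z U j h\<close> counts the elements of U in block j.\<close>
  define T where "T j k = (j + (m - k)) mod m" for j k
  define H where "H = (\<Pi>\<^sub>E g\<in>{..<n}. {..<m})"
  define Z where "Z U j h = card {g \<in> {..<n}. e (g, T j (h g)) \<in> U}" for U j h
  define x where "x = \<tau> / 4"
  have x: "x > 0" using t x_def by simp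
  have Tm: "T j k < m" for j k using m T_def by simp
  have finH: "finite H" and cH: "card H = m ^ n" unfolding H_def by (auto simp: finite_PiE card_PiE)
  define D where "D = {..<n} \<times> {..<m}"
  have inj: "inj_on e D" and im: "e ` D = A" using e by (auto simp: bij_betw_def D_def)
  define f where "f h a = (let (g, s) = the_inv_into D e a in (s + h g) mod m)" for h a
  have fe: "f h (e (g, s)) = (s + h g) mod m" if "g < n" "s < m" for h g s
    unfolding f_def using inj that by (subst the_inv_into_f_f) (auto simp: D_def)
  have ex: "\<exists>g<n. \<exists>s<m. a = e (g, s)" if "a \<in> A" for a using that im unfolding D_def by auto
  have blk: "card {a \<in> U. f h a = j} = Z U j h" if h: "h \<in> H" and U: "U \<subseteq> A" and j: "j < m" for h U j
  proof -
    have hm: "h g < m" if "g < n" for g using h that unfolding H_def by auto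
    have "{a \<in> U. f h a = j} = (\<lambda>g. e (g, T j (h g))) ` {g \<in> {..<n}. e (g, T j (h g)) \<in> U}"
    proof (intro equalityI subsetI)
      fix a assume a: "a \<in> {a \<in> U. f h a = j}"
      then obtain g s where gs: "g < n" "s < m" "a = e (g, s)" using ex U by blast
      then have "s = T j (h g)" using a fe[OF gs(1,2)] mod_shift_eq_iff[OF gs(2) hm[OF gs(1)] j]
        unfolding T_def by auto
      then show "a \<in> (\<lambda>g. e (g, T j (h g))) ` {g \<in> {..<n}. e (g, T j (h g)) \<in> U}" using gs a by auto
    next
      fix a assume "a \<in> (\<lambda>g. e (g, T j (h g))) ` {g \<in> {..<n}. e (g, T j (h g)) \<in> U}"
      then obtain g where g: "g < n" "a = e (g, T j (h g))" "a \<in> U" by auto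
      have "f h a = (T j (h g) + h g) mod m" using fe[OF g(1) Tm] g by simp
      also have "\<dots> = j" using mod_shift_eq_iff[OF Tm hm[OF g(1)] j] by (simp add: T_def)
      finally show "a \<in> {a \<in> U. f h a = j}" using g by simp
    qed
    moreover have "inj_on (\<lambda>g. e (g, T j (h g))) {g \<in> {..<n}. e (g, T j (h g)) \<in> U}"
    proof (rule inj_onI)
      fix g g' assume "g \<in> {g \<in> {..<n}. e (g, T j (h g)) \<in> U}" "g' \<in> {g \<in> {..<n}. e (g, T j (h g)) \<in> U}"
        "e (g, T j (h g)) = e (g', T j (h g'))"
      then show "g = g'" using inj_onD[OF inj, of "(g, T j (h g))" "(g', T j (h g'))"] Tm by (auto simp: D_def)
    qed
    ultimately show ?thesis unfolding Z_def by (simp add: card_image)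
  qed
  \<comment> \<open>\<open>Z U j h\<close> is a sum over the rows, and the contribution of row g
    depends on h g alone. The sum over all h therefore factors, and 1 + z \<le> exp z turns each
    factor into the exponential of a mean.\<close>
  have moment: "(\<Sum>h\<in>H. (1 + x) ^ Z U j h) \<le> real m ^ n * exp (x * (card U / m))" if U: "U \<subseteq> A" and j: "j < m" for U j
  proof -
    define \<phi> where "\<phi> g k = (if e (g, T j k) \<in> U then 1 + x else 1)" for g k
    define c where "c g = card {k \<in> {..<m}. e (g, T j k) \<in> U}" for g
    have "(\<Sum>h\<in>H. (1 + x) ^ Z U j h) = (\<Sum>h\<in>H. \<Prod>g<n. \<phi> g (h g))"
    proof (rule sum.cong[OF refl])
      fix h
      have "(\<Prod>g<n. \<phi> g (h g)) = (\<Prod>g\<in>{g \<in> {..<n}. e (g, T j (h g)) \<in> U}. 1 + x)"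
        unfolding \<phi>_def by (subst prod.inter_filter) auto
      then show "(1 + x) ^ Z U j h = (\<Prod>g<n. \<phi> g (h g))" by (simp add: Z_def)
    qed
    also have "\<dots> = (\<Prod>g<n. \<Sum>k<m. \<phi> g k)" unfolding H_def by (subst prod_sum_PiE) auto
    also have "\<dots> \<le> (\<Prod>g<n. m * exp (x * c g / m))"
    proof (rule prod_mono)
      fix g assume "g \<in> {..<n}"
      have "(\<Sum>k<m. \<phi> g k) = (\<Sum>k<m. 1 + (if e (g, T j k) \<in> U then x else 0))" by (intro sum.cong) (auto simp: \<phi>_def)
      also have "\<dots> = m + x * c g" unfolding c_def sum.distrib by (simp flip: sum.inter_filter)
      also have "\<dots> = m * (1 + x * c g / m)" using m by (simp add: field_simps)
      also have "\<dots> \<le> m * exp (x * c g / m)" by (intro mult_left_mono exp_ge_add_one_self) auto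
      finally have "(\<Sum>k<m. \<phi> g k) \<le> m * exp (x * c g / m)" .
      moreover have "0 \<le> (\<Sum>k<m. \<phi> g k)" using x by (intro sum_nonneg) (auto simp: \<phi>_def)
      ultimately show "0 \<le> (\<Sum>k<m. \<phi> g k) \<and> (\<Sum>k<m. \<phi> g k) \<le> m * exp (x * c g / m)" by simp
    qed
    also have "\<dots> = real m ^ n * exp (\<Sum>g<n. x * c g / m)" by (simp add: prod.distrib exp_sum)
    also have "(\<Sum>g<n. x * c g / m) = x * ((\<Sum>g<n. c g) / m)" by (simp add: sum_distrib_left sum_divide_distrib)
    also have "(\<Sum>g<n. c g) = card U"
    proof -
      define Q where "Q = (SIGMA g:{..<n}. {k \<in> {..<m}. e (g, T j k) \<in> U})"
      \<comment> \<open>For fixed j the map \<open>T j\<close> is an involution of the columns, so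
        running over all shifts k visits every position of a row once.\<close>
      have TT: "T j (T j k) = k" if "k < m" for k
        using mod_shift_eq_iff[OF that Tm[of j k] j] mod_shift_eq_iff[OF Tm[of j k] that j]
        unfolding T_def by (simp add: add.commute)
      have imQ: "(\<lambda>(g, k). e (g, T j k)) ` Q = U"
      proof (intro equalityI subsetI)
        fix a assume a: "a \<in> U"
        then obtain g s where gs: "g < n" "s < m" "a = e (g, s)" using ex U by blast
        then have "(g, T j s) \<in> Q" "a = e (g, T j (T j s))" using TT Tm a by (auto simp: Q_def)
        then show "a \<in> (\<lambda>(g, k). e (g, T j k)) ` Q" by force
      qed (auto simp: Q_def)
      have injQ: "inj_on (\<lambda>(g, k). e (g, T j k)) Q"
      proof (rule inj_onI, clarify)
        fix g k g' k' assume q: "(g, k) \<in> Q" "(g', k') \<in> Q" "e (g, T j k) = e (g', T j k')"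
        have e1: "g = g' \<and> T j k = T j k'"
          using q inj_onD[OF inj, of "(g, T j k)" "(g', T j k')"] Tm by (auto simp: D_def Q_def)
        have "k < m" "k' < m" using q by (auto simp: Q_def)
        then have "k = k'" using TT e1 by metis
        then show "g = g' \<and> k = k'" using e1 by simp
      qed
      have "card U = card Q" using card_image[OF injQ] unfolding imQ .
      then show ?thesis by (simp add: Q_def c_def)
    qed
    finally show ?thesis .
  qed
  have ZA: "Z A j h = n" for j h
  proof -
    have "{g \<in> {..<n}. e (g, T j (h g)) \<in> A} = {..<n}" using im Tm by (auto simp: D_def)
    then show ?thesis by (simp add: Z_def)
  qed
  define good where "good h \<longleftrightarrow> (\<forall>U\<in>\<S>. \<forall>j<m. real (Z U j h) \<le> card U / m + \<tau> * n)" for h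
  have "\<exists>h\<in>H. good h"
  proof (rule ccontr)
    assume "\<not> ?thesis"
    then have bad: "\<And>h. h \<in> H \<Longrightarrow> \<not> good h" by blast
    define w where "w U = exp (ln (1 + x) * (card U / m + \<tau> * n))" for U :: "'a set"
    have w0: "w U > 0" for U by (simp add: w_def)
    define I where "I = \<S> \<times> {..<m}"
    have finI: "finite I" using \<S> by (simp add: I_def)
    have "real m ^ n = (\<Sum>h\<in>H. 1)" using cH by simp
    \<comment> \<open>Markov's inequality with a union bound: if h is bad, the summand of a violated
      pair (U, j) is at least 1.\<close>
    also have "\<dots> \<le> (\<Sum>h\<in>H. \<Sum>(U,j)\<in>I. (1 + x) ^ Z U j h / w U)"
    proof (rule sum_mono)
      fix h assume "h \<in> H"
      then obtain U j where Uj: "U \<in> \<S>" "j < m" "card U / m + \<tau> * n < Z U j h"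
        using bad[of h] unfolding good_def by (auto simp: not_le)
      have "w U \<le> exp (ln (1 + x) * Z U j h)" unfolding w_def using Uj x by (simp add: mult_left_mono)
      also have "\<dots> = (1 + x) ^ Z U j h" using x by (simp add: exp_of_nat2_mult)
      finally have "1 \<le> (1 + x) ^ Z U j h / w U" using w0 by simp
      also have "\<dots> = (case (U, j) of (U, j) \<Rightarrow> (1 + x) ^ Z U j h / w U)" by simp
      also have "\<dots> \<le> (\<Sum>(U,j)\<in>I. (1 + x) ^ Z U j h / w U)"
        by (rule member_le_sum) (use Uj finI x w0 in \<open>auto simp: I_def less_imp_le\<close>)
      finally show "1 \<le> (\<Sum>(U,j)\<in>I. (1 + x) ^ Z U j h / w U)" .
    qed
    also have "\<dots> = (\<Sum>(U,j)\<in>I. (\<Sum>h\<in>H. (1 + x) ^ Z U j h) / w U)"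
      by (subst sum.swap) (auto simp: sum_divide_distrib intro!: sum.cong)
    also have "\<dots> \<le> (\<Sum>(U,j)\<in>I. real m ^ n * exp (- (\<tau>\<^sup>2 * n / 8)))"
    proof (rule sum_mono, clarify)
      fix U j assume "(U, j) \<in> I"
      then have Uj: "U \<in> \<S>" "U \<subseteq> A" "j < m" using \<S> by (auto simp: I_def)
      have "card U \<le> m * n" using Uj A card_mono by metis
      then have "real (card U) \<le> real m * real n" by (metis of_nat_mono of_nat_mult)
      then have "card U / m \<le> n" using m by (simp add: field_simps)
      then have "exp (x * (card U / m)) \<le> exp (- (\<tau>\<^sup>2 * n / 8)) * w U"
        unfolding w_def by (intro exp_moment_exponent x_def t) auto
      then have "(\<Sum>h\<in>H. (1 + x) ^ Z U j h) \<le> real m ^ n * (exp (- (\<tau>\<^sup>2 * n / 8)) * w U)"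
        using moment[OF Uj(2,3)] by (smt (verit) mult_left_mono of_nat_0_le_iff zero_le_power)
      then show "(\<Sum>h\<in>H. (1 + x) ^ Z U j h) / w U \<le> real m ^ n * exp (- (\<tau>\<^sup>2 * n / 8))"
        using w0[of U] by (simp add: field_simps)
    qed
    also have "\<dots> = real m ^ n * (card \<S> * m * exp (- (\<tau>\<^sup>2 * n / 8)))" by (simp add: I_def card_cartesian_product)
    also have "\<dots> < real m ^ n * 1" using small m by (intro mult_strict_left_mono) auto
    finally show False by simp
  qed
  then obtain h where h: "h \<in> H" "good h" by blast
  show ?thesis
  proof (intro exI[of _ "f h"] conjI ballI allI impI)
    fix a assume "a \<in> A" then show "f h a < m" using ex[of a] fe m by auto
  next
    fix j assume "j < m" then show "card {a \<in> A. f h a = j} = n" using blk[OF h(1)] ZA by simp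
  next
    fix U j assume "U \<in> \<S>" "j < m"
    then show "real (card {a \<in> U. f h a = j}) \<le> real (card U) / m + \<tau> * n"
      using blk[OF h(1) \<S>(2)] h(2) unfolding good_def by simp
  qed
qed

text \<open>As every block has exactly n elements, too few elements of U in a block mean too many of
  A - U. Adding the complements doubles the number of sets, hence the factor 2.\<close>

lemma random_equipartition_two_sided:
  fixes \<tau> :: real and A :: "'a set"
  assumes m: "m > 0" and t: "0 < \<tau>" "\<tau> \<le> 1"
    and A: "finite A" "card A = m * n" and \<S>: "finite \<S>" "\<And>U. U \<in> \<S> \<Longrightarrow> U \<subseteq> A"
    and small: "2 * card \<S> * m * exp (- (\<tau>\<^sup>2 * n / 8)) < 1"
  shows "\<exists>f :: 'a \<Rightarrow> nat. (\<forall>a\<in>A. f a < m) \<and> (\<forall>j<m. card {a \<in> A. f a = j} = n) \<and>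
      (\<forall>U\<in>\<S>. \<forall>j<m. \<bar>real (card {a \<in> U. f a = j}) - real (card U) / m\<bar> \<le> \<tau> * n)"
proof -
  define \<T> where "\<T> = \<S> \<union> (\<lambda>U. A - U) ` \<S>"
  have "card \<T> \<le> card \<S> + card ((\<lambda>U. A - U) ` \<S>)" unfolding \<T>_def by (rule card_Un_le)
  also have "\<dots> \<le> 2 * card \<S>" using card_image_le[OF \<S>(1), of "\<lambda>U. A - U"] by simp
  finally have "real (card \<T>) \<le> 2 * real (card \<S>)" by linarith
  then have "card \<T> * m * exp (- (\<tau>\<^sup>2 * n / 8)) \<le> (2 * real (card \<S>)) * m * exp (- (\<tau>\<^sup>2 * n / 8))"
    unfolding of_nat_mult by (intro mult_right_mono) auto
  then have "card \<T> * m * exp (- (\<tau>\<^sup>2 * n / 8)) < 1" using small by simp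
  then obtain f :: "'a \<Rightarrow> nat" where f: "\<forall>a\<in>A. f a < m" "\<forall>j<m. card {a \<in> A. f a = j} = n"
    "\<forall>U\<in>\<T>. \<forall>j<m. real (card {a \<in> U. f a = j}) \<le> real (card U) / m + \<tau> * n"
    using random_equipartition[OF m t A, of \<T>] \<S> unfolding \<T>_def by blast
  have "\<bar>real (card {a \<in> U. f a = j}) - real (card U) / m\<bar> \<le> \<tau> * n" if U: "U \<in> \<S>" and j: "j < m" for U j
  proof -
    have UA: "U \<subseteq> A" using U \<S> by blast
    then have finU: "finite U" using A finite_subset by blast
    have 1: "real (card {a \<in> U. f a = j}) \<le> real (card U) / m + \<tau> * n" using f(3) U j unfolding \<T>_def by blast
    have 2: "real (card {a \<in> A - U. f a = j}) \<le> real (card (A - U)) / m + \<tau> * n" using f(3) U j unfolding \<T>_def by blast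
    have "{a \<in> A - U. f a = j} = {a \<in> A. f a = j} - {a \<in> U. f a = j}" by auto
    then have "real (card {a \<in> A - U. f a = j}) = n - real (card {a \<in> U. f a = j})"
      using f(2) j UA finU A card_mono[of "{a \<in> A. f a = j}" "{a \<in> U. f a = j}"]
      by (simp add: card_Diff_subset Collect_mono_iff subset_iff of_nat_diff)
    moreover have "real (card (A - U)) / m = n - real (card U) / m"
      using UA finU A card_mono[OF A(1) UA] m by (simp add: card_Diff_subset of_nat_diff field_simps)
    ultimately show ?thesis using 1 2 by linarith
  qed
  then show ?thesis using f by blast
qed

section \<open>The theorem of Ghouila-Houri with exceptional vertices\<close>

definition cycle_list :: "('a \<Rightarrow> 'a \<Rightarrow> bool) \<Rightarrow> 'a list \<Rightarrow> bool" where
  "cycle_list R vs \<longleftrightarrow> vs \<noteq> [] \<and> distinct vs \<and> successively R vs \<and> R (last vs) (hd vs)"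

lemma cycle_list_append_commute: "cycle_list R (xs @ ys) \<Longrightarrow> cycle_list R (ys @ xs)"
  by (cases "xs = []"; cases "ys = []") (auto simp: cycle_list_def successively_append_iff)

lemma cycle_list_rotate: "cycle_list R vs \<Longrightarrow> cycle_list R (rotate k vs)"
proof (induction k)
  case (Suc k)
  then have c: "cycle_list R (rotate k vs)" by simp
  then obtain x xs where xs: "rotate k vs = [x] @ xs" by (metis append_Cons append_Nil cycle_list_def list.exhaust)
  show ?case using cycle_list_append_commute[of R "[x]" xs] c xs by simp
qed simp

lemma cycle_list_rev: "cycle_list R vs \<Longrightarrow> cycle_list (\<lambda>x y. R y x) (rev vs)"
  by (auto simp: cycle_list_def hd_rev last_rev)

text \<open>The union is the sumset of S and an interval of k + 1 residues modulo l. One more shift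
  adds an element unless the set is closed under adding 1, and then it contains all
  residues.\<close>

lemma card_cyclic_interval_sum:
  fixes S :: "nat set"
  assumes S: "S \<subseteq> {..<l}" "S \<noteq> {}"
  shows "min l (card S + k) \<le> card (\<Union>t\<in>{1..Suc k}. (\<lambda>i. (i + t) mod l) ` S)"
proof (induction k)
  case 0
  have "inj_on (\<lambda>i. (i + 1) mod l) S"
    using S by (auto simp: inj_on_def mod_Suc subset_iff split: if_splits)
  then show ?case by (simp add: card_image)
next
  case (Suc k)
  define X where "X = (\<Union>t\<in>{1..Suc k}. (\<lambda>i. (i + t) mod l) ` S)"
  define Y where "Y = (\<Union>t\<in>{1..Suc (Suc k)}. (\<lambda>i. (i + t) mod l) ` S)"
  have l: "l > 0" using S by auto
  have finX: "X \<subseteq> {..<l}" "Y \<subseteq> {..<l}" unfolding X_def Y_def using l by auto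
  have fin: "finite X" "finite Y" using finX finite_subset by blast+
  have XY: "X \<subseteq> Y" unfolding X_def Y_def by (intro UN_mono) auto
  have sY: "(x + 1) mod l \<in> Y" if x: "x \<in> X" for x
  proof -
    obtain t i where t: "t \<in> {1..Suc k}" "i \<in> S" "x = (i + t) mod l" using x unfolding X_def by auto
    then have "(x + 1) mod l = (i + Suc t) mod l" by (simp add: mod_simps)
    moreover have "Suc t \<in> {1..Suc (Suc k)}" using t by auto
    ultimately show ?thesis using t(2) unfolding Y_def by blast
  qed
  show ?case
  proof (cases "Y = X")
    case False
    then have "card X < card Y" using XY fin by (intro psubset_card_mono) auto
    then show ?thesis using Suc unfolding X_def Y_def by simp
  next
    case True
    obtain i where "i \<in> S" using S by auto
    then have i: "(i + 1) mod l \<in> X" unfolding X_def by (intro UN_I[of 1]) auto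
    have orb: "(i + 1 + r) mod l \<in> X" for r
    proof (induction r)
      case (Suc r)
      have "((i + 1 + r) mod l + 1) mod l \<in> X" using sY[OF Suc] True by blast
      moreover have "((i + 1 + r) mod l + 1) mod l = (i + 1 + Suc r) mod l" by (simp add: mod_Suc_eq)
      ultimately show ?case by (simp only:)
    qed (use i in simp)
    then have "x \<in> X" if "x < l" for x
    proof -
      have "1 * (i + 1) \<le> l * (i + 1)" using l by (intro mult_right_mono) auto
      then have "i + 1 + (x + l * (i + 1) - (i + 1)) = x + l * (i + 1)"
        by (intro le_add_diff_inverse trans_le_add2) simp
      then have "(x + l * (i + 1)) mod l \<in> X" using orb[of "x + l * (i + 1) - (i + 1)"] by (simp only:)
      moreover have "(x + l * (i + 1)) mod l = x" using that by (metis mod_less mod_mult_self2)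
      ultimately show ?thesis by (simp only:)
    qed
    then have "X = {..<l}" using finX by auto
    then show ?thesis using True unfolding Y_def[symmetric] by simp
  qed
qed

text \<open>Loops are not counted: the relation in \<open>cyclic_link\<close> may relate a vertex to
  itself, which does not help a cycle through several vertices.\<close>

definition out_nbrs :: "'a set \<Rightarrow> ('a \<Rightarrow> 'a \<Rightarrow> bool) \<Rightarrow> 'a \<Rightarrow> 'a set" where
  "out_nbrs V R v = {u \<in> V. u \<noteq> v \<and> R v u}"

definition in_nbrs :: "'a set \<Rightarrow> ('a \<Rightarrow> 'a \<Rightarrow> bool) \<Rightarrow> 'a \<Rightarrow> 'a set" where
  "in_nbrs V R v = {u \<in> V. u \<noteq> v \<and> R u v}"

lemma ex_longest_list:
  assumes "finite V" and "P xs" and "\<And>xs. P xs \<Longrightarrow> distinct xs \<and> set xs \<subseteq> V"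
  shows "\<exists>ys. P ys \<and> (\<forall>zs. P zs \<longrightarrow> length zs \<le> length ys)"
proof -
  have "length zs \<le> card V" if "P zs" for zs
    using assms(3)[OF that] by (metis assms(1) card_mono distinct_card)
  then show ?thesis using ex_has_greatest_nat[of P xs length "Suc (card V)"] assms(2)
    by (metis le_imp_less_Suc)
qed

definition path_list :: "'a set \<Rightarrow> ('a \<Rightarrow> 'a \<Rightarrow> bool) \<Rightarrow> 'a list \<Rightarrow> bool" where
  "path_list V R p \<longleftrightarrow> p \<noteq> [] \<and> distinct p \<and> set p \<subseteq> V \<and> successively R p"

text \<open>The out-neighbours of the last vertex of a longest path all lie on the path, and the arc
  back to the earliest of them closes a cycle through all of them.\<close>

lemma ex_long_cycle:
  assumes fin: "finite V" and v0: "v0 \<in> V" and deg: "\<And>v. v \<in> V \<Longrightarrow> d \<le> card (out_nbrs V R v)" and d: "d \<ge> 1"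
  shows "\<exists>vs. cycle_list R vs \<and> set vs \<subseteq> V \<and> d < length vs"
proof -
  have "path_list V R [v0]" using v0 by (simp add: path_list_def)
  then obtain p where p: "path_list V R p" and pmax: "\<And>q. path_list V R q \<Longrightarrow> length q \<le> length p"
    using ex_longest_list[OF fin, of "path_list V R"] unfolding path_list_def by metis
  have pp: "p \<noteq> []" "distinct p" "set p \<subseteq> V" "successively R p" using p by (auto simp: path_list_def)
  define v where "v = last p"
  have vp: "v \<in> set p" using pp v_def by simp
  have finO: "finite (out_nbrs V R v)" using fin by (simp add: out_nbrs_def)
  have sub: "out_nbrs V R v \<subseteq> set p"
  proof
    fix u assume u: "u \<in> out_nbrs V R v"
    show "u \<in> set p"
    proof (rule ccontr)
      assume "u \<notin> set p"
      then have "path_list V R (p @ [u])" using pp u unfolding path_list_def out_nbrs_def v_def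
        by (auto simp: successively_append_iff)
      then show False using pmax by fastforce
    qed
  qed
  have "card (out_nbrs V R v) \<ge> 1" using deg[of v] d vp pp by auto
  then obtain u where "u \<in> out_nbrs V R v" by fastforce
  define Q where "Q i \<longleftrightarrow> i < length p \<and> p ! i \<in> out_nbrs V R v" for i
  have "\<exists>i. Q i" using \<open>u \<in> _\<close> sub unfolding Q_def by (metis in_set_conv_nth subsetD)
  define i where "i = (LEAST i. Q i)"
  have Qi: "Q i" unfolding i_def using \<open>\<exists>i. Q i\<close> by (rule LeastI_ex)
  have imin: "i \<le> j" if "Q j" for j unfolding i_def using that by (rule Least_le)
  let ?c = "drop i p"
  have il: "i < length p" using Qi by (simp add: Q_def)
  have "p = take i p @ ?c" by simp
  then have "successively R ?c" using pp(4) by (metis successively_append_iff)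
  then have "cycle_list R ?c"
    using il pp Qi unfolding cycle_list_def Q_def
    by (auto simp: hd_drop_conv_nth out_nbrs_def v_def)
  moreover have "insert v (out_nbrs V R v) \<subseteq> set ?c"
  proof -
    have "w \<in> set ?c" if w: "w \<in> out_nbrs V R v" for w
    proof -
      obtain j where j: "j < length p" "p ! j = w" using sub w by (metis in_set_conv_nth subsetD)
      then have "i \<le> j" using imin w by (simp add: Q_def)
      then have "w = ?c ! (j - i)" "j - i < length ?c" using j by auto
      then show ?thesis by (metis nth_mem)
    qed
    moreover have "v \<in> set ?c" using il unfolding v_def by (metis drop_eq_Nil last_drop last_in_set not_le)
    ultimately show ?thesis by blast
  qed
  then have "card (insert v (out_nbrs V R v)) \<le> length ?c"
    by (metis List.finite_set card_length card_mono order_trans)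
  then have "d < length ?c" using deg[of v] vp pp finO by (auto simp: out_nbrs_def)
  moreover have "set ?c \<subseteq> V" using pp by (meson order_trans set_drop_subset)
  ultimately show ?thesis by blast
qed

lemma card_le_if_subset_image_Un:
  assumes "X \<subseteq> f ` S \<union> Y" "finite S" "finite Y"
  shows "card X \<le> card S + card Y"
proof -
  have "card X \<le> card (f ` S \<union> Y)" using assms by (intro card_mono) auto
  also have "\<dots> \<le> card (f ` S) + card Y" by (rule card_Un_le)
  also have "\<dots> \<le> card S + card Y" using card_image_le[OF assms(2)] by simp
  finally show ?thesis .
qed

text \<open>Take a longest cycle C, of length l, and outside it a longest path P from p to q, with k
  + 1 vertices. The in-neighbours of p and the out-neighbours of q lie on C or P, so at least d - k
  of each lie on C. If one of the former precedes one of the latter by at most k + 1 steps, P can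
  replace the vertices between them and C becomes longer. Hence |S| + k + |T| \<le> l by
  \<open>card_cyclic_interval_sum\<close>, although the left side is at least 2 d - k > l.\<close>

theorem ghouila_houri:
  assumes fin: "finite V" and N: "card V \<ge> 2"
    and out: "\<And>v. v \<in> V \<Longrightarrow> card V \<le> 2 * card (out_nbrs V R v)"
    and "in": "\<And>v. v \<in> V \<Longrightarrow> card V \<le> 2 * card (in_nbrs V R v)"
  shows "\<exists>vs. cycle_list R vs \<and> set vs = V"
proof -
  define d where "d = (card V + 1) div 2"
  have d: "card V \<le> 2 * d" "d \<ge> 1" using N by (auto simp: d_def)
  have out': "d \<le> card (out_nbrs V R v)" if "v \<in> V" for v using out[OF that] by (simp add: d_def)
  have in': "d \<le> card (in_nbrs V R v)" if "v \<in> V" for v using "in"[OF that] by (simp add: d_def)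
  obtain v0 where "v0 \<in> V" using N by fastforce
  define cyc where "cyc vs \<longleftrightarrow> cycle_list R vs \<and> set vs \<subseteq> V" for vs
  obtain c0 where c0: "cyc c0" "d < length c0"
    using ex_long_cycle[OF fin \<open>v0 \<in> V\<close> out' d(2)] unfolding cyc_def by blast
  obtain C where C: "cyc C" and Cmax: "\<And>zs. cyc zs \<Longrightarrow> length zs \<le> length C"
    using ex_longest_list[OF fin, of cyc c0] c0 unfolding cyc_def cycle_list_def by metis
  define l where "l = length C"
  have l: "d < l" using c0 Cmax l_def by fastforce
  have CC: "cycle_list R C" "set C \<subseteq> V" "distinct C" using C unfolding cyc_def cycle_list_def by auto
  have lC: "card (set C) = l" using CC l_def distinct_card by blast
  show ?thesis
  proof (rule ccontr)
    assume "\<not> ?thesis"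
    then have "set C \<noteq> V" using CC by blast
    then obtain w where w: "w \<in> V" "w \<notin> set C" using CC by blast
    let ?W = "V - set C"
    have "path_list ?W R [w]" using w by (simp add: path_list_def)
    then obtain P where P: "path_list ?W R P" and Pmax: "\<And>q. path_list ?W R q \<Longrightarrow> length q \<le> length P"
      using ex_longest_list[of ?W "path_list ?W R"] fin unfolding path_list_def by (metis finite_Diff)
    have PP: "P \<noteq> []" "distinct P" "set P \<subseteq> ?W" "successively R P" using P by (auto simp: path_list_def)
    define k where "k = length P - 1"
    have lenP: "length P = Suc k" using PP(1) k_def by (cases P) auto
    have "card (set P) \<le> card ?W" using PP fin by (intro card_mono) auto
    then have kl: "Suc k + l \<le> card V"
      using lenP PP(2) lC CC(2) fin distinct_card[OF PP(2)] card_mono[OF fin CC(2)] by (simp add: card_Diff_subset)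
    define p q where "p = hd P" and "q = last P"
    have pq: "p \<in> set P" "q \<in> set P" using PP p_def q_def by auto
    then have pqV: "p \<in> V" "q \<in> V" using PP(3) by auto
    define S where "S = {i. i < l \<and> R (C ! i) p}"
    define T where "T = {j. j < l \<and> R q (C ! j)}"
    have ext: "x \<in> set P" if x: "x \<in> V" "x \<notin> set C" "R x p \<or> R q x" for x
    proof (rule ccontr)
      assume "x \<notin> set P"
      then have "R x p \<Longrightarrow> path_list ?W R (x # P)" "R q x \<Longrightarrow> path_list ?W R (P @ [x])"
        using PP x(1,2) unfolding path_list_def p_def q_def
        by (auto simp: successively_append_iff successively_Cons)
      then show False using x(3) Pmax[of "x # P"] Pmax[of "P @ [x]"] by auto
    qed
    have ixC: "\<exists>i<l. C ! i = x" if "x \<in> set C" for x using that unfolding l_def by (simp add: in_set_conv_nth)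
    have subin: "in_nbrs V R p \<subseteq> (nth C) ` S \<union> (set P - {p})"
    proof
      fix x assume "x \<in> in_nbrs V R p"
      then show "x \<in> (nth C) ` S \<union> (set P - {p})"
        using ext[of x] ixC[of x] unfolding in_nbrs_def S_def by (cases "x \<in> set C") auto
    qed
    have subout: "out_nbrs V R q \<subseteq> (nth C) ` T \<union> (set P - {q})"
    proof
      fix x assume "x \<in> out_nbrs V R q"
      then show "x \<in> (nth C) ` T \<union> (set P - {q})"
        using ext[of x] ixC[of x] unfolding out_nbrs_def T_def by (cases "x \<in> set C") auto
    qed
    have finST: "finite S" "finite T" by (auto simp: S_def T_def)
    have cP: "card (set P - {p}) = k" "card (set P - {q}) = k"
      using pq PP lenP by (auto simp: distinct_card)
    have cS: "d \<le> card S + k"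
      using card_le_if_subset_image_Un[OF subin finST(1)] in'[OF pqV(1)] cP(1) by simp
    have cT: "d \<le> card T + k"
      using card_le_if_subset_image_Un[OF subout finST(2)] out'[OF pqV(2)] cP(2) by simp
    \<comment> \<open>C has more than d of the at most 2 d vertices, which leaves fewer than d for
      P. This makes S and T nonempty.\<close>
    have kd: "Suc k < d" using kl l d by linarith
    have "card S \<noteq> 0" "card T \<noteq> 0" using cS cT kd by linarith+
    then have ST0: "S \<noteq> {}" "T \<noteq> {}" by (metis card.empty)+
    have S: "S \<subseteq> {..<l}" "S \<noteq> {}" using ST0 by (auto simp: S_def)
    have T: "T \<subseteq> {..<l}" "T \<noteq> {}" using ST0 by (auto simp: T_def)
    define X where "X = (\<Union>t\<in>{1..Suc k}. (\<lambda>i. (i + t) mod l) ` S)"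
    have "X \<inter> T = {}"
    proof (rule ccontr)
      assume "X \<inter> T \<noteq> {}"
      then obtain i t where it: "i \<in> S" "1 \<le> t" "t \<le> Suc k" "(i + t) mod l \<in> T" unfolding X_def by auto
      \<comment> \<open>After rotation by i + t the list starts at the out-neighbour of q, and its
        first l - t + 1 entries end at position i of C. The path P replaces the t - 1 \<le> k
        entries that are cut off.\<close>
      define C' where "C' = rotate (i + t) C"
      define D where "D = take (Suc (l - t)) C'"
      have C': "cycle_list R C'" "set C' = set C" "length C' = l" unfolding C'_def using CC(1)
        by (auto simp: cycle_list_rotate l_def)
      have tl: "t < l" using it(3) kd l by linarith
      have lenD: "length D = Suc (l - t)" unfolding D_def using C'(3) it(2) tl by simp
      then have Dne: "D \<noteq> []" by auto
      have "hd D = C' ! 0" using Dne C' by (metis D_def hd_conv_nth length_greater_0_conv nth_take zero_less_Suc)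
      also have "\<dots> = C ! ((i + t) mod l)" unfolding C'_def using l by (subst nth_rotate) (auto simp: l_def)
      finally have hdD: "R q (hd D)" using it(4) unfolding T_def by simp
      have "last D = D ! (l - t)" using Dne lenD by (simp add: last_conv_nth)
      also have "\<dots> = C' ! (l - t)" unfolding D_def by simp
      also have "\<dots> = C ! ((i + t + (l - t)) mod l)" unfolding C'_def
        using tl it(2) by (subst nth_rotate) (auto simp: l_def)
      also have "i + t + (l - t) = i + l" using tl by simp
      also have "(i + l) mod l = i" using it(1) by (simp add: S_def)
      finally have lastD: "R (last D) p" using it(1) by (simp add: S_def)
      have "successively R (D @ drop (Suc (l - t)) C')" using C'(1) unfolding D_def cycle_list_def by simp
      then have "successively R D" by (metis successively_append_iff)
      moreover have "distinct D" "set D \<subseteq> set C" using C' unfolding D_def cycle_list_def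
        by (auto dest: in_set_takeD)
      ultimately have "cyc (D @ P)" using PP hdD lastD Dne CC unfolding cyc_def cycle_list_def p_def q_def
        by (auto simp: successively_append_iff)
      then have "length (D @ P) \<le> l" using Cmax l_def by blast
      then show False using lenD lenP it tl by simp
    qed
    have Xl: "X \<subseteq> {..<l}" unfolding X_def using l by auto
    then have "finite X" using finite_subset by blast
    then have "card X + card T = card (X \<union> T)" using \<open>X \<inter> T = {}\<close> finST by (simp add: card_Un_disjoint)
    also have "\<dots> \<le> card {..<l}" using Xl T by (intro card_mono) auto
    finally have "card X + card T \<le> l" by simp
    moreover have "min l (card S + k) \<le> card X" unfolding X_def by (rule card_cyclic_interval_sum[OF S])
    moreover have "card T > 0" using T finST by (simp add: card_gt_0_iff)
    ultimately have "card S + k + card T \<le> l" by linarith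
    then show False using cS cT kl d by linarith
  qed
qed

section \<open>Exceptional vertices of low degree\<close>

lemma card_le_Suc_if_Diff_subset:
  assumes "A - {x} \<subseteq> B" "finite B" shows "card A \<le> Suc (card B)"
proof -
  have "card A \<le> card (insert x B)" using assms by (intro card_mono) auto
  also have "\<dots> \<le> Suc (card B)" using assms(2) by (simp add: card_insert_if)
  finally show ?thesis .
qed

text \<open>Contracting an arc into an exceptional vertex removes that vertex; all degrees drop by at most one.\<close>

lemma ghouila_houri_contract:
  assumes IH: "\<And>(V :: 'a set) R I J. finite V \<Longrightarrow> r + 2 \<le> card V \<Longrightarrow> I \<subseteq> V \<Longrightarrow> J \<subseteq> V \<Longrightarrow> card I + card J \<le> r \<Longrightarrow>
      (\<And>v. v \<in> V - I \<Longrightarrow> card V + 2 * r \<le> 2 * card (in_nbrs V R v)) \<Longrightarrow>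
      (\<And>v. v \<in> I \<Longrightarrow> r \<le> card (in_nbrs V R v)) \<Longrightarrow>
      (\<And>v. v \<in> V - J \<Longrightarrow> card V + 2 * r \<le> 2 * card (out_nbrs V R v)) \<Longrightarrow>
      (\<And>v. v \<in> J \<Longrightarrow> r \<le> card (out_nbrs V R v)) \<Longrightarrow> \<exists>vs. cycle_list R vs \<and> set vs = V"
    and fin: "finite (V :: 'a set)" and N: "Suc r + 2 \<le> card V" and IJ: "I \<subseteq> V" "J \<subseteq> V" "card I + card J \<le> Suc r"
    and ini: "\<And>v. v \<in> V - I \<Longrightarrow> card V + 2 * Suc r \<le> 2 * card (in_nbrs V R v)"
      "\<And>v. v \<in> I \<Longrightarrow> Suc r \<le> card (in_nbrs V R v)"
    and outi: "\<And>v. v \<in> V - J \<Longrightarrow> card V + 2 * Suc r \<le> 2 * card (out_nbrs V R v)"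
      "\<And>v. v \<in> J \<Longrightarrow> Suc r \<le> card (out_nbrs V R v)"
    and v: "v \<in> I"
  shows "\<exists>vs. cycle_list R vs \<and> set vs = V"
proof -
  have vV: "v \<in> V" using v IJ by auto
  have "in_nbrs V R v \<noteq> {}" using ini(2)[OF v] by auto
  then obtain u where u: "u \<in> V" "u \<noteq> v" "R u v" unfolding in_nbrs_def by auto
  define V' where "V' = V - {v}"
  \<comment> \<open>The contracted arc is represented by u, which keeps the in-neighbours of u and
    takes over the out-neighbours of v. Accordingly u is exceptional for out-degrees in
    \<open>J'\<close> exactly if v was in \<open>J\<close>.\<close>
  define R' where "R' a b = (if a = u then R v b else R a b)" for a b
  define I' where "I' = I - {v}"
  define J' where "J' = (J - {v, u}) \<union> (if v \<in> J then {u} else {})"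
  have finV': "finite V'" using fin V'_def by simp
  have cV': "Suc (card V') = card V" unfolding V'_def using fin vV by (metis card_Suc_Diff1)
  have finIJ: "finite I" "finite J" using IJ fin finite_subset by auto
  have cI: "Suc (card I') = card I" unfolding I'_def using finIJ v by (metis card_Suc_Diff1)
  have cJ: "card J' \<le> card J"
  proof (cases "v \<in> J")
    case True
    then have "J' = insert u (J - {v, u})" by (auto simp: J'_def)
    then have "card J' \<le> Suc (card (J - {v, u}))" by (simp add: card_insert_if finIJ)
    also have "\<dots> \<le> Suc (card (J - {v}))" using finIJ by (auto intro: card_mono)
    also have "\<dots> = card J" using card_Suc_Diff1[OF finIJ(2) True] .
    finally show ?thesis .
  next
    case False then show ?thesis unfolding J'_def using finIJ by (auto intro: card_mono)
  qed
  \<comment> \<open>If v and u both point to b, they merge into one in-neighbour; if u does but v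
    does not, the arc from u disappears. At most one in-neighbour is lost.\<close>
  have din: "card (in_nbrs V R b) \<le> Suc (card (in_nbrs V' R' b))" if b: "b \<in> V'" for b
  proof (cases "R v b")
    case True
    have "in_nbrs V R b - {v} \<subseteq> in_nbrs V' R' b" using True u b unfolding in_nbrs_def V'_def R'_def by auto
    then show ?thesis by (rule card_le_Suc_if_Diff_subset) (simp add: in_nbrs_def finV')
  next
    case False
    have "in_nbrs V R b - {u} \<subseteq> in_nbrs V' R' b" using False u b unfolding in_nbrs_def V'_def R'_def by auto
    then show ?thesis by (rule card_le_Suc_if_Diff_subset) (simp add: in_nbrs_def finV')
  qed
  have dout: "card (out_nbrs V R a) \<le> Suc (card (out_nbrs V' R' a))" if a: "a \<in> V'" "a \<noteq> u" for a
  proof -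
    have "out_nbrs V R a - {v} \<subseteq> out_nbrs V' R' a" using u a unfolding out_nbrs_def V'_def R'_def by auto
    then show ?thesis by (rule card_le_Suc_if_Diff_subset) (simp add: out_nbrs_def finV')
  qed
  have doutu: "card (out_nbrs V R v) \<le> Suc (card (out_nbrs V' R' u))"
  proof -
    have "out_nbrs V R v - {u} \<subseteq> out_nbrs V' R' u" using u unfolding out_nbrs_def V'_def R'_def by auto
    then show ?thesis by (rule card_le_Suc_if_Diff_subset) (simp add: out_nbrs_def finV')
  qed
  have "\<exists>vs. cycle_list R' vs \<and> set vs = V'"
  proof (rule IH[OF finV', where I = I' and J = J'])
    show "r + 2 \<le> card V'" using N cV' by simp
    show "I' \<subseteq> V'" "J' \<subseteq> V'" using IJ u by (auto simp: I'_def J'_def V'_def)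
    show "card I' + card J' \<le> r" using cI cJ IJ(3) by linarith
    fix b
    show "card V' + 2 * r \<le> 2 * card (in_nbrs V' R' b)" if "b \<in> V' - I'"
      using that ini(1)[of b] din[of b] cV' by (auto simp: V'_def I'_def)
    show "r \<le> card (in_nbrs V' R' b)" if "b \<in> I'"
      using that ini(2)[of b] din[of b] IJ by (auto simp: V'_def I'_def)
    show "card V' + 2 * r \<le> 2 * card (out_nbrs V' R' b)" if b: "b \<in> V' - J'"
    proof (cases "b = u")
      case True
      then have "v \<notin> J" using b by (auto simp: J'_def)
      then show ?thesis using True outi(1)[of v] vV doutu cV' by auto
    next
      case False
      then have "b \<in> V - J" using b by (auto simp: J'_def V'_def)
      then show ?thesis using False outi(1)[of b] dout[of b] b cV' by auto
    qed
    show "r \<le> card (out_nbrs V' R' b)" if b: "b \<in> J'"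
    proof (cases "b = u")
      case True
      then have "v \<in> J" using b by (auto simp: J'_def split: if_splits)
      then show ?thesis using True outi(2)[of v] doutu by auto
    next
      case False
      then have "b \<in> J" "b \<in> V'" using b IJ by (auto simp: J'_def V'_def split: if_splits)
      then show ?thesis using False outi(2)[of b] dout[of b] by auto
    qed
  qed
  then obtain vs where vs: "cycle_list R' vs" "set vs = V'" by blast
  have "u \<in> set vs" using vs u by (auto simp: V'_def)
  then obtain xs ys where "vs = xs @ u # ys" by (meson split_list)
  then have c: "cycle_list R' (u # ys @ xs)" and st: "set (u # ys @ xs) = V'"
    using vs cycle_list_append_commute[of R' xs "u # ys"] by auto
  define ws where "ws = ys @ xs"
  have dist: "distinct (u # ws)" and suc: "successively R' (u # ws)" and lst: "R' (last (u # ws)) u"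
    using c unfolding ws_def[symmetric] cycle_list_def by auto
  have "successively R ws \<longleftrightarrow> successively R' ws"
    by (rule successively_cong) (use dist in \<open>auto simp: R'_def\<close>)
  then have sR: "successively R ws" using suc by (cases ws) auto
  have st': "insert u (set ws) = V - {v}" using st unfolding ws_def V'_def by auto
  then have vws: "v \<noteq> u" "v \<notin> set ws" using u by auto
  have "cycle_list R (u # v # ws)"
  proof (cases ws)
    case Nil
    then show ?thesis using u lst unfolding cycle_list_def R'_def by simp
  next
    case (Cons w rs)
    have "last ws \<noteq> u" using dist Cons by (metis distinct.simps(2) last_in_set list.distinct(1))
    then have "R (last ws) u" using lst Cons unfolding R'_def by simp
    moreover have "R v (hd ws)" using suc Cons unfolding R'_def by simp
    ultimately show ?thesis using dist vws u(3) sR Cons unfolding cycle_list_def by simp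
  qed
  moreover have "set (u # v # ws) = V" using st' vV by auto
  ultimately show ?thesis by blast
qed

text \<open>Every contraction uses up one member of I or J and at most one unit of each degree, so r
  units are enough, and the surplus r over |V|/2 leaves Ghouila-Houri applicable. A member of J is
  treated by reversing all arcs.\<close>

lemma ghouila_houri_exceptional:
  assumes "finite V" "r + 2 \<le> card V" "I \<subseteq> V" "J \<subseteq> V" "card I + card J \<le> r"
    and "\<And>v. v \<in> V - I \<Longrightarrow> card V + 2 * r \<le> 2 * card (in_nbrs V R v)"
    and "\<And>v. v \<in> I \<Longrightarrow> r \<le> card (in_nbrs V R v)"
    and "\<And>v. v \<in> V - J \<Longrightarrow> card V + 2 * r \<le> 2 * card (out_nbrs V R v)"
    and "\<And>v. v \<in> J \<Longrightarrow> r \<le> card (out_nbrs V R v)"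
  shows "\<exists>vs. cycle_list R vs \<and> set vs = V"
  using assms
proof (induction r arbitrary: V R I J)
  case 0
  then have "finite I" "finite J" using finite_subset by metis+
  then have "I = {}" "J = {}" using 0 by (auto simp: card_eq_0_iff)
  then show ?case using ghouila_houri[OF 0(1)] 0 by simp
next
  case (Suc r)
  have finIJ: "finite I" "finite J" using Suc.prems finite_subset by auto
  consider v where "v \<in> I" | v where "v \<in> J" | "I = {}" "J = {}" by blast
  then show ?case
  proof cases
    case 1
    show ?thesis by (rule ghouila_houri_contract[OF Suc.IH Suc.prems 1])
  next
    case 2
    have sw: "in_nbrs V (\<lambda>x y. R y x) v = out_nbrs V R v" "out_nbrs V (\<lambda>x y. R y x) v = in_nbrs V R v" for v
      by (auto simp: in_nbrs_def out_nbrs_def)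
    have "\<exists>vs. cycle_list (\<lambda>x y. R y x) vs \<and> set vs = V"
      by (rule ghouila_houri_contract[where I = J and J = I, OF Suc.IH _ _ _ _ _ _ _ _ _ 2])
        (use Suc.prems in \<open>auto simp: sw\<close>)
    then obtain vs where "cycle_list (\<lambda>x y. R y x) vs" "set vs = V" by blast
    then show ?thesis using cycle_list_rev[of "\<lambda>x y. R y x" vs] by (metis set_rev)
  next
    case 3
    show ?thesis by (rule ghouila_houri[OF Suc.prems(1)]) (use Suc.prems 3 in force)+
  qed
qed

lemma cycle_list_successor:
  assumes c: "cycle_list R vs" and V: "set vs = V"
  shows "\<exists>h. bij_betw h V V \<and> (\<forall>v\<in>V. R v (h v)) \<and> (\<forall>u\<in>V. \<forall>v\<in>V. \<exists>k. (h ^^ k) u = v)"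
proof -
  define l where "l = length vs"
  have l: "l > 0" and dist: "distinct vs" using c by (auto simp: l_def cycle_list_def)
  have bij: "bij_betw (nth vs) {..<l} V" using dist V by (simp add: bij_betw_nth l_def)
  define ix where "ix = the_inv_into {..<l} (nth vs)"
  have ix: "ix (vs ! i) = i" if "i < l" for i
    unfolding ix_def using bij that by (simp add: bij_betw_def the_inv_into_f_f)
  define h where "h v = vs ! (Suc (ix v) mod l)" for v
  have hn: "h (vs ! i) = vs ! (Suc i mod l)" if "i < l" for i using ix[OF that] h_def by simp
  have ex: "\<exists>i<l. v = vs ! i" if "v \<in> V" for v using that V by (metis in_set_conv_nth l_def)
  have pw: "(h ^^ k) (vs ! i) = vs ! ((i + k) mod l)" if "i < l" for i k
  proof (induction k)
    case (Suc k)
    have "(h ^^ Suc k) (vs ! i) = vs ! (Suc ((i + k) mod l) mod l)" using Suc l hn by simp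
    then show ?case by (simp add: mod_Suc_eq)
  qed (use that in simp)
  have "h v \<in> V" if "v \<in> V" for v using V l unfolding h_def l_def by auto
  moreover have "\<exists>k. (h ^^ k) u = v" if uv: "u \<in> V" "v \<in> V" for u v
  proof -
    obtain i j where ij: "i < l" "u = vs ! i" "j < l" "v = vs ! j" using ex[OF uv(1)] ex[OF uv(2)] by auto
    have "(h ^^ (j + l - i)) u = v" using pw[OF ij(1), of "j + l - i"] ij by simp
    then show ?thesis by blast
  qed
  moreover have "V \<subseteq> h ` V"
  proof
    fix v assume "v \<in> V"
    then obtain j where j: "j < l" "v = vs ! j" using ex by auto
    have "h (vs ! ((j + l - 1) mod l)) = vs ! (Suc (j + l - 1) mod l)" using l by (simp add: hn mod_Suc_eq)
    also have "\<dots> = v" using j l by simp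
    finally show "v \<in> h ` V" using l V by (metis imageI l_def mod_less_divisor nth_mem)
  qed
  moreover have "R v (h v)" if "v \<in> V" for v
  proof -
    have "\<exists>i<l. v = vs ! i" by (rule ex) (rule that)
    then obtain i where i: "i < l" "v = vs ! i" by (elim exE conjE)
    show ?thesis
    proof (cases "Suc i < l")
      case True
      have "R (vs ! i) (vs ! Suc i)" using c True unfolding cycle_list_def successively_conv_nth l_def by blast
      moreover have "h v = vs ! Suc i" using hn[OF i(1)] i True by simp
      ultimately show ?thesis using i by simp
    next
      case False
      then have "Suc i = l" using i by simp
      then have i': "i = length vs - 1" "i < length vs" using l_def by auto
      have "h v = vs ! 0" using hn[OF i(1)] i(2) \<open>Suc i = l\<close> by simp
      moreover have "vs \<noteq> []" using c by (simp add: cycle_list_def)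
      ultimately have "h v = hd vs" "v = last vs" using i(2) i'(1) by (simp_all add: last_conv_nth hd_conv_nth)
      then show ?thesis using c by (simp add: cycle_list_def)
    qed
  qed
  ultimately have "h ` V = V" and 1: "\<forall>v\<in>V. R v (h v)" "\<forall>u\<in>V. \<forall>v\<in>V. \<exists>k. (h ^^ k) u = v" by auto
  have "finite V" using V by auto
  then have "inj_on h V" using \<open>h ` V = V\<close> by (simp add: eq_card_imp_inj_on)
  then show ?thesis using 1 \<open>h ` V = V\<close> unfolding bij_betw_def by blast
qed

section \<open>Matchings along block patterns\<close>

text \<open>The vertices are paths, each named by its end p and starting in \<theta> p; there is an
  arc from p to u if F leads from p to the start \<theta> u. Low out-degrees come from
  \<open>P0\<close> and low in-degrees from \<open>Q0\<close>, hence r = 2 \<rho>. The summands 2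
  and 1 pay for a possible loop at p, which the neighbour sets ignore.\<close>

lemma cyclic_link:
  fixes F :: "'a \<Rightarrow> 'b \<Rightarrow> bool"
  assumes finP: "finite P" and \<theta>: "bij_betw \<theta> P Q" and sub: "P0 \<subseteq> P" "Q0 \<subseteq> Q"
    and card: "card P0 \<le> \<rho>" "card Q0 \<le> \<rho>" and N: "2 * \<rho> + 2 \<le> card P"
    and d1: "\<And>p. p \<in> P - P0 \<Longrightarrow> card P + 4 * \<rho> + 2 \<le> 2 * card {q \<in> Q. F p q}"
    and d2: "\<And>p. p \<in> P0 \<Longrightarrow> 2 * \<rho> + 1 \<le> card {q \<in> Q. F p q}"
    and d3: "\<And>q. q \<in> Q - Q0 \<Longrightarrow> card P + 4 * \<rho> + 2 \<le> 2 * card {p \<in> P. F p q}"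
    and d4: "\<And>q. q \<in> Q0 \<Longrightarrow> 2 * \<rho> + 1 \<le> card {p \<in> P. F p q}"
  shows "\<exists>h. bij_betw h P P \<and> (\<forall>p\<in>P. F p (\<theta> (h p))) \<and> (\<forall>u\<in>P. \<forall>v\<in>P. \<exists>k. (h ^^ k) u = v)"
proof -
  define R where "R p u = F p (\<theta> u)" for p u
  define I where "I = {p \<in> P. \<theta> p \<in> Q0}"
  have \<theta>Q: "\<theta> p \<in> Q" if "p \<in> P" for p using \<theta> that by (meson bij_betwE)
  have inj: "inj_on \<theta> P" and im: "\<theta> ` P = Q" using \<theta> by (auto simp: bij_betw_def)
  have out: "card {q \<in> Q. F p q} \<le> Suc (card (out_nbrs P R p))" if "p \<in> P" for p
  proof -
    have "{q \<in> Q. F p q} = \<theta> ` {u \<in> P. F p (\<theta> u)}" using im by auto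
    then have "card {q \<in> Q. F p q} \<le> card {u \<in> P. F p (\<theta> u)}" using finP by (simp add: card_image_le)
    also have "\<dots> \<le> Suc (card (out_nbrs P R p))"
      by (rule card_le_Suc_if_Diff_subset[of _ p]) (use finP in \<open>auto simp: out_nbrs_def R_def\<close>)
    finally show ?thesis .
  qed
  have inn: "card {u \<in> P. F u (\<theta> p)} \<le> Suc (card (in_nbrs P R p))" for p
    by (rule card_le_Suc_if_Diff_subset[of _ p]) (use finP in \<open>auto simp: in_nbrs_def R_def\<close>)
  have "card I \<le> \<rho>"
  proof -
    have "card I = card (\<theta> ` I)" using inj by (metis (no_types, lifting) I_def card_image inj_on_subset mem_Collect_eq subsetI)
    also have "\<dots> \<le> card Q0" using sub(2) finP im by (intro card_mono) (auto simp: I_def dest: finite_subset)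
    finally show ?thesis using card by simp
  qed
  have "\<exists>vs. cycle_list R vs \<and> set vs = P"
  proof (rule ghouila_houri_exceptional[where I = I and J = P0 and r = "2 * \<rho>"])
    show "card I + card P0 \<le> 2 * \<rho>" using card \<open>card I \<le> \<rho>\<close> by simp
    fix v
    show "card P + 2 * (2 * \<rho>) \<le> 2 * card (in_nbrs P R v)" if "v \<in> P - I"
      using that inn[of v] d3[of "\<theta> v"] \<theta>Q[of v] by (auto simp: I_def)
    show "2 * \<rho> \<le> card (in_nbrs P R v)" if "v \<in> I"
      using that inn[of v] d4[of "\<theta> v"] by (auto simp: I_def)
    show "card P + 2 * (2 * \<rho>) \<le> 2 * card (out_nbrs P R v)" if "v \<in> P - P0"
      using that out[of v] d1[of v] by auto
    show "2 * \<rho> \<le> card (out_nbrs P R v)" if "v \<in> P0"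
      using that out[of v] d2[of v] sub by auto
  qed (use finP N sub in \<open>auto simp: I_def\<close>)
  then obtain vs where "cycle_list R vs" "set vs = P" by blast
  from cycle_list_successor[OF this] show ?thesis unfolding R_def .
qed

definition block :: "('a \<Rightarrow> int) \<Rightarrow> 'a set \<Rightarrow> int \<Rightarrow> 'a set" where
  "block f P x = {p \<in> P. f p = x}"

text \<open>Blocks are indexed by nonnegative integers; block -1 holds the few vertices left over when
  the number of vertices is not a multiple of the number of blocks.\<close>

locale block_stage =
  fixes P :: "'a set" and Q :: "'b set" and f :: "'a \<Rightarrow> int" and g :: "'b \<Rightarrow> int" and G :: "('a \<times> 'b) set"
    and I :: "int set" and T :: "'t set" and x y :: "'t \<Rightarrow> int" and \<pi> :: "'t \<Rightarrow> int \<Rightarrow> int"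
    and W :: "(int \<times> int) set" and k L L' n \<rho> \<delta> :: nat
  assumes fin: "finite P" "finite Q" "finite T"
    and fP: "\<And>p. p \<in> P \<Longrightarrow> f p \<in> insert (-1) I" and gQ: "\<And>q. q \<in> Q \<Longrightarrow> g q \<in> insert (-1) I"
    and I: "-1 \<notin> I"
    and xI: "\<And>t. t \<in> T \<Longrightarrow> x t \<in> I"
    and bij\<pi>: "\<And>t. t \<in> T \<Longrightarrow> bij_betw (\<pi> t) I I" and \<pi>x: "\<And>t. t \<in> T \<Longrightarrow> \<pi> t (x t) = y t"
    and special: "\<And>t. t \<in> T \<Longrightarrow> (x t, y t) \<in> W"
    and generic: "\<And>t i. t \<in> T \<Longrightarrow> i \<in> I \<Longrightarrow> i \<noteq> x t \<Longrightarrow> (i, \<pi> t i) \<notin> W"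
    and load: "\<And>i j. i \<in> I \<Longrightarrow> j \<in> I \<Longrightarrow> card {t \<in> T. i \<noteq> x t \<and> \<pi> t i = j} \<le> k"
    and loadxy: "\<And>i j. i \<in> I \<Longrightarrow> j \<in> I \<Longrightarrow> card {t \<in> T. x t = i \<and> y t = j} \<le> L"
    and loadx: "\<And>i. i \<in> I \<Longrightarrow> card {t \<in> T. x t = i} \<le> L'"
    and loady: "\<And>i. i \<in> I \<Longrightarrow> card {t \<in> T. y t = i} \<le> L'"
    and cP: "\<And>i. i \<in> I \<Longrightarrow> card (block f P i) = n" and cQ: "\<And>i. i \<in> I \<Longrightarrow> card (block g Q i) = n"
    and cP0: "card (block f P (-1)) = \<rho>" and cQ0: "card (block g Q (-1)) = \<rho>"
    and matchings: "\<And>i j. i \<in> I \<Longrightarrow> j \<in> I \<Longrightarrow> \<exists>F :: nat \<Rightarrow> 'a \<Rightarrow> 'b.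
      (\<forall>a<k. bij_betw (F a) (block f P i) (block g Q j) \<and> (\<forall>p\<in>block f P i. (p, F a p) \<in> G)) \<and>
      (\<forall>a<k. \<forall>b<k. a \<noteq> b \<longrightarrow> (\<forall>p\<in>block f P i. F a p \<noteq> F b p))"
    and degP: "\<And>p j. p \<in> P \<Longrightarrow> j \<in> I \<Longrightarrow> \<delta> \<le> card {q \<in> block g Q j. (p, q) \<in> G}"
    and degQ: "\<And>q i. q \<in> Q \<Longrightarrow> i \<in> I \<Longrightarrow> \<delta> \<le> card {p \<in> block f P i. (p, q) \<in> G}"
    and large: "n + 5 * \<rho> + 2 + 2 * L \<le> 2 * \<delta>" "2 * \<rho> + 1 + L' \<le> \<delta>" "2 * \<rho> + 2 \<le> n"
begin

text \<open>In pattern t the arcs out of the block \<open>x t\<close> and out of the leftover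
  vertices are chosen by Ghouila-Houri and end in \<open>Qt t\<close>; all others come from block
  matchings. The leftover vertices belong to every \<open>Pt t\<close>, because no block matching
  reaches them.\<close>

definition Pt :: "'t \<Rightarrow> 'a set" where "Pt t = block f P (x t) \<union> block f P (-1)"
definition Qt :: "'t \<Rightarrow> 'b set" where "Qt t = block g Q (y t) \<union> block g Q (-1)"

lemma yI: "t \<in> T \<Longrightarrow> y t \<in> I"
  using bij\<pi> \<pi>x xI by (metis bij_betwE)

lemma fin_block: "finite (block f P i)" "finite (block g Q j)"
  using fin by (auto simp: block_def)

lemma card_Pt: "t \<in> T \<Longrightarrow> card (Pt t) = n + \<rho>"
  unfolding Pt_def using I xI fin_block cP cP0 by (subst card_Un_disjoint) (auto simp: block_def)

lemma card_Qt: "t \<in> T \<Longrightarrow> card (Qt t) = n + \<rho>"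
  unfolding Qt_def using I yI fin_block cQ cQ0 by (subst card_Un_disjoint) (auto simp: block_def)

lemma Pt_sub: "Pt t \<subseteq> P" and Qt_sub: "Qt t \<subseteq> Q"
  by (auto simp: Pt_def Qt_def block_def)

lemma P_minus_Pt: "t \<in> T \<Longrightarrow> P - Pt t = (\<Union>i\<in>I - {x t}. block f P i)"
  using fP I by (auto simp: Pt_def block_def)

lemma Q_minus_Qt: "t \<in> T \<Longrightarrow> Q - Qt t = (\<Union>i\<in>I - {x t}. block g Q (\<pi> t i))"
proof -
  assume t: "t \<in> T"
  have "bij_betw (\<pi> t) (I - {x t}) (I - {y t})"
    using bij_betw_DiffI[OF bij\<pi>[OF t], of "{x t}" "{y t}"] \<pi>x[OF t] xI[OF t] yI[OF t] by (simp add: bij_betw_def)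
  then have "I - {y t} = \<pi> t ` (I - {x t})" by (simp add: bij_betw_def)
  moreover have "Q - Qt t = (\<Union>j\<in>I - {y t}. block g Q j)" using gQ I by (auto simp: Qt_def block_def)
  ultimately show ?thesis by simp
qed

text \<open>At most k patterns use a given pair of blocks generically, so \<open>num\<close> can
  give each of them its own one of the k disjoint matchings. Patterns that lead from the block of p
  to different blocks cannot collide at p.\<close>

lemma generic_matchings:
  "\<exists>F. (\<forall>t\<in>T. bij_betw (F t) (P - Pt t) (Q - Qt t) \<and> (\<forall>p\<in>P - Pt t. (p, F t p) \<in> G \<and> g (F t p) = \<pi> t (f p))) \<and>
     (\<forall>t\<in>T. \<forall>t'\<in>T. t \<noteq> t' \<longrightarrow> (\<forall>p\<in>P. p \<notin> Pt t \<longrightarrow> p \<notin> Pt t' \<longrightarrow> F t p \<noteq> F t' p))"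
proof -
  define num where "num i j = (SOME \<nu> :: 't \<Rightarrow> nat. \<nu> ` {t \<in> T. i \<noteq> x t \<and> \<pi> t i = j} \<subseteq> {..<k} \<and>
    inj_on \<nu> {t \<in> T. i \<noteq> x t \<and> \<pi> t i = j})" for i j
  have num: "inj_on (num i j) {t \<in> T. i \<noteq> x t \<and> \<pi> t i = j}"
    "num i j ` {t \<in> T. i \<noteq> x t \<and> \<pi> t i = j} \<subseteq> {..<k}" if "i \<in> I" "j \<in> I" for i j
  proof -
    have "\<exists>\<nu> :: 't \<Rightarrow> nat. \<nu> ` {t \<in> T. i \<noteq> x t \<and> \<pi> t i = j} \<subseteq> {..<k} \<and> inj_on \<nu> {t \<in> T. i \<noteq> x t \<and> \<pi> t i = j}"
      by (rule card_le_inj) (use load that fin in auto)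
    from someI_ex[OF this] show "inj_on (num i j) {t \<in> T. i \<noteq> x t \<and> \<pi> t i = j}"
      "num i j ` {t \<in> T. i \<noteq> x t \<and> \<pi> t i = j} \<subseteq> {..<k}" unfolding num_def[symmetric] by auto
  qed
  define good where "good i j F \<longleftrightarrow>
      (\<forall>a<k. bij_betw (F a) (block f P i) (block g Q j) \<and> (\<forall>p\<in>block f P i. (p, F a p) \<in> G)) \<and>
      (\<forall>a<k. \<forall>b<k. a \<noteq> b \<longrightarrow> (\<forall>p\<in>block f P i. F a p \<noteq> F b p))" for i j and F :: "nat \<Rightarrow> 'a \<Rightarrow> 'b"
  define F where "F i j = (SOME F. good i j F)" for i j
  have F: "good i j (F i j)" if "i \<in> I" "j \<in> I" for i j
  proof -
    have "\<exists>F. good i j F" unfolding good_def by (rule matchings[OF that])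
    from someI_ex[OF this] show ?thesis unfolding F_def .
  qed
  define H where "H t p = F (f p) (\<pi> t (f p)) (num (f p) (\<pi> t (f p)) t) p" for t p
  have \<pi>I: "\<pi> t i \<in> I" if "t \<in> T" "i \<in> I" for t i using bij\<pi> that by (meson bij_betwE)
  have nk: "num i (\<pi> t i) t < k" if "t \<in> T" "i \<in> I" "i \<noteq> x t" for t i
    using num(2)[OF that(2) \<pi>I[OF that(1,2)]] that by auto
  have bb: "bij_betw (H t) (block f P i) (block g Q (\<pi> t i))" if "t \<in> T" "i \<in> I" "i \<noteq> x t" for t i
  proof -
    have "bij_betw (F i (\<pi> t i) (num i (\<pi> t i) t)) (block f P i) (block g Q (\<pi> t i))"
      using F[OF that(2) \<pi>I[OF that(1,2)]] nk[OF that] unfolding good_def by blast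
    then show ?thesis by (rule bij_betw_cong[THEN iffD1, rotated]) (auto simp: H_def block_def)
  qed
  have in_blk: "f p \<in> I \<and> f p \<noteq> x t \<and> p \<in> block f P (f p)" if "t \<in> T" "p \<in> P" "p \<notin> Pt t" for t p
    using that fP[OF that(2)] by (auto simp: Pt_def block_def)
  have 1: "bij_betw (H t) (P - Pt t) (Q - Qt t)" if t: "t \<in> T" for t
    unfolding P_minus_Pt[OF t] Q_minus_Qt[OF t]
  proof (rule bij_betw_UNION_disjoint)
    have "\<pi> t i \<noteq> \<pi> t j" if "i \<in> I - {x t}" "j \<in> I - {x t}" "i \<noteq> j" for i j
      using bij\<pi>[OF t] that by (auto simp: bij_betw_def inj_on_def)
    then show "disjoint_family_on (\<lambda>i. block g Q (\<pi> t i)) (I - {x t})"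
      unfolding disjoint_family_on_def by (auto simp: block_def)
  qed (use bb t in auto)
  have 2: "(p, H t p) \<in> G \<and> g (H t p) = \<pi> t (f p)" if t: "t \<in> T" and p: "p \<in> P - Pt t" for t p
  proof -
    have i: "f p \<in> I" "f p \<noteq> x t" "p \<in> block f P (f p)" using in_blk t p by auto
    have "(p, H t p) \<in> G" unfolding H_def using F[OF i(1) \<pi>I[OF t i(1)]] i(3) nk[OF t i(1,2)] unfolding good_def by blast
    moreover have "H t p \<in> block g Q (\<pi> t (f p))" using bb[OF t i(1,2)] i(3) by (meson bij_betwE)
    ultimately show ?thesis by (auto simp: block_def)
  qed
  have 3: "H t p \<noteq> H t' p" if tt: "t \<in> T" "t' \<in> T" "t \<noteq> t'" and p: "p \<in> P" "p \<notin> Pt t" "p \<notin> Pt t'" for t t' p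
  proof -
    let ?i = "f p"
    have i: "?i \<in> I" "?i \<noteq> x t" "?i \<noteq> x t'" "p \<in> block f P ?i" using in_blk tt p by auto
    show ?thesis
    proof (cases "\<pi> t ?i = \<pi> t' ?i")
      case True
      then have "num ?i (\<pi> t ?i) t \<noteq> num ?i (\<pi> t ?i) t'"
        using inj_onD[OF num(1)[OF i(1) \<pi>I[OF tt(1) i(1)]], of t t'] tt i by auto
      moreover have "num ?i (\<pi> t ?i) t < k" "num ?i (\<pi> t ?i) t' < k"
        using nk[OF tt(1) i(1,2)] nk[OF tt(2) i(1,3)] True by auto
      ultimately show ?thesis unfolding H_def True[symmetric]
        using F[OF i(1) \<pi>I[OF tt(1) i(1)]] i(4) unfolding good_def by blast
    next
      case False
      then show ?thesis using 2[OF tt(1), of p] 2[OF tt(2), of p] p by auto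
    qed
  qed
  show ?thesis by (rule exI[of _ H]) (use 1 2 3 in blast)
qed

definition linked :: "('t \<Rightarrow> 'a \<Rightarrow> 'b) \<Rightarrow> 't set \<Rightarrow> ('t \<Rightarrow> 'a \<Rightarrow> 'a) \<Rightarrow> bool" where
  "linked \<theta> S h \<longleftrightarrow> (\<forall>t\<in>S. bij_betw (h t) (Pt t) (Pt t) \<and> (\<forall>p\<in>Pt t. (p, \<theta> t (h t p)) \<in> G) \<and>
        (\<forall>u\<in>Pt t. \<forall>v\<in>Pt t. \<exists>k. (h t ^^ k) u = v)) \<and>
      (\<forall>t\<in>S. \<forall>t'\<in>S. t \<noteq> t' \<longrightarrow> (\<forall>p\<in>Pt t \<inter> Pt t'. \<theta> t (h t p) \<noteq> \<theta> t' (h t' p)))"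

text \<open>The patterns are served greedily, F being the arcs of G that earlier patterns have not
  taken. A reserved pair occurs in at most L patterns, so its degrees stay at least \<delta> - L,
  and \<open>large\<close> is the demand of \<open>cyclic_link\<close> for |Pt t| = n + \<rho>. A
  leftover vertex lies in every \<open>Pt s\<close> and may lose up to L' arcs; it counts as
  exceptional.\<close>

lemma special_links:
  assumes "\<forall>t\<in>T. bij_betw (\<theta> t) (Pt t) (Qt t)"
  shows "\<exists>h. linked \<theta> T h"
proof -
  have \<theta>: "bij_betw (\<theta> t) (Pt t) (Qt t)" if "t \<in> T" for t using assms that by (rule bspec)
  have "finite S \<Longrightarrow> S \<subseteq> T \<Longrightarrow> \<exists>h. linked \<theta> S h" for S
  proof (induction S rule: finite_induct)
    case empty show ?case by (simp add: linked_def)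
  next
    case (insert t S)
    then have t: "t \<in> T" and ST: "S \<subseteq> T" by auto
    obtain h where h: "\<forall>t\<in>S. bij_betw (h t) (Pt t) (Pt t) \<and> (\<forall>p\<in>Pt t. (p, \<theta> t (h t p)) \<in> G) \<and>
        (\<forall>u\<in>Pt t. \<forall>v\<in>Pt t. \<exists>k. (h t ^^ k) u = v)"
      "\<forall>t\<in>S. \<forall>t'\<in>S. t \<noteq> t' \<longrightarrow> (\<forall>p\<in>Pt t \<inter> Pt t'. \<theta> t (h t p) \<noteq> \<theta> t' (h t' p))" using insert.IH[OF ST] unfolding linked_def by blast
    define \<phi> where "\<phi> s p = \<theta> s (h s p)" for s p
    have bij\<phi>: "bij_betw (\<phi> s) (Pt s) (Qt s)" if "s \<in> S" for s
      using bij_betw_trans[of "h s" "Pt s" "Pt s" "\<theta> s" "Qt s"] h(1) \<theta> that ST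
      unfolding \<phi>_def by (auto simp: comp_def)
    define F where "F p q \<longleftrightarrow> (p, q) \<in> G \<and> (\<forall>s\<in>S. p \<in> Pt s \<longrightarrow> \<phi> s p \<noteq> q)" for p q
    \<comment> \<open>Only the part \<open>y t\<close> of \<open>Qt t\<close> is counted. An arc
      from p into it can be taken only by an earlier pattern s with p in \<open>Pt s\<close> and
      \<open>y s = y t\<close>, and each of these takes one arc at p.\<close>
    have out: "card {q \<in> block g Q (y t). (p, q) \<in> G} \<le> card {q \<in> Qt t. F p q} + card {s \<in> T. p \<in> Pt s \<and> y s = y t}" for p
    proof -
      have "{q \<in> block g Q (y t). (p, q) \<in> G} \<subseteq> (\<lambda>s. \<phi> s p) ` {s \<in> T. p \<in> Pt s \<and> y s = y t} \<union> {q \<in> Qt t. F p q}"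
      proof
        fix q assume q: "q \<in> {q \<in> block g Q (y t). (p, q) \<in> G}"
        show "q \<in> (\<lambda>s. \<phi> s p) ` {s \<in> T. p \<in> Pt s \<and> y s = y t} \<union> {q \<in> Qt t. F p q}"
        proof (cases "F p q")
          case True then show ?thesis using q by (auto simp: Qt_def)
        next
          case False
          then obtain s where s: "s \<in> S" "p \<in> Pt s" "\<phi> s p = q" using q unfolding F_def by auto
          have "q \<in> Qt s" using bij\<phi>[OF s(1)] s by (metis bij_betwE)
          then have "y s = y t" using q yI[OF t] I by (auto simp: Qt_def block_def)
          then show ?thesis using s ST by auto
        qed
      qed
      then have "card {q \<in> block g Q (y t). (p, q) \<in> G} \<le> card {s \<in> T. p \<in> Pt s \<and> y s = y t} + card {q \<in> Qt t. F p q}"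
        by (rule card_le_if_subset_image_Un) (use fin fin_block in \<open>auto simp: Qt_def\<close>)
      then show ?thesis by simp
    qed
    have inn: "card {p \<in> block f P (x t). (p, q) \<in> G} \<le> card {p \<in> Pt t. F p q} + card {s \<in> T. q \<in> Qt s \<and> x s = x t}" for q
    proof -
      let ?inv = "\<lambda>s. inv_into (Pt s) (\<phi> s) q"
      have "{p \<in> block f P (x t). (p, q) \<in> G} \<subseteq> ?inv ` {s \<in> T. q \<in> Qt s \<and> x s = x t} \<union> {p \<in> Pt t. F p q}"
      proof
        fix p assume p: "p \<in> {p \<in> block f P (x t). (p, q) \<in> G}"
        show "p \<in> ?inv ` {s \<in> T. q \<in> Qt s \<and> x s = x t} \<union> {p \<in> Pt t. F p q}"
        proof (cases "F p q")
          case True then show ?thesis using p by (auto simp: Pt_def)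
        next
          case False
          then obtain s where s: "s \<in> S" "p \<in> Pt s" "\<phi> s p = q" using p unfolding F_def by auto
          have "q \<in> Qt s" using bij\<phi>[OF s(1)] s by (metis bij_betwE)
          moreover have "x s = x t" using p s(2) xI[OF t] I by (auto simp: Pt_def block_def)
          moreover have "?inv s = p" using bij\<phi>[OF s(1)] s by (auto simp: bij_betw_def)
          ultimately show ?thesis using s ST by auto
        qed
      qed
      then have "card {p \<in> block f P (x t). (p, q) \<in> G} \<le> card {s \<in> T. q \<in> Qt s \<and> x s = x t} + card {p \<in> Pt t. F p q}"
        by (rule card_le_if_subset_image_Un) (use fin fin_block in \<open>auto simp: Pt_def\<close>)
      then show ?thesis by simp
    qed
    have "\<exists>h'. bij_betw h' (Pt t) (Pt t) \<and> (\<forall>p\<in>Pt t. F p (\<theta> t (h' p))) \<and> (\<forall>u\<in>Pt t. \<forall>v\<in>Pt t. \<exists>k. (h' ^^ k) u = v)"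
    proof -
      have c1: "finite (Pt t)" using fin_block by (simp add: Pt_def)
      have c2: "bij_betw (\<theta> t) (Pt t) (Qt t)" by (rule \<theta>[OF t])
      have c3: "block f P (-1) \<subseteq> Pt t" "block g Q (-1) \<subseteq> Qt t" by (auto simp: Pt_def Qt_def)
      have c4: "card (block f P (-1)) \<le> \<rho>" "card (block g Q (-1)) \<le> \<rho>" using cP0 cQ0 by auto
      have c5: "2 * \<rho> + 2 \<le> card (Pt t)" using card_Pt[OF t] large by simp
      have d1: "card (Pt t) + 4 * \<rho> + 2 \<le> 2 * card {q \<in> Qt t. F p q}" if p: "p \<in> Pt t - block f P (-1)" for p
      proof -
      from p have "p \<in> P" "f p = x t" by (auto simp: Pt_def block_def)
      then have "{s \<in> T. p \<in> Pt s \<and> y s = y t} \<subseteq> {s \<in> T. x s = x t \<and> y s = y t}"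
        using xI[OF t] I by (auto simp: Pt_def block_def)
      then have "card {s \<in> T. p \<in> Pt s \<and> y s = y t} \<le> card {s \<in> T. x s = x t \<and> y s = y t}"
        using fin by (intro card_mono) auto
      also have "\<dots> \<le> L" using loadxy xI yI t by blast
      finally show ?thesis
        using out[of p] degP[OF \<open>p \<in> P\<close> yI[OF t]] large card_Pt[OF t] by linarith
      qed
      have d2: "2 * \<rho> + 1 \<le> card {q \<in> Qt t. F p q}" if p: "p \<in> block f P (-1)" for p
      proof -
      from p have "p \<in> P" by (auto simp: block_def)
      have "card {s \<in> T. p \<in> Pt s \<and> y s = y t} \<le> card {s \<in> T. y s = y t}"
        using fin by (intro card_mono) auto
      also have "\<dots> \<le> L'" using loady yI t by blast
      finally show ?thesis
        using out[of p] degP[OF \<open>p \<in> P\<close> yI[OF t]] large by linarith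
      qed
      have d3: "card (Pt t) + 4 * \<rho> + 2 \<le> 2 * card {p \<in> Pt t. F p q}" if q: "q \<in> Qt t - block g Q (-1)" for q
      proof -
      from q have "q \<in> Q" "g q = y t" by (auto simp: Qt_def block_def)
      then have "{s \<in> T. q \<in> Qt s \<and> x s = x t} \<subseteq> {s \<in> T. x s = x t \<and> y s = y t}"
        using yI[OF t] I by (auto simp: Qt_def block_def)
      then have "card {s \<in> T. q \<in> Qt s \<and> x s = x t} \<le> card {s \<in> T. x s = x t \<and> y s = y t}"
        using fin by (intro card_mono) auto
      also have "\<dots> \<le> L" using loadxy xI yI t by blast
      finally show ?thesis
        using inn[of q] degQ[OF \<open>q \<in> Q\<close> xI[OF t]] large card_Pt[OF t] by linarith
      qed
      have d4: "2 * \<rho> + 1 \<le> card {p \<in> Pt t. F p q}" if q: "q \<in> block g Q (-1)" for q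
      proof -
      from q have "q \<in> Q" by (auto simp: block_def)
      have "card {s \<in> T. q \<in> Qt s \<and> x s = x t} \<le> card {s \<in> T. x s = x t}"
        using fin by (intro card_mono) auto
      also have "\<dots> \<le> L'" using loadx xI t by blast
      finally show ?thesis
        using inn[of q] degQ[OF \<open>q \<in> Q\<close> xI[OF t]] large by linarith
      qed
      show ?thesis by (rule cyclic_link[OF c1 c2 c3 c4 c5 d1 d2 d3 d4])
    qed
    then obtain h' where h': "bij_betw h' (Pt t) (Pt t)" "\<forall>p\<in>Pt t. F p (\<theta> t (h' p))"
      "\<forall>u\<in>Pt t. \<forall>v\<in>Pt t. \<exists>k. (h' ^^ k) u = v" by blast
    define H where "H = h(t := h')"
    have Ht: "H t = h'" and HS: "\<And>s. s \<in> S \<Longrightarrow> H s = h s" using insert.hyps by (auto simp: H_def)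
    have A: "bij_betw (H s) (Pt s) (Pt s) \<and> (\<forall>p\<in>Pt s. (p, \<theta> s (H s p)) \<in> G) \<and>
        (\<forall>u\<in>Pt s. \<forall>v\<in>Pt s. \<exists>k. (H s ^^ k) u = v)" if "s \<in> insert t S" for s
    proof (cases "s = t")
      case True
      have "\<forall>p\<in>Pt t. (p, \<theta> t (h' p)) \<in> G" using h'(2) unfolding F_def by blast
      then show ?thesis unfolding True Ht using h'(1,3) by (intro conjI)
    next
      case False
      then have "s \<in> S" using that by simp
      show ?thesis unfolding HS[OF \<open>s \<in> S\<close>] using bspec[OF h(1) \<open>s \<in> S\<close>] .
    qed
    have ne: "\<theta> t (h' p) \<noteq> \<theta> s (h s p)" if "s \<in> S" "p \<in> Pt t" "p \<in> Pt s" for s p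
    proof -
      have "F p (\<theta> t (h' p))" using h'(2) that(2) by blast
      then have "\<phi> s p \<noteq> \<theta> t (h' p)" using that(1,3) unfolding F_def by blast
      then show ?thesis unfolding \<phi>_def by (rule not_sym)
    qed
    have B: "\<theta> s (H s p) \<noteq> \<theta> s' (H s' p)" if ss: "s \<in> insert t S" "s' \<in> insert t S" "s \<noteq> s'" "p \<in> Pt s" "p \<in> Pt s'" for s s' p
    proof -
      have "s = t \<or> s \<in> S" "s' = t \<or> s' \<in> S" using ss(1,2) by simp_all
      then consider "s = t" "s' \<in> S" | "s' = t" "s \<in> S" | "s \<in> S" "s' \<in> S" using ss(3) by metis
      then show ?thesis
      proof cases
        case 1
        show ?thesis unfolding 1(1) Ht HS[OF 1(2)] by (rule ne[OF 1(2)]) (use ss(4,5) 1(1) in simp_all)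
      next
        case 2
        show ?thesis unfolding 2(1) Ht HS[OF 2(2)] by (rule not_sym, rule ne[OF 2(2)]) (use ss(4,5) 2(1) in simp_all)
      next
        case 3
        show ?thesis unfolding HS[OF 3(1)] HS[OF 3(2)] by (rule h(2)[rule_format, OF 3 ss(3)]) (use ss(4,5) in simp)
      qed
    qed
    have "\<forall>s\<in>insert t S. bij_betw (H s) (Pt s) (Pt s) \<and> (\<forall>p\<in>Pt s. (p, \<theta> s (H s p)) \<in> G) \<and>
        (\<forall>u\<in>Pt s. \<forall>v\<in>Pt s. \<exists>k. (H s ^^ k) u = v)" using A by (rule ballI)
    moreover have "\<forall>s\<in>insert t S. \<forall>s'\<in>insert t S. s \<noteq> s' \<longrightarrow> (\<forall>p\<in>Pt s \<inter> Pt s'. \<theta> s (H s p) \<noteq> \<theta> s' (H s' p))"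
      by (intro ballI impI, elim IntE) (rule B)
    ultimately show ?case unfolding linked_def by (intro exI[of _ H] conjI)
  qed
  from this[OF fin(3) order.refl] show ?thesis .
qed

lemma linked_matchings:
  assumes "linked \<theta> T h" and "\<forall>t\<in>T. bij_betw (\<theta> t) (Pt t) (Qt t)"
  shows "\<forall>t\<in>T. bij_betw (\<lambda>p. \<theta> t (h t p)) (Pt t) (Qt t) \<and> (\<forall>p\<in>Pt t. (p, \<theta> t (h t p)) \<in> G)"
    and "\<forall>t\<in>T. \<forall>t'\<in>T. t \<noteq> t' \<longrightarrow> (\<forall>p\<in>Pt t \<inter> Pt t'. \<theta> t (h t p) \<noteq> \<theta> t' (h t' p))"
proof -
  note h = assms(1)[unfolded linked_def, THEN conjunct1] assms(1)[unfolded linked_def, THEN conjunct2]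
  show "\<forall>t\<in>T. \<forall>t'\<in>T. t \<noteq> t' \<longrightarrow> (\<forall>p\<in>Pt t \<inter> Pt t'. \<theta> t (h t p) \<noteq> \<theta> t' (h t' p))" by (rule h(2))
  show "\<forall>t\<in>T. bij_betw (\<lambda>p. \<theta> t (h t p)) (Pt t) (Qt t) \<and> (\<forall>p\<in>Pt t. (p, \<theta> t (h t p)) \<in> G)"
  proof (intro ballI conjI)
    fix t assume t: "t \<in> T"
    show "bij_betw (\<lambda>p. \<theta> t (h t p)) (Pt t) (Qt t)"
      using bij_betw_trans[of "h t" "Pt t" "Pt t" "\<theta> t"] bspec[OF h(1) t] bspec[OF assms(2) t] by (simp add: comp_def)
    show "(p, \<theta> t (h t p)) \<in> G" if "p \<in> Pt t" for p using bspec[OF h(1) t] that by blast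
  qed
qed

text \<open>The point is that a special arc of t and a generic arc of t' cannot agree. If p lies in
  \<open>Pt t\<close> but not in \<open>Pt t'\<close>, it is not a leftover vertex, so its special
  arc runs in the reserved pair (\<open>x t\<close>, \<open>y t\<close>) or ends in a leftover
  vertex; a generic arc does neither.\<close>

lemma combine_special_generic:
  assumes F: "\<forall>t\<in>T. bij_betw (F t) (P - Pt t) (Q - Qt t) \<and> (\<forall>p\<in>P - Pt t. (p, F t p) \<in> G \<and> g (F t p) = \<pi> t (f p))"
     "\<forall>t\<in>T. \<forall>t'\<in>T. t \<noteq> t' \<longrightarrow> (\<forall>p\<in>P. p \<notin> Pt t \<longrightarrow> p \<notin> Pt t' \<longrightarrow> F t p \<noteq> F t' p)"
    and S: "\<forall>t\<in>T. bij_betw (S t) (Pt t) (Qt t) \<and> (\<forall>p\<in>Pt t. (p, S t p) \<in> G)"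
     "\<forall>t\<in>T. \<forall>t'\<in>T. t \<noteq> t' \<longrightarrow> (\<forall>p\<in>Pt t \<inter> Pt t'. S t p \<noteq> S t' p)"
    and C: "\<And>t p. C t p = (if p \<in> Pt t then S t p else F t p)"
  shows "\<And>t. t \<in> T \<Longrightarrow> bij_betw (C t) P Q"
    and "\<And>t p. t \<in> T \<Longrightarrow> p \<in> P \<Longrightarrow> (p, C t p) \<in> G"
    and "\<And>t t' p. t \<in> T \<Longrightarrow> t' \<in> T \<Longrightarrow> t \<noteq> t' \<Longrightarrow> p \<in> P \<Longrightarrow> C t p \<noteq> C t' p"
proof -
  fix t assume t: "t \<in> T"
  have "bij_betw (C t) (Pt t) (Qt t)"
    by (rule bij_betw_cong[THEN iffD1, rotated]) (use S t in \<open>auto simp: C\<close>)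
  moreover have "bij_betw (C t) (P - Pt t) (Q - Qt t)"
    by (rule bij_betw_cong[THEN iffD1, rotated]) (use F t in \<open>auto simp: C\<close>)
  ultimately have "bij_betw (C t) (Pt t \<union> (P - Pt t)) (Qt t \<union> (Q - Qt t))"
    by (rule bij_betw_combine) auto
  moreover have "Pt t \<union> (P - Pt t) = P" "Qt t \<union> (Q - Qt t) = Q" using Pt_sub Qt_sub by auto
  ultimately show "bij_betw (C t) P Q" by simp
next
  fix t p assume "t \<in> T" "p \<in> P"
  then show "(p, C t p) \<in> G" using F S by (auto simp: C)
next
  have mixed: "S t p \<noteq> F t' p" if "t \<in> T" "t' \<in> T" "p \<in> Pt t" "p \<notin> Pt t'" for t t' p
  proof -
    have p: "p \<in> P" "f p = x t" using that Pt_sub[of t] by (auto simp: Pt_def block_def)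
    have fx: "f p \<noteq> x t'" using that p by (auto simp: Pt_def block_def)
    have fI: "f p \<in> I" using xI that p by simp
    have "\<pi> t' (f p) \<noteq> y t" using generic[OF that(2) fI fx] special[OF that(1)] p by auto
    moreover have "\<pi> t' (f p) \<noteq> -1" using bij\<pi>[OF that(2)] fI I by (metis bij_betwE)
    moreover have "g (F t' p) = \<pi> t' (f p)" using F that p by blast
    moreover have "S t p \<in> Qt t" using S that by (meson bij_betwE)
    then have "g (S t p) = y t \<or> g (S t p) = -1" by (auto simp: Qt_def block_def)
    ultimately show ?thesis by metis
  qed
  fix t t' p assume tt: "t \<in> T" "t' \<in> T" "t \<noteq> t'" "p \<in> P"
  consider "p \<in> Pt t" "p \<in> Pt t'" | "p \<in> Pt t" "p \<notin> Pt t'" | "p \<notin> Pt t" "p \<in> Pt t'" | "p \<notin> Pt t" "p \<notin> Pt t'" by blast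
  then show "C t p \<noteq> C t' p"
  proof cases
    case 1 then show ?thesis using S(2) tt by (auto simp: C)
  next
    case 2 then show ?thesis using mixed[OF tt(1,2)] by (auto simp: C)
  next
    case 3 then show ?thesis using mixed[OF tt(2,1), of p] by (auto simp: C)
  next
    case 4 then show ?thesis using F(2) tt by (auto simp: C)
  qed
qed

end

section \<open>Closing paths to Hamilton cycles\<close>

text \<open>By pigeonhole some p > 0 steps lead from u back to u. Then so do p * k steps, and the
  last p * k - k of them start in v.\<close>

lemma bij_betw_funpow_return:
  assumes bij: "bij_betw \<sigma> A A" and fin: "finite A" and u: "u \<in> A" and k: "(\<sigma> ^^ k) u = v"
  shows "\<exists>j. (\<sigma> ^^ j) v = u"
proof -
  have bk: "bij_betw (\<sigma> ^^ j) A A" for j using bij by (rule bij_betw_funpow)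
  have "\<not> inj_on (\<lambda>j. (\<sigma> ^^ j) u) {..card A}"
  proof
    assume "inj_on (\<lambda>j. (\<sigma> ^^ j) u) {..card A}"
    moreover have "(\<lambda>j. (\<sigma> ^^ j) u) ` {..card A} \<subseteq> A" using bk u by (auto dest: bij_betwE)
    ultimately have "card {..card A} \<le> card A" using fin by (rule card_inj_on_le)
    then show False by simp
  qed
  then obtain i j where ij: "i < j" "(\<sigma> ^^ i) u = (\<sigma> ^^ j) u"
    unfolding inj_on_def by (metis linorder_neqE_nat)
  then have "(\<sigma> ^^ i) u = (\<sigma> ^^ i) ((\<sigma> ^^ (j - i)) u)" by (metis comp_apply funpow_add le_add_diff_inverse less_imp_le)
  moreover have "(\<sigma> ^^ (j - i)) u \<in> A" using bk u by (meson bij_betwE)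
  ultimately have p: "(\<sigma> ^^ (j - i)) u = u" using bk[of i] u unfolding bij_betw_def inj_on_def by metis
  define p where "p = j - i"
  have "(\<sigma> ^^ (p * k)) u = u" for k
  proof (induction k)
    case (Suc k)
    have "(\<sigma> ^^ (p * Suc k)) u = (\<sigma> ^^ (p * k)) ((\<sigma> ^^ p) u)"
      unfolding mult_Suc_right add.commute[of p] funpow_add comp_apply ..
    then show ?case using Suc p p_def by simp
  qed simp
  moreover have "1 * k \<le> p * k" using ij(1) by (intro mult_right_mono) (auto simp: p_def)
  then have "k \<le> p * k" by simp
  ultimately have "(\<sigma> ^^ (p * k - k)) ((\<sigma> ^^ k) u) = u" by (metis comp_apply funpow_add le_add_diff_inverse2)
  then show ?thesis using k by blast
qed

text \<open>Following N and M alternately, the paths starting in S end in E. Closing them up along a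
  cyclic permutation of their ends produces a single cycle.\<close>

lemma close_paths:
  fixes M :: "'a \<Rightarrow> 'b" and N :: "'b \<Rightarrow> 'a" and rk :: "'a \<Rightarrow> nat"
  assumes fin: "finite A" and EA: "E \<subseteq> A" and SB: "S \<subseteq> B" and card: "card E = card S"
    and M: "bij_betw M (A - E) (B - S)" and N: "bij_betw N B A"
    and rk: "\<And>a. a \<in> A - E \<Longrightarrow> rk (N (M a)) < rk a"
  shows "\<exists>\<Psi>. bij_betw \<Psi> E S \<and> (\<forall>h M'. bij_betw h E E \<longrightarrow> (\<forall>u\<in>E. \<forall>v\<in>E. \<exists>k. (h ^^ k) u = v) \<longrightarrow>
     bij_betw M' A B \<longrightarrow> (\<forall>a\<in>A. M' a = (if a \<in> E then \<Psi> (h a) else M a)) \<longrightarrow>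
     (\<forall>u\<in>A. \<forall>v\<in>A. \<exists>k. ((N \<circ> M') ^^ k) u = v))"
proof -
  define \<tau> where "\<tau> = N \<circ> M"
  have NB: "N y \<in> A" if "y \<in> B" for y using N that by (meson bij_betwE)
  have MB: "M x \<in> B - S" if "x \<in> A - E" for x using M that by (meson bij_betwE)
  have \<tau>A: "\<tau> x \<in> A" if "x \<in> A - E" for x using NB MB[OF that] by (simp add: \<tau>_def)
  have \<tau>_eq: "x = y" if "x \<in> A - E" "y \<in> A - E" "\<tau> x = \<tau> y" for x y
  proof -
    have "M x = M y" using N MB[OF that(1)] MB[OF that(2)] that(3) unfolding \<tau>_def bij_betw_def inj_on_def by auto
    then show ?thesis using M that(1,2) unfolding bij_betw_def inj_on_def by blast
  qed
  \<comment> \<open>The walk from x meets E for the first time after k steps, in e. The falling rank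
    guarantees that this happens.\<close>
  define hit where "hit x e k \<longleftrightarrow> (\<tau> ^^ k) x = e \<and> e \<in> E \<and> (\<forall>j<k. (\<tau> ^^ j) x \<in> A - E)" for x e k
  have ex_hit: "\<exists>e k. hit x e k" if "x \<in> A" for x
    using that
  proof (induction "rk x" arbitrary: x rule: less_induct)
    case less
    show ?case
    proof (cases "x \<in> E")
      case True then have "hit x x 0" by (simp add: hit_def)
      then show ?thesis by blast
    next
      case False
      then have xA: "x \<in> A - E" using less.prems by simp
      then obtain e k where ek: "hit (\<tau> x) e k" using less.hyps[OF _ \<tau>A[OF xA]] rk[OF xA] by (auto simp: \<tau>_def)
      have "hit x e (Suc k)" unfolding hit_def
      proof (intro conjI allI impI)
        show "(\<tau> ^^ Suc k) x = e" "e \<in> E" using ek unfolding hit_def by (auto simp: funpow_swap1)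
        fix j assume "j < Suc k"
        then show "(\<tau> ^^ j) x \<in> A - E" using ek xA unfolding hit_def
          by (cases j) (auto simp: funpow_swap1)
      qed
      then show ?thesis by blast
    qed
  qed
  have "\<exists>e. \<exists>k. hit (N s) e k" if "s \<in> S" for s using ex_hit NB SB that by blast
  then obtain \<Phi> where \<Phi>: "\<And>s. s \<in> S \<Longrightarrow> \<exists>k. hit (N s) (\<Phi> s) k" by metis
  \<comment> \<open>Two paths with the same end agree when traced backwards, as \<tau> is injective
    off E. If the shorter one began at an inner vertex of the longer one, s would be a value of M,
    but M avoids S.\<close>
  have inj_aux: "s = s'" if s: "s \<in> S" "s' \<in> S" and h: "hit (N s) e k" "hit (N s') e k'" and kk: "k \<le> k'" for s s' e k k'
  proof -
    have shifted: "j \<le> k \<Longrightarrow> (\<tau> ^^ (k - j)) (N s) = (\<tau> ^^ (k' - j)) (N s')" for j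
    proof (induction j)
      case 0 then show ?case using h by (simp add: hit_def)
    next
      case (Suc j)
      let ?x = "(\<tau> ^^ (k - Suc j)) (N s)" and ?y = "(\<tau> ^^ (k' - Suc j)) (N s')"
      have "?x \<in> A - E" "?y \<in> A - E" using h Suc.prems kk unfolding hit_def by auto
      moreover have "\<tau> ?x = (\<tau> ^^ (k - j)) (N s)" "\<tau> ?y = (\<tau> ^^ (k' - j)) (N s')"
      proof -
        have e: "k - j = Suc (k - Suc j)" "k' - j = Suc (k' - Suc j)" using Suc.prems kk by auto
        show "\<tau> ?x = (\<tau> ^^ (k - j)) (N s)" "\<tau> ?y = (\<tau> ^^ (k' - j)) (N s')" unfolding e by simp_all
      qed
      ultimately show ?case using Suc \<tau>_eq by simp
    qed
    from shifted[of k] have e0: "N s = (\<tau> ^^ (k' - k)) (N s')" by simp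
    show ?thesis
    proof (cases "k' = k")
      case True
      then have "N s = N s'" using e0 by simp
      then show ?thesis using N s SB unfolding bij_betw_def inj_on_def by blast
    next
      case False
      then obtain r where r: "k' - k = Suc r" using kk by (metis Suc_diff_Suc le_neq_implies_less)
      let ?w = "(\<tau> ^^ r) (N s')"
      have w: "?w \<in> A - E" using h(2) r kk unfolding hit_def by auto
      have "N s = N (M ?w)" using e0 r by (simp add: \<tau>_def)
      then have "s = M ?w" using N s SB MB[OF w] unfolding bij_betw_def inj_on_def by blast
      then show ?thesis using MB[OF w] s by blast
    qed
  qed
  have finB: "finite B" using N fin bij_betw_finite by blast
  have finES: "finite E" "finite S" using fin finB EA SB finite_subset by blast+
  have injS: "inj_on \<Phi> S"
  proof (rule inj_onI)
    fix s s' assume s: "s \<in> S" "s' \<in> S" "\<Phi> s = \<Phi> s'"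
    obtain k k' where "hit (N s) (\<Phi> s) k" "hit (N s') (\<Phi> s) k'" using \<Phi>[OF s(1)] \<Phi>[OF s(2)] s(3) by metis
    then show "s = s'" using inj_aux[OF s(1,2)] inj_aux[OF s(2,1)] by (metis nat_le_linear)
  qed
  have "\<Phi> ` S \<subseteq> E" using \<Phi> unfolding hit_def by blast
  then have "\<Phi> ` S = E" using finES card injS by (metis card_image card_subset_eq)
  then have bij\<Phi>: "bij_betw \<Phi> S E" using injS by (simp add: bij_betw_def)
  \<comment> \<open>\<open>\<Psi> e\<close> starts the path that ends in e. So M' leads from an end
    e to the start of the path ending in h e, the first return to E is h, and a cyclic h joins all
    paths.\<close>
  define \<Psi> where "\<Psi> = inv_into S \<Phi>"
  have bij\<Psi>: "bij_betw \<Psi> E S" unfolding \<Psi>_def using bij\<Phi> by (rule bij_betw_inv_into)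
  have \<Phi>\<Psi>: "\<Phi> (\<Psi> e) = e" if "e \<in> E" for e unfolding \<Psi>_def using bij\<Phi> that by (rule bij_betw_inv_into_right)
  have "\<exists>k. ((N \<circ> M') ^^ k) u = v" if h: "bij_betw h E E" "\<forall>u\<in>E. \<forall>v\<in>E. \<exists>k. (h ^^ k) u = v"
    and M': "bij_betw M' A B" "\<forall>a\<in>A. M' a = (if a \<in> E then \<Psi> (h a) else M a)" and uv: "u \<in> A" "v \<in> A" for h M' u v
  proof -
    define \<sigma> where "\<sigma> = N \<circ> M'"
    have bij\<sigma>: "bij_betw \<sigma> A A" unfolding \<sigma>_def using M'(1) N by (rule bij_betw_trans)
    define R where "R x y \<longleftrightarrow> (\<exists>k. (\<sigma> ^^ k) x = y)" for x y
    have Rtrans: "R x z" if "R x y" "R y z" for x y z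
      using that unfolding R_def by (metis comp_apply funpow_add)
    have R0: "R x x" for x unfolding R_def by (rule exI[of _ 0]) simp
    have R1: "R x (\<sigma> x)" for x unfolding R_def by (rule exI[of _ 1]) simp
    have \<sigma>\<tau>: "\<sigma> x = \<tau> x" if "x \<in> A - E" for x using M'(2) that by (simp add: \<sigma>_def \<tau>_def)
    have hitR: "R x e" if "hit x e k" for x e k
    proof -
      have "j \<le> k \<Longrightarrow> (\<sigma> ^^ j) x = (\<tau> ^^ j) x" for j
      proof (induction j)
        case (Suc j)
        then have "(\<tau> ^^ j) x \<in> A - E" using that unfolding hit_def by simp
        then show ?case using Suc \<sigma>\<tau> by simp
      qed simp
      then have "(\<sigma> ^^ k) x = e" using that by (simp add: hit_def)
      then show ?thesis unfolding R_def by blast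
    qed
    have Rh: "R e (h e)" if e: "e \<in> E" for e
    proof -
      have he: "h e \<in> E" using h(1) e by (meson bij_betwE)
      then have S: "\<Psi> (h e) \<in> S" using bij\<Psi> by (meson bij_betwE)
      have "\<sigma> e = N (\<Psi> (h e))" using M'(2) e EA by (auto simp: \<sigma>_def)
      moreover have "\<exists>k. hit (N (\<Psi> (h e))) (h e) k" using \<Phi>[OF S] \<Phi>\<Psi>[OF he] by simp
      ultimately show ?thesis using Rtrans[OF R1] hitR by metis
    qed
    have hk: "(h ^^ k) e \<in> E \<and> R e ((h ^^ k) e)" if "e \<in> E" for k e
    proof (induction k)
      case (Suc k)
      then show ?case using Rh Rtrans h(1) by (metis bij_betwE comp_apply funpow.simps(2))
    qed (use that R0 in simp)
    have toE: "\<exists>e\<in>E. R x e" if "x \<in> A" for x using ex_hit[OF that] hitR unfolding hit_def by metis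
    obtain e where e: "e \<in> E" "R u e" using toE uv by blast
    obtain e' where e': "e' \<in> E" "R v e'" using toE uv by blast
    have "R e e'" using h(2) e(1) e'(1) hk by metis
    moreover have "R e' v" using e'(2) bij_betw_funpow_return[OF bij\<sigma> fin uv(2)] unfolding R_def by blast
    ultimately have "R u v" using e(2) Rtrans by blast
    then show ?thesis unfolding R_def \<sigma>_def .
  qed
  then show ?thesis using bij\<Psi> by blast
qed

section \<open>From transitive permutations to Hamilton cycles\<close>

lemma transitive_permutation_list:
  assumes bij: "bij_betw \<sigma> V V" and fin: "finite V" and v0: "v0 \<in> V" and tr: "\<And>v. v \<in> V \<Longrightarrow> \<exists>k. (\<sigma> ^^ k) v0 = v"
  shows "\<exists>vs. distinct vs \<and> set vs = V \<and> cyclic_arcs vs = (\<lambda>v. (v, \<sigma> v)) ` V"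
proof -
  have "\<exists>j. (\<sigma> ^^ j) (\<sigma> v0) = v0" by (rule bij_betw_funpow_return[OF bij fin v0, of 1]) simp
  then obtain j where "(\<sigma> ^^ Suc j) v0 = v0" by (auto simp: funpow_swap1)
  then have ex: "\<exists>p. 0 < p \<and> (\<sigma> ^^ p) v0 = v0" by blast
  define p where "p = (LEAST p. 0 < p \<and> (\<sigma> ^^ p) v0 = v0)"
  have p: "0 < p" "(\<sigma> ^^ p) v0 = v0" using LeastI_ex[OF ex] unfolding p_def by auto
  have pmin: "p \<le> q" if "0 < q" "(\<sigma> ^^ q) v0 = v0" for q unfolding p_def using that by (intro Least_le) auto
  have md: "(\<sigma> ^^ (k mod p)) v0 = (\<sigma> ^^ k) v0" for k using p(2) by (rule funpow_mod_eq)
  define vs where "vs = map (\<lambda>i. (\<sigma> ^^ i) v0) [0..<p]"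
  have len: "length vs = p" by (simp add: vs_def)
  have nth: "vs ! i = (\<sigma> ^^ i) v0" if "i < p" for i using that by (simp add: vs_def)
  have inV: "(\<sigma> ^^ i) v0 \<in> V" for i using bij_betw_funpow[OF bij] v0 by (meson bij_betwE)
  have ne: "(\<sigma> ^^ i) v0 \<noteq> (\<sigma> ^^ k) v0" if "i < k" "k < p" for i k
  proof
    assume "(\<sigma> ^^ i) v0 = (\<sigma> ^^ k) v0"
    then have "(\<sigma> ^^ i) v0 = (\<sigma> ^^ i) ((\<sigma> ^^ (k - i)) v0)" using that(1) by (metis comp_apply funpow_add le_add_diff_inverse less_imp_le)
    then have "(\<sigma> ^^ (k - i)) v0 = v0"
      using bij_betw_funpow[OF bij, of i] v0 inV unfolding bij_betw_def inj_on_def by metis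
    then show False using pmin[of "k - i"] that by simp
  qed
  have "distinct vs" unfolding distinct_conv_nth len
  proof (intro allI impI)
    fix i k assume "i < p" "k < p" "i \<noteq> k"
    then show "vs ! i \<noteq> vs ! k" using ne[of i k] ne[of k i] nth by (metis linorder_neqE_nat)
  qed
  moreover have set: "set vs = V"
  proof
    show "set vs \<subseteq> V" using inV by (auto simp: vs_def)
    show "V \<subseteq> set vs"
    proof
      fix v assume "v \<in> V"
      then obtain k where "(\<sigma> ^^ (k mod p)) v0 = v" using tr md by metis
      moreover have "k mod p < p" using p by simp
      ultimately show "v \<in> set vs" by (auto simp: vs_def)
    qed
  qed
  moreover have "cyclic_arcs vs = (\<lambda>v. (v, \<sigma> v)) ` V"
  proof -
    have "(vs ! i, vs ! (Suc i mod length vs)) = (vs ! i, \<sigma> (vs ! i))" if "i < p" for i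
      using that md[of "Suc i"] p nth[of "Suc i mod p"] by (simp add: len nth)
    then have "cyclic_arcs vs = {(vs ! i, \<sigma> (vs ! i)) | i. i < p}" unfolding cyclic_arcs_def len by (metis len)
    also have "\<dots> = (\<lambda>v. (v, \<sigma> v)) ` set vs" unfolding set_conv_nth len by auto
    finally show ?thesis using set by simp
  qed
  ultimately show ?thesis by blast
qed

lemma alternating_hamilton_list:
  assumes fin: "finite A" "finite B" and disj: "A \<inter> B = {}" and ne: "A \<noteq> {}"
    and M: "bij_betw M A B" and N: "bij_betw N B A" and tr: "\<forall>u\<in>A. \<forall>v\<in>A. \<exists>k. ((N \<circ> M) ^^ k) u = v"
  shows "\<exists>vs. distinct vs \<and> set vs = A \<union> B \<and> cyclic_arcs vs = (\<lambda>v. (v, M v)) ` A \<union> (\<lambda>v. (v, N v)) ` B"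
proof -
  define \<sigma> where "\<sigma> v = (if v \<in> A then M v else N v)" for v
  have MB: "M a \<in> B" if "a \<in> A" for a using M that by (meson bij_betwE)
  have NA: "N b \<in> A" if "b \<in> B" for b using N that by (meson bij_betwE)
  have \<sigma>B: "\<sigma> b = N b" if "b \<in> B" for b using that disj by (auto simp: \<sigma>_def)
  have "bij_betw \<sigma> A B" by (rule bij_betw_cong[THEN iffD1, OF _ M]) (simp add: \<sigma>_def)
  moreover have "bij_betw \<sigma> B A" by (rule bij_betw_cong[THEN iffD1, OF _ N]) (simp add: \<sigma>B)
  ultimately have bij: "bij_betw \<sigma> (A \<union> B) (A \<union> B)"
    using bij_betw_combine[of \<sigma> A B B A] disj by (simp add: Un_commute Int_commute)
  obtain a0 where a0: "a0 \<in> A" using ne by blast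
  \<comment> \<open>Two steps of \<sigma> are one step of N after M, so the even powers reach all of
    A, and one further step reaches all of B.\<close>
  have even: "(\<sigma> ^^ (2 * k)) a0 = ((N \<circ> M) ^^ k) a0 \<and> ((N \<circ> M) ^^ k) a0 \<in> A" for k
  proof (induction k)
    case (Suc k)
    have "(\<sigma> ^^ (2 * Suc k)) a0 = \<sigma> (\<sigma> ((\<sigma> ^^ (2 * k)) a0))" by simp
    also have "\<dots> = \<sigma> (\<sigma> (((N \<circ> M) ^^ k) a0))" by (simp only: conjunct1[OF Suc])
    also have "\<sigma> (((N \<circ> M) ^^ k) a0) = M (((N \<circ> M) ^^ k) a0)" by (simp only: \<sigma>_def conjunct2[OF Suc] if_True)
    also have "\<sigma> \<dots> = N \<dots>" using Suc MB by (intro \<sigma>B) blast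
    finally have 1: "(\<sigma> ^^ (2 * Suc k)) a0 = N (M (((N \<circ> M) ^^ k) a0))" .
    have 2: "((N \<circ> M) ^^ Suc k) a0 = N (M (((N \<circ> M) ^^ k) a0))" by (simp only: funpow.simps comp_apply)
    show ?case unfolding 1 2 by (intro conjI refl NA MB conjunct2[OF Suc])
  qed (simp add: a0)
  have "\<exists>k. (\<sigma> ^^ k) a0 = v" if v: "v \<in> A \<union> B" for v
  proof (cases "v \<in> A")
    case True
    then show ?thesis using tr a0 even by metis
  next
    case False
    then obtain a where a: "a \<in> A" "v = M a" using v M by (auto simp: bij_betw_def)
    then obtain k where "((N \<circ> M) ^^ k) a0 = a" using tr a0 by blast
    then have "(\<sigma> ^^ Suc (2 * k)) a0 = v" using even[of k] a by (simp add: \<sigma>_def)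
    then show ?thesis by blast
  qed
  then obtain vs where "distinct vs" "set vs = A \<union> B" "cyclic_arcs vs = (\<lambda>v. (v, \<sigma> v)) ` (A \<union> B)"
    using transitive_permutation_list[OF bij, of a0] fin a0 by auto
  moreover have "(\<lambda>v. (v, \<sigma> v)) ` (A \<union> B) = (\<lambda>v. (v, M v)) ` A \<union> (\<lambda>v. (v, N v)) ` B"
    using \<sigma>B unfolding image_Un by (intro arg_cong2[of _ _ _ _ "(\<union>)"] image_cong) (auto simp: \<sigma>_def)
  ultimately show ?thesis by metis
qed

text \<open>Each t carries one Hamilton cycle, split into its arcs from A to B and back.
  Transitivity on A makes it a single cycle, since every vertex of B follows one of A.\<close>

definition disjoint_hamilton_matchings ::
  "'a set \<Rightarrow> 'b set \<Rightarrow> ('a \<times> 'b) set \<Rightarrow> ('b \<times> 'a) set \<Rightarrow> 't set \<Rightarrow> ('t \<Rightarrow> 'a \<Rightarrow> 'b) \<Rightarrow> ('t \<Rightarrow> 'b \<Rightarrow> 'a) \<Rightarrow> bool" where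
  "disjoint_hamilton_matchings A B G1 G2 T M N \<longleftrightarrow>
     (\<forall>t\<in>T. bij_betw (M t) A B \<and> bij_betw (N t) B A \<and> (\<forall>u\<in>A. \<forall>v\<in>A. \<exists>k. ((N t \<circ> M t) ^^ k) u = v) \<and>
        (\<forall>x\<in>A. (x, M t x) \<in> G1) \<and> (\<forall>y\<in>B. (y, N t y) \<in> G2)) \<and>
     (\<forall>t\<in>T. \<forall>t'\<in>T. t \<noteq> t' \<longrightarrow> (\<forall>x\<in>A. M t x \<noteq> M t' x) \<and> (\<forall>y\<in>B. N t y \<noteq> N t' y))"

text \<open>The arcs from B to A are completed first, along arbitrary bijections
  \<open>\<theta> t\<close>. With \<open>N t\<close> fixed, removing the arcs out of
  \<open>X.Pt t\<close> leaves paths, because the rank of the block falls. Only now does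
  \<open>close_paths\<close> tell which start belongs to which end, and the arcs from A to B are
  linked along this bijection \<open>\<Psi> t\<close>.\<close>

lemma block_stages_hamilton_families:
  assumes S1: "block_stage A B fA fB G1 I T a b \<pi> W k L L' n \<rho> \<delta>"
    and S2: "block_stage B A fB fA G2 I T b c \<nu> W k L L' n \<rho> \<delta>"
    and rk: "\<And>t x. t \<in> T \<Longrightarrow> x \<in> I \<Longrightarrow> x \<noteq> a t \<Longrightarrow> rk t (\<nu> t (\<pi> t x)) < (rk t x :: nat)"
  shows "\<exists>M N. disjoint_hamilton_matchings A B G1 G2 T M N"
proof -
  interpret X: block_stage A B fA fB G1 I T a b \<pi> W k L L' n \<rho> \<delta> by (rule S1)
  interpret Y: block_stage B A fB fA G2 I T b c \<nu> W k L L' n \<rho> \<delta> by (rule S2)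
  have SP: "X.Qt t = Y.Pt t" for t by (simp add: X.Qt_def Y.Pt_def)
  obtain F where F: "\<forall>t\<in>T. bij_betw (F t) (A - X.Pt t) (B - X.Qt t) \<and> (\<forall>p\<in>A - X.Pt t. (p, F t p) \<in> G1 \<and> fB (F t p) = \<pi> t (fA p))"
     "\<forall>t\<in>T. \<forall>t'\<in>T. t \<noteq> t' \<longrightarrow> (\<forall>p\<in>A. p \<notin> X.Pt t \<longrightarrow> p \<notin> X.Pt t' \<longrightarrow> F t p \<noteq> F t' p)"
    using X.generic_matchings by (elim exE conjE)
  obtain H where H: "\<forall>t\<in>T. bij_betw (H t) (B - Y.Pt t) (A - Y.Qt t) \<and> (\<forall>p\<in>B - Y.Pt t. (p, H t p) \<in> G2 \<and> fA (H t p) = \<nu> t (fB p))"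
     "\<forall>t\<in>T. \<forall>t'\<in>T. t \<noteq> t' \<longrightarrow> (\<forall>p\<in>B. p \<notin> Y.Pt t \<longrightarrow> p \<notin> Y.Pt t' \<longrightarrow> H t p \<noteq> H t' p)"
    using Y.generic_matchings by (elim exE conjE)
  have ex\<theta>: "\<exists>\<theta>. bij_betw \<theta> (Y.Pt t) (Y.Qt t)" if "t \<in> T" for t
    using Y.card_Pt[OF that] Y.card_Qt[OF that] finite_subset[OF Y.Pt_sub Y.fin(1)] finite_subset[OF Y.Qt_sub Y.fin(2)]
    by (intro finite_same_card_bij) auto
  define \<theta> where "\<theta> t = (SOME \<theta>. bij_betw \<theta> (Y.Pt t) (Y.Qt t))" for t
  have \<theta>: "bij_betw (\<theta> t) (Y.Pt t) (Y.Qt t)" if "t \<in> T" for t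
    using someI_ex[OF ex\<theta>[OF that]] unfolding \<theta>_def .
  have all\<theta>: "\<forall>t\<in>T. bij_betw (\<theta> t) (Y.Pt t) (Y.Qt t)" using \<theta> by (rule ballI)
  from Y.special_links[OF all\<theta>] obtain h where h: "Y.linked \<theta> T h" by blast
  define N where "N t y = (if y \<in> Y.Pt t then \<theta> t (h t y) else H t y)" for t y
  note sp2 = Y.linked_matchings[OF h all\<theta>]
  note N = Y.combine_special_generic[OF H sp2 N_def]
  define closing where "closing t \<Psi> \<longleftrightarrow> bij_betw \<Psi> (X.Pt t) (X.Qt t) \<and> (\<forall>h M'. bij_betw h (X.Pt t) (X.Pt t) \<longrightarrow>
     (\<forall>u\<in>X.Pt t. \<forall>v\<in>X.Pt t. \<exists>k. (h ^^ k) u = v) \<longrightarrow>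
     bij_betw M' A B \<longrightarrow> (\<forall>a\<in>A. M' a = (if a \<in> X.Pt t then \<Psi> (h a) else F t a)) \<longrightarrow>
     (\<forall>u\<in>A. \<forall>v\<in>A. \<exists>k. ((N t \<circ> M') ^^ k) u = v))" for t \<Psi>
  have "\<exists>\<Psi>. closing t \<Psi>" if t: "t \<in> T" for t
    unfolding closing_def
  \<comment> \<open>A vertex outside \<open>X.Pt t\<close> and the one two steps later lie in blocks
    with index in I, so the rank 0 of leftover vertices is only a default.\<close>
  proof (rule close_paths[where rk = "\<lambda>x. if fA x = -1 then 0 else rk t (fA x)"])
    show "finite A" "X.Pt t \<subseteq> A" "X.Qt t \<subseteq> B" by (rule X.fin X.Pt_sub X.Qt_sub)+
    show "card (X.Pt t) = card (X.Qt t)" using X.card_Pt[OF t] X.card_Qt[OF t] by simp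
    show "bij_betw (F t) (A - X.Pt t) (B - X.Qt t)" using F t by blast
    show "bij_betw (N t) B A" by (rule N(1)[OF t])
    fix x assume x: "x \<in> A - X.Pt t"
    then have fx: "fA x \<in> I" "fA x \<noteq> a t" "fA x \<noteq> -1" using X.fP by (auto simp: X.Pt_def block_def)
    have "F t x \<in> B - X.Qt t" using F t x by (meson bij_betwE)
    then have y: "F t x \<in> B - Y.Pt t" by (simp add: SP)
    then have "N t (F t x) = H t (F t x)" by (simp add: N_def)
    then have "fA (N t (F t x)) = \<nu> t (\<pi> t (fA x))" using H F t x y by simp
    moreover have "\<nu> t (\<pi> t (fA x)) \<noteq> -1"
      using Y.bij\<pi>[OF t] X.bij\<pi>[OF t] fx(1) X.I by (metis bij_betwE)
    ultimately show "(if fA (N t (F t x)) = -1 then 0 else rk t (fA (N t (F t x)))) < (if fA x = -1 then 0 else rk t (fA x))"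
      using rk[OF t fx(1,2)] fx(3) by simp
  qed
  then have "\<forall>t\<in>T. \<exists>\<Psi>. closing t \<Psi>" by (rule ballI)
  from bchoice[OF this] obtain \<Psi> where \<Psi>: "\<forall>t\<in>T. closing t (\<Psi> t)" by (elim exE)
  have bij\<Psi>: "bij_betw (\<Psi> t) (X.Pt t) (X.Qt t)" if "t \<in> T" for t using \<Psi> that unfolding closing_def by blast
  have all\<Psi>: "\<forall>t\<in>T. bij_betw (\<Psi> t) (X.Pt t) (X.Qt t)" using bij\<Psi> by (rule ballI)
  from X.special_links[OF all\<Psi>] obtain g where g: "X.linked \<Psi> T g" by blast
  define M where "M t y = (if y \<in> X.Pt t then \<Psi> t (g t y) else F t y)" for t y
  note sp1 = X.linked_matchings[OF g all\<Psi>]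
  note M = X.combine_special_generic[OF F sp1 M_def]
  have tr: "\<forall>u\<in>A. \<forall>v\<in>A. \<exists>k. ((N t \<circ> M t) ^^ k) u = v" if t: "t \<in> T" for t
  proof -
    have "\<forall>h M'. bij_betw h (X.Pt t) (X.Pt t) \<longrightarrow>
     (\<forall>u\<in>X.Pt t. \<forall>v\<in>X.Pt t. \<exists>k. (h ^^ k) u = v) \<longrightarrow>
     bij_betw M' A B \<longrightarrow> (\<forall>a\<in>A. M' a = (if a \<in> X.Pt t then \<Psi> t (h a) else F t a)) \<longrightarrow>
     (\<forall>u\<in>A. \<forall>v\<in>A. \<exists>k. ((N t \<circ> M') ^^ k) u = v)" using bspec[OF \<Psi> t] unfolding closing_def by (rule conjunct2)
    from this[rule_format, of "g t" "M t"] show ?thesis using g t M(1)[OF t] M_def unfolding X.linked_def by blast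
  qed
  have 1: "\<forall>t\<in>T. bij_betw (M t) A B \<and> bij_betw (N t) B A \<and> (\<forall>u\<in>A. \<forall>v\<in>A. \<exists>k. ((N t \<circ> M t) ^^ k) u = v) \<and>
        (\<forall>x\<in>A. (x, M t x) \<in> G1) \<and> (\<forall>y\<in>B. (y, N t y) \<in> G2)"
  proof
    fix t assume t: "t \<in> T"
    have "\<forall>x\<in>A. (x, M t x) \<in> G1" using M(2)[OF t] by blast
    moreover have "\<forall>y\<in>B. (y, N t y) \<in> G2" using N(2)[OF t] by blast
    ultimately show "bij_betw (M t) A B \<and> bij_betw (N t) B A \<and> (\<forall>u\<in>A. \<forall>v\<in>A. \<exists>k. ((N t \<circ> M t) ^^ k) u = v) \<and>
        (\<forall>x\<in>A. (x, M t x) \<in> G1) \<and> (\<forall>y\<in>B. (y, N t y) \<in> G2)"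
      using M(1)[OF t] N(1)[OF t] tr[OF t] by (intro conjI)
  qed
  have 2: "\<forall>t\<in>T. \<forall>t'\<in>T. t \<noteq> t' \<longrightarrow> (\<forall>x\<in>A. M t x \<noteq> M t' x) \<and> (\<forall>y\<in>B. N t y \<noteq> N t' y)"
    using M(3) N(3) by blast
  from 1 2 show ?thesis unfolding disjoint_hamilton_matchings_def by (intro exI conjI)
qed

section \<open>Block patterns\<close>

text \<open>For odd m the inverse of 2 modulo m is (m + 1)/2.\<close>

lemma mod_mult_half:
  fixes s m :: int
  assumes m: "odd m" "0 < m" and s: "0 \<le> s" "s < m" and e: "2 * s mod m = z mod m"
  shows "s = (z * ((m + 1) div 2)) mod m"
proof -
  have h: "2 * ((m + 1) div 2) = m + 1" using m by presburger
  have "(z * ((m + 1) div 2)) mod m = (2 * s * ((m + 1) div 2)) mod m"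
    using e by (metis mod_mult_left_eq)
  also have "2 * s * ((m + 1) div 2) = s + s * m" using h by (metis (no_types, opaque_lifting) add.commute distrib_left mult.assoc mult.commute mult.right_neutral)
  also have "(s + s * m) mod m = s" using s by simp
  finally show ?thesis by simp
qed

text \<open>Primality gives the shifts by 2u a single orbit on the m blocks, and it makes m odd, so
  that 2 is invertible. The last inequality keeps u and 2u nonzero modulo m for every reserved
  offset u.\<close>

locale shift_pattern =
  fixes m :: int and w :: int and \<mu> :: nat
  assumes prime_m: "prime m" and w: "1 \<le> w" and mw: "5 * w < m"
begin

lemma m: "0 < m" "odd m"
proof -
  show "0 < m" using w mw by simp
  show "odd m" using prime_m w mw by (intro prime_odd_int) auto
qed

text \<open>An index (s, i, u, k) stands for the k-th cycle whose blocks are mostly shifted by s and whose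
  reserved pairs lead from i to i + u and on to i + 2u.\<close>

definition I :: "int set" where "I = {0..<m}"
definition U :: "int set" where "U = {1..w}"
text \<open>The conditions keep the offsets of all generic pairs out of U: s and 2s - u occur in
  \<open>\<pi>\<close>, 2u - s and 3u - 2s in \<open>\<nu>\<close>, the second of each where
  \<open>\<pi>\<close> deviates from the shift.\<close>

definition S :: "int set" where
  "S = {s \<in> I. s \<notin> U \<and> (\<forall>u\<in>U. (2 * u - s) mod m \<notin> U \<and> (2 * s - u) mod m \<notin> U \<and> (3 * u - 2 * s) mod m \<notin> U)}"
definition T :: "(int \<times> int \<times> int \<times> nat) set" where "T = S \<times> I \<times> U \<times> {..<\<mu>}"
definition W :: "(int \<times> int) set" where "W = {(x, y). (y - x) mod m \<in> U}"

definition a :: "int \<times> int \<times> int \<times> nat \<Rightarrow> int" where "a t = (case t of (s, i, u, k) \<Rightarrow> i)"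
definition b :: "int \<times> int \<times> int \<times> nat \<Rightarrow> int" where "b t = (case t of (s, i, u, k) \<Rightarrow> (i + u) mod m)"
definition c :: "int \<times> int \<times> int \<times> nat \<Rightarrow> int" where "c t = (case t of (s, i, u, k) \<Rightarrow> (i + 2 * u) mod m)"

text \<open>A transposition followed by the shift by s: sending i to i + u displaces the block i + u
  - s, which takes over the target i + s of i.\<close>

definition \<pi> :: "int \<times> int \<times> int \<times> nat \<Rightarrow> int \<Rightarrow> int" where
  "\<pi> t x = (case t of (s, i, u, k) \<Rightarrow>
     if x = i then (i + u) mod m else if x = (i + u - s) mod m then (i + s) mod m else (x + s) mod m)"

text \<open>Chosen such that \<open>\<nu>\<close> after \<open>\<pi>\<close> is the shift by 2u.\<close>

definition \<nu> :: "int \<times> int \<times> int \<times> nat \<Rightarrow> int \<Rightarrow> int" where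
  "\<nu> t y = (inv_into I (\<pi> t) y + (case t of (s, i, u, k) \<Rightarrow> 2 * u)) mod m"

lemma finI: "finite I" "finite U" "card I = nat m" "card U = nat w"
  by (auto simp: I_def U_def)

lemma finS: "finite S" using finI by (auto simp: S_def)
lemma finT: "finite T" using finI finS by (auto simp: T_def)

lemma UI: "u \<in> U \<Longrightarrow> 1 \<le> u \<and> u \<le> w \<and> u mod m = u \<and> 5 * u < m"
  using w mw by (auto simp: U_def)

section \<open>The block permutations of a pattern\<close>

lemma shift_bij: "bij_betw (\<lambda>x. (x + s) mod m) I I"
proof -
  have "inj_on (\<lambda>x. (x + s) mod m) I"
  proof (rule inj_onI)
    fix x y assume xy: "x \<in> I" "y \<in> I" "(x + s) mod m = (y + s) mod m"
    then have "((x + s) - s) mod m = ((y + s) - s) mod m" by (metis mod_diff_left_eq)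
    then show "x = y" using xy by (simp add: I_def)
  qed
  moreover have "(\<lambda>x. (x + s) mod m) ` I \<subseteq> I" using m by (auto simp: I_def)
  ultimately show ?thesis unfolding bij_betw_def using finI(1) endo_inj_surj by blast
qed

lemma bij_\<pi>: assumes t: "t \<in> T" shows "bij_betw (\<pi> t) I I"
proof -
  obtain s i u k where t': "t = (s, i, u, k)" by (cases t)
  have i: "i \<in> I" using t t' by (auto simp: T_def)
  let ?j = "(i + u - s) mod m"
  have j: "?j \<in> I" using m by (simp add: I_def)
  have "\<pi> t x = (Transposition.transpose i ?j x + s) mod m" if "x \<in> I" for x
  proof -
    have "(?j + s) mod m = (i + u) mod m" by (simp add: mod_add_left_eq)
    then show ?thesis unfolding \<pi>_def t' Transposition.transpose_def by auto
  qed
  moreover have "bij_betw (Transposition.transpose i ?j) I I"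
    using bij_betw_transpose_iff[of i I ?j] i j by simp
  ultimately show ?thesis
    using bij_betw_trans[OF _ shift_bij[of s], of "Transposition.transpose i ?j" I]
    by (subst bij_betw_cong[where g = "\<lambda>x. (Transposition.transpose i ?j x + s) mod m"]) (auto simp: comp_def)
qed

lemma \<nu>_\<pi>: assumes "t \<in> T" "x \<in> I" "t = (s, i, u, k)" shows "\<nu> t (\<pi> t x) = (x + 2 * u) mod m"
  using bij_\<pi>[OF assms(1)] assms(2,3) by (simp add: \<nu>_def bij_betw_def inv_into_f_f)

lemma bij_\<nu>: assumes t: "t \<in> T" shows "bij_betw (\<nu> t) I I"
proof -
  obtain s i u k where t': "t = (s, i, u, k)" by (cases t)
  have "bij_betw (inv_into I (\<pi> t)) I I" using bij_\<pi>[OF t] by (rule bij_betw_inv_into)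
  moreover have "\<nu> t = (\<lambda>x. (x + 2 * u) mod m) \<circ> inv_into I (\<pi> t)" by (rule ext) (simp add: \<nu>_def t')
  ultimately show ?thesis using bij_betw_trans[OF _ shift_bij[of "2 * u"]] by simp
qed

lemma abc_I: "t \<in> T \<Longrightarrow> a t \<in> I \<and> b t \<in> I \<and> c t \<in> I"
  using m by (auto simp: T_def a_def b_def c_def I_def)

lemma \<pi>_a: "t \<in> T \<Longrightarrow> \<pi> t (a t) = b t"
  by (cases t) (simp add: \<pi>_def a_def b_def)

lemma \<nu>_b: assumes "t \<in> T" shows "\<nu> t (b t) = c t"
proof -
  obtain s i u k where t': "t = (s, i, u, k)" by (cases t)
  show ?thesis using \<nu>_\<pi>[OF assms _ t', of "a t"] \<pi>_a[OF assms] abc_I[OF assms] by (simp add: t' a_def c_def)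
qed

lemma special_ab: assumes t: "t \<in> T" shows "(a t, b t) \<in> W"
proof -
  obtain s i u k where t': "t = (s, i, u, k)" by (cases t)
  have "((i + u) mod m - i) mod m = u mod m" by (simp add: mod_diff_left_eq)
  then show ?thesis using t UI[of u] by (auto simp: t' T_def W_def a_def b_def)
qed

lemma special_bc: assumes t: "t \<in> T" shows "(b t, c t) \<in> W"
proof -
  obtain s i u k where t': "t = (s, i, u, k)" by (cases t)
  have "((i + 2 * u) mod m - (i + u) mod m) mod m = (i + 2 * u - (i + u)) mod m" by (rule mod_diff_eq)
  also have "\<dots> = u mod m" by (simp add: algebra_simps)
  finally show ?thesis using t UI[of u] by (auto simp: t' T_def W_def b_def c_def)
qed

lemma \<pi>_cases [consumes 4, case_names shift swap]:
  assumes t: "t \<in> T" "t = (s, i, u, k)" and x: "x \<in> I" "x \<noteq> i"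
  obtains "\<pi> t x = (x + s) mod m" | "x = (i + u - s) mod m" "\<pi> t x = (i + s) mod m"
proof (cases "x = (i + u - s) mod m")
  case True then show ?thesis using x t by (intro that(2)) (simp_all add: \<pi>_def)
next
  case False then show ?thesis using x t by (intro that(1)) (simp add: \<pi>_def)
qed

lemma generic_\<pi>: assumes t: "t \<in> T" and x: "x \<in> I" "x \<noteq> a t" shows "(x, \<pi> t x) \<notin> W"
proof -
  obtain s i u k where t': "t = (s, i, u, k)" by (cases t)
  have su: "s \<in> S" "u \<in> U" using t t' by (auto simp: T_def)
  have x': "x \<noteq> i" using x t' by (simp add: a_def)
  from t t' x(1) x' show ?thesis
  proof (cases rule: \<pi>_cases)
    case shift
    have "(\<pi> t x - x) mod m = s mod m" unfolding shift by (simp add: mod_diff_left_eq)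
    also have "\<dots> = s" using su by (auto simp: S_def I_def)
    finally show ?thesis using su by (auto simp: W_def S_def)
  next
    case swap
    have "(\<pi> t x - x) mod m = ((i + s) - (i + u - s)) mod m" unfolding swap(2)
      by (subst swap(1)) (rule mod_diff_eq)
    also have "(i + s) - (i + u - s) = 2 * s - u" by simp
    finally show ?thesis using su by (auto simp: W_def S_def)
  qed
qed

lemma generic_\<nu>: assumes t: "t \<in> T" and y: "y \<in> I" "y \<noteq> b t" shows "(y, \<nu> t y) \<notin> W"
proof -
  obtain s i u k where t': "t = (s, i, u, k)" by (cases t)
  have su: "s \<in> S" "u \<in> U" using t t' by (auto simp: T_def)
  obtain x where x: "x \<in> I" "y = \<pi> t x" using bij_\<pi>[OF t] y(1) by (auto simp: bij_betw_def)
  have x': "x \<noteq> i" using x y \<pi>_a[OF t] t' by (auto simp: a_def)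
  have n: "\<nu> t y = (x + 2 * u) mod m" using \<nu>_\<pi>[OF t x(1) t'] x by simp
  from t t' x(1) x' show ?thesis
  proof (cases rule: \<pi>_cases)
    case shift
    have "(\<nu> t y - y) mod m = ((x + 2 * u) - (x + s)) mod m" unfolding n unfolding x(2) shift by (rule mod_diff_eq)
    also have "(x + 2 * u) - (x + s) = 2 * u - s" by simp
    finally show ?thesis using su by (auto simp: W_def S_def)
  next
    case swap
    have "\<nu> t y = ((i + u - s) + 2 * u) mod m" unfolding n by (subst swap(1)) (simp add: mod_add_left_eq)
    then have "(\<nu> t y - y) mod m = ((i + u - s) + 2 * u - (i + s)) mod m" unfolding x(2) swap(2)
      by (simp only: mod_diff_eq)
    also have "(i + u - s) + 2 * u - (i + s) = 3 * u - 2 * s" by simp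
    finally show ?thesis using su by (auto simp: W_def S_def)
  qed
qed

section \<open>How many patterns use a given pair of blocks\<close>

lemma card_img2: "card (h ` (I \<times> U \<times> {..<\<mu>})) \<le> nat m * nat w * \<mu>"
proof -
  have "card (h ` (I \<times> U \<times> {..<\<mu>})) \<le> card (I \<times> U \<times> {..<\<mu>})" using finI by (intro card_image_le) auto
  then show ?thesis using finI by (simp add: card_cartesian_product mult.assoc)
qed

lemma card_img1: "card (h ` (U \<times> {..<\<mu>})) \<le> nat w * \<mu>"
proof -
  have "card (h ` (U \<times> {..<\<mu>})) \<le> card (U \<times> {..<\<mu>})" using finI by (intro card_image_le) auto
  then show ?thesis using finI by (simp add: card_cartesian_product)
qed

text \<open>At a shifted block s = y - x, which leaves m w \<mu> choices of i, u and k. At the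
  swapped block 2s = y - x + u, so u determines s by halving modulo m and then i = y - s, which
  leaves w \<mu> choices.\<close>

lemma load_\<pi>: assumes x: "x \<in> I" and y: "y \<in> I"
  shows "card {t \<in> T. x \<noteq> a t \<and> \<pi> t x = y} \<le> nat m * nat w * \<mu> + nat w * \<mu>"
proof -
  define h1 where "h1 = (\<lambda>(i :: int, u :: int, k :: nat). ((y - x) mod m, i, u, k))"
  define s2 where "s2 u = ((y - x + u) * ((m + 1) div 2)) mod m" for u
  define h2 where "h2 = (\<lambda>(u, k :: nat). (s2 u, (y - s2 u) mod m, u, k))"
  have "{t \<in> T. x \<noteq> a t \<and> \<pi> t x = y} \<subseteq> h1 ` (I \<times> U \<times> {..<\<mu>}) \<union> h2 ` (U \<times> {..<\<mu>})"
  proof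
    fix t assume "t \<in> {t \<in> T. x \<noteq> a t \<and> \<pi> t x = y}"
    then have t: "t \<in> T" "x \<noteq> a t" "\<pi> t x = y" by auto
    obtain s i u k where t': "t = (s, i, u, k)" by (cases t)
    have mem: "s \<in> I" "i \<in> I" "u \<in> U" "k < \<mu>" using t t' by (auto simp: T_def S_def)
    have x': "x \<noteq> i" using t t' by (simp add: a_def)
    from t(1) t' x(1) x' show "t \<in> h1 ` (I \<times> U \<times> {..<\<mu>}) \<union> h2 ` (U \<times> {..<\<mu>})"
    proof (cases rule: \<pi>_cases)
      case shift
      then have "(y - x) mod m = s mod m" unfolding t(3)[symmetric] by (simp add: mod_diff_left_eq)
      then have "s = (y - x) mod m" using mem by (simp add: I_def)
      then have "t = h1 (i, u, k)" by (simp add: h1_def t')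
      then show ?thesis using mem by auto
    next
      case swap
      have "(y - x) mod m = ((i + s) - (i + u - s)) mod m" using swap(2) t(3)
        by (subst swap(1)) (simp only: mod_diff_eq)
      also have "(i + s) - (i + u - s) = 2 * s - u" by simp
      finally have "2 * s mod m = (y - x + u) mod m"
        by (metis add.commute diff_add_cancel mod_add_right_eq)
      then have s: "s = s2 u" unfolding s2_def using mem m by (intro mod_mult_half) (auto simp: I_def)
      have "(y - s) mod m = i mod m" unfolding t(3)[symmetric] swap(2) by (simp add: mod_diff_left_eq)
      then have "i = (y - s2 u) mod m" using mem s by (simp add: I_def)
      then have "t = h2 (u, k)" using s by (simp add: h2_def t')
      then show ?thesis using mem by auto
    qed
  qed
  then have "card {t \<in> T. x \<noteq> a t \<and> \<pi> t x = y} \<le> card (h1 ` (I \<times> U \<times> {..<\<mu>}) \<union> h2 ` (U \<times> {..<\<mu>}))"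
    using finI by (intro card_mono) auto
  also have "\<dots> \<le> card (h1 ` (I \<times> U \<times> {..<\<mu>})) + card (h2 ` (U \<times> {..<\<mu>}))" by (rule card_Un_le)
  finally show ?thesis using card_img2[of h1] card_img1[of h2] by linarith
qed

text \<open>The same count, made at the block x with y = \<open>\<pi> t x\<close>: the shift gives s
  = y - z + 2u, the swap 2s = y - z + 3u and again i = y - s.\<close>

lemma load_\<nu>: assumes y: "y \<in> I" and z: "z \<in> I"
  shows "card {t \<in> T. y \<noteq> b t \<and> \<nu> t y = z} \<le> nat m * nat w * \<mu> + nat w * \<mu>"
proof -
  define h1 where "h1 = (\<lambda>(i :: int, u :: int, k :: nat). ((y - z + 2 * u) mod m, i, u, k))"
  define s2 where "s2 u = ((y - z + 3 * u) * ((m + 1) div 2)) mod m" for u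
  define h2 where "h2 = (\<lambda>(u, k :: nat). (s2 u, (y - s2 u) mod m, u, k))"
  have "{t \<in> T. y \<noteq> b t \<and> \<nu> t y = z} \<subseteq> h1 ` (I \<times> U \<times> {..<\<mu>}) \<union> h2 ` (U \<times> {..<\<mu>})"
  proof
    fix t assume "t \<in> {t \<in> T. y \<noteq> b t \<and> \<nu> t y = z}"
    then have t: "t \<in> T" "y \<noteq> b t" "\<nu> t y = z" by auto
    obtain s i u k where t': "t = (s, i, u, k)" by (cases t)
    have mem: "s \<in> I" "i \<in> I" "u \<in> U" "k < \<mu>" using t t' by (auto simp: T_def S_def)
    obtain x where x: "x \<in> I" "y = \<pi> t x" using bij_\<pi>[OF t(1)] y(1) by (auto simp: bij_betw_def)
    have x': "x \<noteq> i" using x t \<pi>_a[OF t(1)] t' by (auto simp: a_def)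
    have zx: "z = (x + 2 * u) mod m" using \<nu>_\<pi>[OF t(1) x(1) t'] x t by simp
    from t(1) t' x(1) x' show "t \<in> h1 ` (I \<times> U \<times> {..<\<mu>}) \<union> h2 ` (U \<times> {..<\<mu>})"
    proof (cases rule: \<pi>_cases)
      case shift
      have "(y - z) mod m = ((x + s) - (x + 2 * u)) mod m" unfolding zx x(2) shift by (rule mod_diff_eq)
      also have "(x + s) - (x + 2 * u) = s - 2 * u" by simp
      finally have "s mod m = (y - z + 2 * u) mod m"
        by (metis add.commute diff_add_cancel mod_add_right_eq)
      then have "s = (y - z + 2 * u) mod m" using mem by (simp add: I_def)
      then have "t = h1 (i, u, k)" by (simp add: h1_def t')
      then show ?thesis using mem by auto
    next
      case swap
      have zz: "z = ((i + u - s) + 2 * u) mod m" unfolding zx by (subst swap(1)) (simp add: mod_add_left_eq)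
      have "(y - z) mod m = ((i + s) - ((i + u - s) + 2 * u)) mod m" unfolding zz x(2) swap(2) by (rule mod_diff_eq)
      also have "(i + s) - ((i + u - s) + 2 * u) = 2 * s - 3 * u" by simp
      finally have "2 * s mod m = (y - z + 3 * u) mod m"
        by (metis add.commute diff_add_cancel mod_add_right_eq)
      then have s: "s = s2 u" unfolding s2_def using mem m by (intro mod_mult_half) (auto simp: I_def)
      have "(y - s) mod m = i mod m" unfolding x(2) swap(2) by (simp add: mod_diff_left_eq)
      then have "i = (y - s2 u) mod m" using mem s by (simp add: I_def)
      then have "t = h2 (u, k)" using s by (simp add: h2_def t')
      then show ?thesis using mem by auto
    qed
  qed
  then have "card {t \<in> T. y \<noteq> b t \<and> \<nu> t y = z} \<le> card (h1 ` (I \<times> U \<times> {..<\<mu>}) \<union> h2 ` (U \<times> {..<\<mu>}))"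
    using finI by (intro card_mono) auto
  also have "\<dots> \<le> card (h1 ` (I \<times> U \<times> {..<\<mu>})) + card (h2 ` (U \<times> {..<\<mu>}))" by (rule card_Un_le)
  finally show ?thesis using card_img2[of h1] card_img1[of h2] by linarith
qed

lemma card_offset:
  assumes "\<And>s i u k. e (s, i, u, k) = (i + z u) mod m"
  shows "card {t \<in> T. e t = x} \<le> nat m * nat w * \<mu>"
proof -
  define h where "h = (\<lambda>(s :: int, u :: int, k :: nat). (s, (x - z u) mod m, u, k))"
  have "{t \<in> T. e t = x} \<subseteq> h ` (I \<times> U \<times> {..<\<mu>})"
  proof
    fix t assume t: "t \<in> {t \<in> T. e t = x}"
    obtain s i u k where t': "t = (s, i, u, k)" by (cases t)
    have mem: "s \<in> I" "i \<in> I" "u \<in> U" "k < \<mu>" using t t' by (auto simp: T_def S_def)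
    have "x = (i + z u) mod m" using t t' assms by simp
    then have "(x - z u) mod m = i mod m" by (simp add: mod_diff_left_eq)
    then have "t = h (s, u, k)" using mem by (simp add: h_def t' I_def)
    then show "t \<in> h ` (I \<times> U \<times> {..<\<mu>})" using mem by auto
  qed
  then have "card {t \<in> T. e t = x} \<le> card (h ` (I \<times> U \<times> {..<\<mu>}))" using finI by (intro card_mono) auto
  then show ?thesis using card_img2[of h] by linarith
qed

lemma load_a: "card {t \<in> T. a t = x} \<le> nat m * nat w * \<mu>"
proof -
  have "{t \<in> T. a t = x} = {t \<in> T. a t mod m = x}" by (auto simp: T_def a_def I_def)
  then show ?thesis using card_offset[of "\<lambda>t. a t mod m" "\<lambda>u. 0" x] by (simp add: a_def)
qed

lemma load_b: "card {t \<in> T. b t = x} \<le> nat m * nat w * \<mu>"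
  by (rule card_offset[of _ "\<lambda>u. u"]) (simp add: b_def)

lemma load_c: "card {t \<in> T. c t = x} \<le> nat m * nat w * \<mu>"
  by (rule card_offset[of _ "\<lambda>u. 2 * u"]) (simp add: c_def)

text \<open>The two ends of a reserved pair determine u as their difference and then i, so only s
  and k are free. The factor w saved against a generic pair is what keeps the reserved pairs
  dense.\<close>

lemma card_offset2:
  assumes "\<And>t. t \<in> T \<Longrightarrow> (case t of (s, i, u, k) \<Rightarrow> (i + z * u) mod m) = e t"
     "\<And>t. t \<in> T \<Longrightarrow> (case t of (s, i, u, k) \<Rightarrow> (i + (z + 1) * u) mod m) = e' t"
  shows "card {t \<in> T. e t = x \<and> e' t = y} \<le> nat m * \<mu>"
proof -
  define u where "u = (y - x) mod m"
  define h where "h = (\<lambda>(s :: int, k :: nat). (s, (x - z * u) mod m, u, k))"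
  have "{t \<in> T. e t = x \<and> e' t = y} \<subseteq> h ` (I \<times> {..<\<mu>})"
  proof
    fix t assume t: "t \<in> {t \<in> T. e t = x \<and> e' t = y}"
    obtain s i v k where t': "t = (s, i, v, k)" by (cases t)
    have mem: "s \<in> I" "i \<in> I" "v \<in> U" "k < \<mu>" using t t' by (auto simp: T_def S_def)
    have x: "x = (i + z * v) mod m" and y: "y = (i + (z + 1) * v) mod m" using t t' assms(1)[of t] assms(2)[of t] by auto
    have "(y - x) mod m = ((i + (z + 1) * v) - (i + z * v)) mod m" unfolding x y by (rule mod_diff_eq)
    also have "(i + (z + 1) * v) - (i + z * v) = v" by (simp add: algebra_simps)
    finally have u: "u = v" using UI[OF mem(3)] by (simp add: u_def)
    have "(x - z * v) mod m = i mod m" unfolding x by (simp add: mod_diff_left_eq)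
    then have "t = h (s, k)" using mem u by (simp add: h_def t' I_def)
    then show "t \<in> h ` (I \<times> {..<\<mu>})" using mem by auto
  qed
  then have "card {t \<in> T. e t = x \<and> e' t = y} \<le> card (h ` (I \<times> {..<\<mu>}))" using finI by (intro card_mono) auto
  also have "\<dots> \<le> card (I \<times> {..<\<mu>})" using finI by (intro card_image_le) auto
  finally show ?thesis using finI by (simp add: card_cartesian_product)
qed

lemma load_ab: "card {t \<in> T. a t = x \<and> b t = y} \<le> nat m * \<mu>"
  by (rule card_offset2[of 0]) (auto simp: a_def b_def T_def I_def)

lemma load_bc: "card {t \<in> T. b t = x \<and> c t = y} \<le> nat m * \<mu>"
  by (rule card_offset2[of 1]) (auto simp: b_def c_def)

text \<open>Each of the three excluded relations determines s from a pair in U \<times> U, in two of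
  them by halving modulo m; the excluded s in U number w \<le> w^2.\<close>

lemma card_S: "nat m \<le> card S + 4 * (nat w)\<^sup>2"
proof -
  let ?h = "(m + 1) div 2"
  define B where "B = U \<union> (\<lambda>(u, v). (2 * u - v) mod m) ` (U \<times> U) \<union> (\<lambda>(u, v). ((u + v) * ?h) mod m) ` (U \<times> U)
      \<union> (\<lambda>(u, v). ((3 * u - v) * ?h) mod m) ` (U \<times> U)"
  have "I - S \<subseteq> B"
  proof
    fix s assume s: "s \<in> I - S"
    then have sI: "0 \<le> s" "s < m" by (auto simp: I_def)
    consider "s \<in> U" | u where "u \<in> U" "(2 * u - s) mod m \<in> U" | u where "u \<in> U" "(2 * s - u) mod m \<in> U"
      | u where "u \<in> U" "(3 * u - 2 * s) mod m \<in> U" using s by (auto simp: S_def)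
    then show "s \<in> B"
    proof cases
      case 1 then show ?thesis by (simp add: B_def)
    next
      case (2 u)
      define v where "v = (2 * u - s) mod m"
      have "(2 * u - v) mod m = s mod m" unfolding v_def by (simp add: mod_diff_right_eq)
      then have "s = (2 * u - v) mod m" using sI by simp
      then have "s \<in> (\<lambda>(u, v). (2 * u - v) mod m) ` (U \<times> U)" using 2 v_def by force
      then show ?thesis by (simp add: B_def)
    next
      case (3 u)
      define v where "v = (2 * s - u) mod m"
      have "2 * s mod m = (u + v) mod m" unfolding v_def by (simp add: mod_add_right_eq)
      then have "s = ((u + v) * ?h) mod m" using sI m by (intro mod_mult_half) auto
      then have "s \<in> (\<lambda>(u, v). ((u + v) * ?h) mod m) ` (U \<times> U)" using 3 v_def by force
      then show ?thesis by (simp add: B_def)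
    next
      case (4 u)
      define v where "v = (3 * u - 2 * s) mod m"
      have "2 * s mod m = (3 * u - v) mod m" unfolding v_def by (simp add: mod_diff_right_eq)
      then have "s = ((3 * u - v) * ?h) mod m" using sI m by (intro mod_mult_half) auto
      then have "s \<in> (\<lambda>(u, v). ((3 * u - v) * ?h) mod m) ` (U \<times> U)" using 4 v_def by force
      then show ?thesis by (simp add: B_def)
    qed
  qed
  have i: "card (h ` (U \<times> U)) \<le> (nat w)\<^sup>2" for h :: "int \<times> int \<Rightarrow> int"
    using card_image_le[of "U \<times> U" h] finI by (simp add: card_cartesian_product power2_eq_square)
  have "card B \<le> nat w + (nat w)\<^sup>2 + (nat w)\<^sup>2 + (nat w)\<^sup>2"
    unfolding B_def by (intro order.trans[OF card_Un_le] add_mono i) (simp add: finI)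
  moreover have "nat w \<le> (nat w)\<^sup>2" using w by (intro self_le_power) auto
  ultimately have "card B \<le> 4 * (nat w)\<^sup>2" by simp
  moreover have "card (I - S) \<le> card B" using \<open>I - S \<subseteq> B\<close> finI by (intro card_mono) (auto simp: B_def)
  moreover have "card I \<le> card S + card (I - S)"
    using finS finI card_Un_le[of S "I - S"] card_mono[of "S \<union> (I - S)" I] by auto
  ultimately show ?thesis using finI by linarith
qed

lemma card_T: "(nat m - 4 * (nat w)\<^sup>2) * (nat m * nat w * \<mu>) \<le> card T"
proof -
  have "card T = card S * (nat m * nat w * \<mu>)" using finI by (simp add: T_def card_cartesian_product mult.assoc)
  moreover have "nat m - 4 * (nat w)\<^sup>2 \<le> card S" using card_S by simp
  ultimately show ?thesis by (metis mult_le_mono1)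
qed

text \<open>The rank counts the steps of the shift by 2u from a block to the block i.\<close>

definition rk :: "int \<times> int \<times> int \<times> nat \<Rightarrow> int \<Rightarrow> nat" where
  "rk t x = (case t of (s, i, u, k) \<Rightarrow> LEAST n. (x + int n * (2 * u)) mod m = i)"

text \<open>As 0 < 2u < m and m is prime, 2u is invertible modulo m, so every block reaches i by
  shifts by 2u. From x other than i one shift brings it one step nearer.\<close>

lemma rk_decreasing: assumes t: "t \<in> T" and x: "x \<in> I" "x \<noteq> a t" shows "rk t (\<nu> t (\<pi> t x)) < rk t x"
proof -
  obtain s i u k where t': "t = (s, i, u, k)" by (cases t)
  have iu: "i \<in> I" "u \<in> U" using t t' by (auto simp: T_def)
  have "\<not> m dvd 2 * u" using UI[OF iu(2)] zdvd_not_zless[of "2 * u" m] by auto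
  then have "coprime m (2 * u)" by (rule prime_imp_coprime[OF prime_m])
  then obtain z where z: "[2 * u * z = 1] (mod m)" using cong_solve_coprime_int[of "2 * u" m] by (auto simp: coprime_commute)
  define n where "n = nat ((z * (i - x)) mod m)"
  have "int n = (z * (i - x)) mod m" using m by (simp add: n_def)
  then have "(x + int n * (2 * u)) mod m = (x + (z * (i - x)) * (2 * u)) mod m"
    by (metis mod_add_right_eq mod_mult_left_eq)
  also have "\<dots> = (x + (2 * u * z) * (i - x)) mod m" by (simp add: algebra_simps)
  also have "\<dots> = (x + 1 * (i - x)) mod m" using z unfolding cong_def
    by (metis mod_add_right_eq mod_mult_left_eq)
  also have "\<dots> = i" using iu by (simp add: I_def)
  finally have ex: "(x + int n * (2 * u)) mod m = i" .
  define d where "d = (LEAST n. (x + int n * (2 * u)) mod m = i)"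
  have d: "(x + int d * (2 * u)) mod m = i" unfolding d_def by (rule LeastI) (rule ex)
  have "x mod m \<noteq> i" using x t' by (simp add: I_def a_def)
  then have "d \<noteq> 0" using d by (intro notI) simp
  then obtain d' where d': "d = Suc d'" by (cases d) auto
  have "((x + 2 * u) mod m + int d' * (2 * u)) mod m = (x + 2 * u + int d' * (2 * u)) mod m" by (simp add: mod_add_left_eq)
  also have "x + 2 * u + int d' * (2 * u) = x + int d * (2 * u)" by (simp add: d' algebra_simps)
  finally have "((x + 2 * u) mod m + int d' * (2 * u)) mod m = i" using d by simp
  then have "rk t ((x + 2 * u) mod m) \<le> d'" unfolding rk_def t' by (auto intro: Least_le)
  moreover have "rk t x = d" by (simp add: rk_def t' d_def)
  ultimately show ?thesis using \<nu>_\<pi>[OF t x(1) t'] d' by simp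
qed

end

section \<open>Choice of the constants\<close>

text \<open>Since \<mu> is about k/((m + 1) w), the number of patterns is at least about (1 - e) m
  k, hence about (1 - 2e) c m N. The remaining 6e pays, by c \<ge> 1/2 and the bound on N, for the
  rounding of k and \<mu> and for the up to m vertices that m N misses.\<close>

lemma card_patterns_lower_bound:
  fixes c e :: real
  assumes c: "1/2 \<le> c" "c \<le> 1" and e: "0 < e" "8 * e \<le> 1" and w: "1 \<le> w"
    and m: "4 * real w ^ 2 + 2 \<le> e * real m"
    and k: "(1 - e) * c * real N - 1 \<le> real k"
    and \<mu>: "real k / (real (m + 1) * real w) - 1 \<le> real \<mu>"
    and N: "real m * real w + 2 \<le> 3 * e * real N" and n: "n \<le> m * N + m"
  shows "(1 - 8 * e) * c * real n \<le> real ((m - 4 * w\<^sup>2) * (m * w * \<mu>))"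
proof -
  have "e * real m > 0" using m by (smt (verit) zero_le_power2)
  then have m0: "real m > 0" using e by (simp add: zero_less_mult_iff)
  have "e * real m \<le> 1 * real m" using e by (intro mult_right_mono) auto
  then have "real (4 * w\<^sup>2) \<le> real m" using m by simp
  then have "4 * w\<^sup>2 \<le> m" by (simp only: of_nat_le_iff)
  then have mw: "real (m - 4 * w\<^sup>2) = real m - 4 * real w ^ 2" by (simp add: of_nat_diff)
  define q where "q = real m - 4 * real w ^ 2"
  have q: "(1 - e) * real (m + 1) \<le> q" "0 \<le> q" "q \<le> real m"
    unfolding q_def using m e \<open>real (4 * w\<^sup>2) \<le> real m\<close> by (auto simp: algebra_simps)
  have w0: "real w > 0" using w by simp
  have "(1 - e) * (real m * real k) - real m * (real m * real w) \<le> q * (real m * real w * \<mu>)"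
  proof -
    have "(1 - e) * real k \<le> q / real (m + 1) * real k" using q by (intro mult_right_mono) (auto simp: field_simps)
    then have "real m * ((1 - e) * real k) \<le> real m * (q / real (m + 1) * real k)" by (intro mult_left_mono) auto
    moreover have "q * (real m * real w * (real k / (real (m + 1) * real w) - 1)) \<le> q * (real m * real w * \<mu>)"
      using \<mu> q w0 by (intro mult_left_mono) auto
    moreover have "q * (real m * real w * (real k / (real (m + 1) * real w) - 1)) =
        real m * (q / real (m + 1) * real k) - q * (real m * real w)"
    proof -
      define z where "z = real k / (real (m + 1) * real w)"
      have zw: "z * real w = real k / real (m + 1)" using w0 by (simp add: z_def)
      have "real m * (q / real (m + 1) * real k) = real m * q * (z * real w)" unfolding zw by simp
      then show ?thesis unfolding z_def[symmetric] by (simp add: algebra_simps)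
    qed
    moreover have "q * (real m * real w) \<le> real m * (real m * real w)" using q by (intro mult_right_mono) auto
    ultimately show ?thesis by (simp add: mult.left_commute)
  qed
  moreover have "(1 - 2 * e) * c * N - 1 \<le> (1 - e) * real k"
  proof -
    have "(1 - e) * ((1 - e) * c * real N - 1) \<le> (1 - e) * real k" using k e by (intro mult_left_mono) auto
    moreover have "0 \<le> e * e * c * N" using c e by simp
    ultimately show ?thesis using e by (simp add: algebra_simps)
  qed
  then have "real m * ((1 - 2 * e) * c * N - 1) \<le> real m * ((1 - e) * real k)" by (intro mult_left_mono) auto
  moreover have "(1 - 8 * e) * c * real n \<le> real m * ((1 - 2 * e) * c * N - 1) - real m * (real m * real w)"
  proof -
    have "real n \<le> real (m * N + m)" using n by (simp only: of_nat_le_iff)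
    then have "(1 - 8 * e) * c * real n \<le> (1 - 8 * e) * c * (real m * N + real m)" using e c by (intro mult_left_mono) auto
    also have "\<dots> = real m * ((1 - 8 * e) * c * N + (1 - 8 * e) * c)" by (simp add: algebra_simps)
    also have "\<dots> \<le> real m * ((1 - 2 * e) * c * N - 1 - real m * real w)"
    proof (rule mult_left_mono)
      have "3 * e * real N \<le> 6 * e * c * real N" using c e by (intro mult_right_mono) auto
      moreover have "(1 - 8 * e) * c \<le> 1 * 1" using c e by (intro mult_mono) auto
      ultimately show "(1 - 8 * e) * c * N + (1 - 8 * e) * c \<le> (1 - 2 * e) * c * N - 1 - real m * real w"
        using N by (simp add: algebra_simps)
    qed simp
    finally show ?thesis by (simp add: algebra_simps)
  qed
  ultimately show ?thesis unfolding of_nat_mult mw q_def[symmetric] by (simp add: mult.left_commute mult.assoc)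
qed

text \<open>The deviation of a random partition fits with all roundings into \<tau> N; the union
  bound runs over at most 4 m N neighbourhoods; k matchings per pair carry \<mu> copies of every
  pattern; the degree conditions of \<open>block_stage\<close> hold for every possible number of
  leftover vertices; and the patterns are numerous enough.\<close>

definition admissible_block_size :: "real \<Rightarrow> real \<Rightarrow> real \<Rightarrow> real \<Rightarrow> real \<Rightarrow> nat \<Rightarrow> nat \<Rightarrow> nat \<Rightarrow> bool" where
  "admissible_block_size c \<epsilon> e \<tau> \<sigma> m w N \<longleftrightarrow>
     \<sigma> * real N + 3 \<le> \<tau> * real N \<and> 2 * real (4 * m * N) * real m * exp (- (\<sigma>\<^sup>2 * real N / 8)) < 1 \<and> 1 \<le> N \<and>
      (\<exists>k \<mu>. real k \<le> (1 - e) * c * real N \<and> k \<le> N \<and> m * w * \<mu> + w * \<mu> \<le> k \<and>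
        (\<forall>\<rho><m. real (N + 5 * \<rho> + 2 + 2 * (m * \<mu>)) \<le> 2 * ((c - \<tau>) * real N) \<and>
          real (2 * \<rho> + 1 + m * w * \<mu>) \<le> (c - \<tau>) * real N \<and> 2 * \<rho> + 2 \<le> N) \<and>
        (\<forall>n\<le>m * N + m. (1 - \<epsilon>) * c * real n \<le> real ((m - 4 * w\<^sup>2) * (m * w * \<mu>))))"

lemma parameters:
  fixes c \<epsilon> :: real
  assumes c: "1/2 < c" "c \<le> 1" and \<epsilon>: "0 < \<epsilon>" "\<epsilon> < 1"
  shows "\<exists>(\<beta>::real) e \<tau> \<sigma> (m::nat) w n1. c \<ge> 1/2 + \<beta> \<and> \<beta> > 0 \<and> e > 0 \<and> e \<le> 1 \<and> 5 * \<tau> \<le> e * \<beta> \<and> \<tau> \<ge> 0 \<and>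
    0 < \<sigma> \<and> \<sigma> \<le> 1 \<and> prime m \<and> 1 \<le> w \<and> 5 * w < m \<and>
    (\<forall>N\<ge>n1. admissible_block_size c \<epsilon> e \<tau> \<sigma> m w N)"
proof -
  \<comment> \<open>\<open>card_patterns_lower_bound\<close> loses 8e, hence e = \<epsilon>/8. A
    reserved pair has load at most N/w, which w \<ge> 4/\<beta> makes at most \<beta> N/4. Taking
    \<sigma> = \<tau>/2 leaves half of \<tau> N for roundings.\<close>
  define \<beta> where "\<beta> = c - 1/2"
  define e where "e = \<epsilon> / 8"
  define \<tau> where "\<tau> = e * \<beta> / 8"
  define \<sigma> where "\<sigma> = \<tau> / 2"
  define w where "w = nat \<lceil>4 / \<beta>\<rceil>"
  have \<beta>: "0 < \<beta>" "\<beta> \<le> 1/2" using c by (auto simp: \<beta>_def)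
  have e: "0 < e" "8 * e \<le> 1" using \<epsilon> by (auto simp: e_def)
  have "e * \<beta> \<le> (1/8) * \<beta>" using e \<beta> by (intro mult_right_mono) auto
  then have t: "0 < \<tau>" "8 * \<tau> = e * \<beta>" "\<tau> \<le> \<beta> / 64" using e \<beta> by (auto simp: \<tau>_def)
  have s: "0 < \<sigma>" "\<sigma> \<le> 1" using t \<beta> by (auto simp: \<sigma>_def)
  have "0 < 4 / \<beta>" using \<beta> by simp
  then have w: "4 / \<beta> \<le> real w" "1 \<le> w" unfolding w_def by linarith+
  obtain m where m: "prime m" "5 * w + nat \<lceil>(4 * real w ^ 2 + 2) / e\<rceil> < m" using bigger_prime by blast
  have "(4 * real w ^ 2 + 2) / e \<le> real (nat \<lceil>(4 * real w ^ 2 + 2) / e\<rceil>)" by (rule real_nat_ceiling_ge)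
  also have "\<dots> \<le> real m" using m(2) by linarith
  finally have me: "4 * real w ^ 2 + 2 \<le> e * real m" using e by (simp add: field_simps)
  define a where "a = \<sigma>\<^sup>2 / 8"
  have a: "0 < a" using s by (simp add: a_def)
  \<comment> \<open>A sum of nonnegative thresholds exceeds each of them, so N \<ge> X yields the
    six inequalities \<open>C\<close> together.\<close>
  define X where "X = (5 * real m + 2) / \<beta> + (2 * real m + 1) / (e / 4) + (2 * real m + 2) + (16 * real m ^ 2 + 1) / a ^ 2
    + 6 / \<tau> + (real m * real w + 2) / (3 * e)"
  have pos: "0 \<le> (5 * real m + 2) / \<beta>" "0 \<le> (2 * real m + 1) / (e / 4)" "0 \<le> (16 * real m ^ 2 + 1) / a ^ 2"
    "0 \<le> 6 / \<tau>" "0 \<le> (real m * real w + 2) / (3 * e)" using \<beta> e t by auto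
  have main: "admissible_block_size c \<epsilon> e \<tau> \<sigma> m w N"
    if N: "N \<ge> nat \<lceil>X\<rceil>" for N
  proof -
    have "X \<le> real N" using N by linarith
    then have "(5 * real m + 2) / \<beta> \<le> N" "(2 * real m + 1) / (e / 4) \<le> N" "2 * real m + 2 \<le> N"
      "(16 * real m ^ 2 + 1) / a ^ 2 \<le> N" "6 / \<tau> \<le> N" "(real m * real w + 2) / (3 * e) \<le> N"
      using pos unfolding X_def by linarith+
    then have C: "5 * real m + 2 \<le> \<beta> * N" "2 * real m + 1 \<le> e / 4 * N" "2 * real m + 2 \<le> N"
      "16 * real m ^ 2 + 1 \<le> a ^ 2 * N" "6 \<le> \<tau> * N" "real m * real w + 2 \<le> 3 * e * N"
      using \<beta> e a t by (simp_all add: field_simps)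
    have N0: "real N > 0" using C(3) by linarith
    have N1: "\<sigma> * real N + 3 \<le> \<tau> * real N" using C(5) by (simp add: \<sigma>_def)
    have N2: "2 * real (4 * m * N) * real m * exp (- (\<sigma>\<^sup>2 * real N / 8)) < 1"
    proof -
      \<comment> \<open>The quadratic term of the exponential series is enough, because (a N)^2/2
        exceeds 8 m^2 N.\<close>
      have "1 + a * N + (a * N)\<^sup>2 / 2 \<le> exp (a * N)" using a N0 by (intro exp_lower_Taylor_quadratic) auto
      moreover have "16 * real m ^ 2 * N < a ^ 2 * N * N" using C(4) N0 by (intro mult_strict_right_mono) auto
      moreover have "0 \<le> a * N" using a N0 by simp
      ultimately have "8 * real m ^ 2 * N < exp (a * N)" by (simp add: power2_eq_square algebra_simps)
      then have "8 * real m ^ 2 * N * exp (- (a * N)) < 1" by (simp add: exp_minus field_simps)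
      then show ?thesis by (simp add: a_def power2_eq_square mult_ac)
    qed
    define k where "k = nat \<lfloor>(1 - e) * c * N\<rfloor>"
    \<comment> \<open>The largest \<mu> for which the load bound (m + 1) w \<mu> of a generic pair
      is at most k.\<close>
    define \<mu> where "\<mu> = k div ((m + 1) * w)"
    have k0: "0 \<le> (1 - e) * c * N" using c e by auto
    have k: "real k \<le> (1 - e) * c * N" "(1 - e) * c * N - 1 \<le> real k" using k0 unfolding k_def by linarith+
    have "(1 - e) * c * N \<le> 1 * real N" using c e by (intro mult_right_mono) (auto intro: mult_le_one)
    then have kN: "real k \<le> real N" using k by linarith
    have "\<mu> * ((m + 1) * w) \<le> k" unfolding \<mu>_def by (rule div_times_less_eq_dividend)
    then have load: "m * w * \<mu> + w * \<mu> \<le> k" by (simp add: algebra_simps)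
    then have "real (m * w * \<mu>) \<le> real k" by linarith
    then have L': "real (m * w * \<mu>) \<le> (1 - e) * c * N" using k by linarith
    have q: "real k / real ((m + 1) * w) - 1 \<le> real \<mu>"
    proof -
      have "real_of_int \<lfloor>real k / real ((m + 1) * w)\<rfloor> = real \<mu>" unfolding \<mu>_def floor_divide_of_nat_eq by simp
      then show ?thesis by linarith
    qed
    have L: "real (m * \<mu>) \<le> \<beta> / 4 * N"
    proof -
      have "4 / \<beta> * real (m * \<mu>) \<le> real w * real (m * \<mu>)" using w by (intro mult_right_mono) auto
      also have "\<dots> = real (m * w * \<mu>)" by simp
      also have "\<dots> \<le> real N" using \<open>real (m * w * \<mu>) \<le> real k\<close> kN by linarith
      finally show ?thesis using \<beta> by (simp add: field_simps)
    qed
    have tN: "\<tau> * N \<le> \<beta> / 64 * N" using t N0 by (intro mult_right_mono) auto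
    have "real (N + 5 * \<rho> + 2 + 2 * (m * \<mu>)) \<le> 2 * ((c - \<tau>) * real N) \<and>
          real (2 * \<rho> + 1 + m * w * \<mu>) \<le> (c - \<tau>) * real N \<and> 2 * \<rho> + 2 \<le> N" if \<rho>: "\<rho> < m" for \<rho>
    proof (intro conjI)
      have \<rho>': "real \<rho> \<le> real m" using \<rho> by simp
      have "2 * ((c - \<tau>) * real N) = real N + 2 * (\<beta> * N) - 2 * (\<tau> * N)" by (simp add: \<beta>_def algebra_simps)
      moreover have "0 \<le> \<beta> * N" using \<beta> N0 by simp
      moreover have "real (N + 5 * \<rho> + 2 + 2 * (m * \<mu>)) = real N + 5 * real \<rho> + 2 + 2 * real (m * \<mu>)" by simp
      ultimately show "real (N + 5 * \<rho> + 2 + 2 * (m * \<mu>)) \<le> 2 * ((c - \<tau>) * real N)"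
        using C(1) L tN \<rho>' by linarith
      \<comment> \<open>The load m w \<mu> may use up (1 - e) c N. The remaining e c N \<ge> e N/2
        has to cover \<tau> N \<le> e N/16 and 2 \<rho> + 1 \<le> e N/4.\<close>
      have "e * (1/2) * N \<le> e * c * N" using c e N0 by (intro mult_right_mono mult_left_mono) auto
      moreover have "e * \<beta> * N \<le> e * (1/2) * N" using \<beta> e N0 by (intro mult_right_mono mult_left_mono) auto
      then have "8 * (\<tau> * N) \<le> e * (1/2) * N" using t(2) by (simp add: mult.assoc[symmetric])
      moreover have "(c - \<tau>) * real N = (1 - e) * c * N + e * c * N - \<tau> * N" by (simp add: algebra_simps)
      moreover have "real (2 * \<rho> + 1 + m * w * \<mu>) = 2 * real \<rho> + 1 + real (m * w * \<mu>)" by simp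
      ultimately show "real (2 * \<rho> + 1 + m * w * \<mu>) \<le> (c - \<tau>) * real N" using C(2) L' \<rho>' e N0 by linarith
      have "real (2 * \<rho> + 2) \<le> real N" using C(3) \<rho>' by simp
      then show "2 * \<rho> + 2 \<le> N" by (simp only: of_nat_le_iff)
    qed
    moreover have "(1 - \<epsilon>) * c * real n \<le> real ((m - 4 * w\<^sup>2) * (m * w * \<mu>))" if n: "n \<le> m * N + m" for n
    proof -
      have "(1 - 8 * e) * c * real n \<le> real ((m - 4 * w\<^sup>2) * (m * w * \<mu>))"
        by (rule card_patterns_lower_bound[OF _ c(2) e w(2) me k(2) q[unfolded of_nat_mult] C(6) n]) (use c in auto)
      then show ?thesis by (simp add: e_def)
    qed
    ultimately show ?thesis using N1 N2 k kN load N0 unfolding admissible_block_size_def by (intro conjI exI[of _ k] exI[of _ \<mu>]) auto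
  qed
  show ?thesis
    by (rule exI[of _ \<beta>], rule exI[of _ e], rule exI[of _ \<tau>], rule exI[of _ \<sigma>], rule exI[of _ m], rule exI[of _ w], rule exI[of _ "nat \<lceil>X\<rceil>"])
      (use main \<beta> e t s m w in \<open>auto simp: \<beta>_def\<close>)
qed

section \<open>Approximate Hamilton decompositions\<close>

text \<open>The \<rho> leftover vertices are set aside before the random partition. This takes at
  most \<rho> < m elements from a set U and changes |U|/m by at most 1.\<close>

lemma block_partition:
  fixes \<sigma> :: real and V :: "'a set"
  assumes m: "m > 0" and s: "0 < \<sigma>" "\<sigma> \<le> 1" and V: "finite V" "card V = m * N + \<rho>" and \<rho>: "\<rho> < m"
    and \<S>: "finite \<S>" "\<S> \<subseteq> Pow V" "card \<S> \<le> s"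
    and small: "2 * real s * real m * exp (- (\<sigma>\<^sup>2 * N / 8)) < 1"
  shows "\<exists>f :: 'a \<Rightarrow> int. (\<forall>v\<in>V. f v \<in> insert (-1) {0..<int m}) \<and> card (block f V (-1)) = \<rho> \<and>
     (\<forall>j\<in>{0..<int m}. card (block f V j) = N) \<and>
     (\<forall>U\<in>\<S>. \<forall>j\<in>{0..<int m}. \<bar>real (card (U \<inter> block f V j)) - real (card U) / m\<bar> \<le> \<sigma> * N + 1)"
proof -
  obtain Z where Z: "Z \<subseteq> V" "card Z = \<rho>" "finite Z" using obtain_subset_with_card_n[of \<rho> V] V by auto
  define A where "A = V - Z"
  have A: "finite A" "card A = m * N" using V Z by (auto simp: A_def card_Diff_subset)
  define \<T> where "\<T> = (\<lambda>U. U - Z) ` \<S>"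
  have "card \<T> \<le> s" unfolding \<T>_def using card_image_le[OF \<S>(1)] \<S>(3) order_trans by blast
  then have "real (card \<T>) \<le> real s" by simp
  then have "2 * real (card \<T>) * real m * exp (- (\<sigma>\<^sup>2 * N / 8)) \<le> 2 * real s * real m * exp (- (\<sigma>\<^sup>2 * N / 8))"
    by (intro mult_right_mono mult_left_mono) simp_all
  then have sm: "2 * card \<T> * m * exp (- (\<sigma>\<^sup>2 * N / 8)) < 1" using small by simp
  obtain f :: "'a \<Rightarrow> nat" where f: "\<forall>a\<in>A. f a < m" "\<forall>j<m. card {a \<in> A. f a = j} = N"
    "\<forall>U\<in>\<T>. \<forall>j<m. \<bar>real (card {a \<in> U. f a = j}) - real (card U) / m\<bar> \<le> \<sigma> * N"
    using random_equipartition_two_sided[OF m s A, of \<T>] sm \<S>(1,2) unfolding \<T>_def A_def by blast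
  define g where "g v = (if v \<in> Z then -1 else int (f v))" for v
  have blk0: "block g V (-1) = Z" using Z by (auto simp: block_def g_def)
  have blk: "block g V (int j) = {a \<in> A. f a = j}" for j by (auto simp: block_def g_def A_def)
  have "\<bar>real (card (U \<inter> block g V (int j))) - real (card U) / m\<bar> \<le> \<sigma> * N + 1" if U: "U \<in> \<S>" and j: "j < m" for U j
  proof -
    have UV: "U \<subseteq> V" using U \<S>(2) by blast
    then have finU: "finite U" using V(1) by (rule finite_subset)
    have "U \<inter> block g V (int j) = {a \<in> U - Z. f a = j}" using UV unfolding blk A_def by auto
    then have 1: "\<bar>real (card (U \<inter> block g V (int j))) - real (card (U - Z)) / m\<bar> \<le> \<sigma> * N"
      using f(3) U j unfolding \<T>_def by simp
    have "card U \<le> card (U - Z) + card Z" using diff_card_le_card_Diff[OF Z(3), of U] by simp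
    moreover have "card (U - Z) \<le> card U" using finU by (intro card_mono) auto
    ultimately have "real (card U) \<le> real (card (U - Z)) + \<rho>" "real (card (U - Z)) \<le> real (card U)" using Z(2) by linarith+
    then have "real (card U) / m \<le> (real (card (U - Z)) + \<rho>) / m" "real (card (U - Z)) / m \<le> real (card U) / m"
      by (intro divide_right_mono; simp)+
    moreover have "real \<rho> / m \<le> 1" using \<rho> m by simp
    ultimately show ?thesis using 1 unfolding add_divide_distrib by linarith
  qed
  then have "\<forall>U\<in>\<S>. \<forall>j\<in>{0..<int m}. \<bar>real (card (U \<inter> block g V j)) - real (card U) / m\<bar> \<le> \<sigma> * N + 1"
    by (metis atLeastLessThan_iff nonneg_int_cases of_nat_less_iff)
  moreover have "\<forall>j\<in>{0..<int m}. card (block g V j) = N" using f(2) blk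
    by (metis atLeastLessThan_iff nonneg_int_cases of_nat_less_iff)
  moreover have "\<forall>v\<in>V. g v \<in> insert (-1) {0..<int m}" using f(1) by (auto simp: g_def A_def)
  ultimately show ?thesis using blk0 Z(2) by blast
qed

section \<open>From nearly regular block pairs to families of Hamilton cycles\<close>

definition near_degree :: "real \<Rightarrow> real \<Rightarrow> nat \<Rightarrow> nat \<Rightarrow> bool" where
  "near_degree c \<tau> N k \<longleftrightarrow> (c - \<tau>) * real N \<le> real k \<and> real k \<le> (c + \<tau>) * real N"

definition block_regular :: "real \<Rightarrow> real \<Rightarrow> nat \<Rightarrow> int set \<Rightarrow> ('a \<times> 'b) set \<Rightarrow> 'a set \<Rightarrow> 'b set \<Rightarrow> ('a \<Rightarrow> int) \<Rightarrow> ('b \<Rightarrow> int) \<Rightarrow> bool" where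
  "block_regular c \<tau> N I G P Q f g \<longleftrightarrow>
     (\<forall>p\<in>P. \<forall>j\<in>I. near_degree c \<tau> N (card {q \<in> block g Q j. (p, q) \<in> G})) \<and>
     (\<forall>q\<in>Q. \<forall>j\<in>I. near_degree c \<tau> N (card {p \<in> block f P j. (p, q) \<in> G}))"

lemma block_regular_matchings:
  fixes c e b \<tau> :: real and G :: "('a \<times> 'b) set"
  assumes fin: "finite P" "finite Q" and reg: "block_regular c \<tau> N I G P Q f g"
    and cP: "\<And>i. i \<in> I \<Longrightarrow> card (block f P i) = N" and cQ: "\<And>i. i \<in> I \<Longrightarrow> card (block g Q i) = N"
    and c: "c \<ge> 1/2 + b" "b > 0" "e > 0" "e \<le> 1" "5 * \<tau> \<le> e * b" "\<tau> \<ge> 0"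
    and k: "real k \<le> (1 - e) * c * N" "k \<le> N" and ij: "i \<in> I" "j \<in> I"
  shows "\<exists>F :: nat \<Rightarrow> 'a \<Rightarrow> 'b.
      (\<forall>a<k. bij_betw (F a) (block f P i) (block g Q j) \<and> (\<forall>p\<in>block f P i. (p, F a p) \<in> G)) \<and>
      (\<forall>a<k. \<forall>b<k. a \<noteq> b \<longrightarrow> (\<forall>p\<in>block f P i. F a p \<noteq> F b p))"
proof (rule near_regular_disjoint_matchings[where N = "real N", OF _ _ _ _ c])
  show "finite (block f P i)" "finite (block g Q j)" using fin by (auto simp: block_def)
  show "card (block f P i) = card (block g Q j)" "real N = real (card (block f P i))" using cP cQ ij by auto
  show "real k \<le> (1 - e) * c * real N" "real k \<le> real N" using k by auto
  show "(c - \<tau>) * N \<le> card {y \<in> block g Q j. (x, y) \<in> G} \<and> card {y \<in> block g Q j. (x, y) \<in> G} \<le> (c + \<tau>) * N"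
    if "x \<in> block f P i" for x using reg that ij unfolding block_regular_def near_degree_def by (auto simp: block_def)
  show "(c - \<tau>) * N \<le> card {x \<in> block f P i. (x, y) \<in> G} \<and> card {x \<in> block f P i. (x, y) \<in> G} \<le> (c + \<tau>) * N"
    if "y \<in> block g Q j" for y using reg that ij unfolding block_regular_def near_degree_def by (auto simp: block_def)
qed

context shift_pattern
begin

lemma hamilton_families:
  fixes c0 e \<beta> \<tau> :: real and A :: "'a set" and B :: "'b set"
  assumes fin: "finite A" "finite B"
    and fA: "\<And>v. v \<in> A \<Longrightarrow> fA v \<in> insert (-1) I" and fB: "\<And>v. v \<in> B \<Longrightarrow> fB v \<in> insert (-1) I"
    and cA: "\<And>i. i \<in> I \<Longrightarrow> card (block fA A i) = N" and cB: "\<And>i. i \<in> I \<Longrightarrow> card (block fB B i) = N"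
    and cA0: "card (block fA A (-1)) = \<rho>" and cB0: "card (block fB B (-1)) = \<rho>"
    and r1: "block_regular c0 \<tau> N I G1 A B fA fB" and r2: "block_regular c0 \<tau> N I G2 B A fB fA"
    and c: "c0 \<ge> 1/2 + \<beta>" "\<beta> > 0" "e > 0" "e \<le> 1" "5 * \<tau> \<le> e * \<beta>" "\<tau> \<ge> 0"
    and k: "real k \<le> (1 - e) * c0 * N" "k \<le> N" "nat m * nat w * \<mu> + nat w * \<mu> \<le> k"
    and large: "real (N + 5 * \<rho> + 2 + 2 * (nat m * \<mu>)) \<le> 2 * ((c0 - \<tau>) * N)"
      "real (2 * \<rho> + 1 + nat m * nat w * \<mu>) \<le> (c0 - \<tau>) * N" "2 * \<rho> + 2 \<le> N"
  shows "\<exists>M N. disjoint_hamilton_matchings A B G1 G2 T M N"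
proof -
  \<comment> \<open>Degrees are integers, so they are bounded below by the ceiling too, and the real
    bounds in \<open>large\<close> become bounds on naturals.\<close>
  define \<delta> where "\<delta> = nat \<lceil>(c0 - \<tau>) * N\<rceil>"
  have \<delta>: "\<delta> \<le> d" if "(c0 - \<tau>) * N \<le> real d" for d unfolding \<delta>_def using that by (simp add: nat_ceiling_le_eq)
  have \<delta>': "(c0 - \<tau>) * N \<le> \<delta>" unfolding \<delta>_def by (rule real_nat_ceiling_ge)
  have "real (N + 5 * \<rho> + 2 + 2 * (nat m * \<mu>)) \<le> real (2 * \<delta>)" using large(1) \<delta>' by simp
  then have l1: "N + 5 * \<rho> + 2 + 2 * (nat m * \<mu>) \<le> 2 * \<delta>" by (simp only: of_nat_le_iff)
  have "real (2 * \<rho> + 1 + nat m * nat w * \<mu>) \<le> real \<delta>" using large(2) \<delta>' by linarith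
  then have l2: "2 * \<rho> + 1 + nat m * nat w * \<mu> \<le> \<delta>" by (simp only: of_nat_le_iff)
  have nI: "-1 \<notin> I" by (simp add: I_def)
  have d1: "\<delta> \<le> card {q \<in> block fB B j. (p, q) \<in> G1}" if "p \<in> A" "j \<in> I" for p j
    using r1 that \<delta> unfolding block_regular_def near_degree_def by blast
  have d2: "\<delta> \<le> card {p \<in> block fA A j. (p, q) \<in> G1}" if "q \<in> B" "j \<in> I" for q j
    using r1 that \<delta> unfolding block_regular_def near_degree_def by blast
  have d3: "\<delta> \<le> card {q \<in> block fA A j. (p, q) \<in> G2}" if "p \<in> B" "j \<in> I" for p j
    using r2 that \<delta> unfolding block_regular_def near_degree_def by blast
  have d4: "\<delta> \<le> card {p \<in> block fB B j. (p, q) \<in> G2}" if "q \<in> A" "j \<in> I" for q j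
    using r2 that \<delta> unfolding block_regular_def near_degree_def by blast
  \<comment> \<open>A reserved pair has load at most m \<mu>, an end block of reserved pairs at most
    m w \<mu>; these are the parameters L and L' of the stage.\<close>
  have S1: "block_stage A B fA fB G1 I T a b \<pi> W k (nat m * \<mu>) (nat m * nat w * \<mu>) N \<rho> \<delta>"
  proof
    show "card {t \<in> T. i \<noteq> a t \<and> \<pi> t i = j} \<le> k" if "i \<in> I" "j \<in> I" for i j
      using load_\<pi>[OF that] k(3) by linarith
    show "\<exists>F :: nat \<Rightarrow> 'a \<Rightarrow> 'b.
      (\<forall>a<k. bij_betw (F a) (block fA A i) (block fB B j) \<and> (\<forall>p\<in>block fA A i. (p, F a p) \<in> G1)) \<and>
      (\<forall>a<k. \<forall>b<k. a \<noteq> b \<longrightarrow> (\<forall>p\<in>block fA A i. F a p \<noteq> F b p))" if "i \<in> I" "j \<in> I" for i j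
      by (rule block_regular_matchings[OF fin r1 cA cB c k(1,2) that])
  qed (rule fin finT nI cA0 cB0 l1 l2 large(3) load_ab load_a load_b | erule fA fB cA cB bij_\<pi> \<pi>_a special_ab
      | erule (2) generic_\<pi> | erule (1) d1 d2 | simp add: abc_I)+
  have S2: "block_stage B A fB fA G2 I T b c \<nu> W k (nat m * \<mu>) (nat m * nat w * \<mu>) N \<rho> \<delta>"
  proof
    show "card {t \<in> T. i \<noteq> b t \<and> \<nu> t i = j} \<le> k" if "i \<in> I" "j \<in> I" for i j
      using load_\<nu>[OF that] k(3) by linarith
    show "\<exists>F :: nat \<Rightarrow> 'b \<Rightarrow> 'a.
      (\<forall>a<k. bij_betw (F a) (block fB B i) (block fA A j) \<and> (\<forall>p\<in>block fB B i. (p, F a p) \<in> G2)) \<and>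
      (\<forall>a<k. \<forall>b<k. a \<noteq> b \<longrightarrow> (\<forall>p\<in>block fB B i. F a p \<noteq> F b p))" if "i \<in> I" "j \<in> I" for i j
      by (rule block_regular_matchings[OF fin(2,1) r2 cB cA c k(1,2) that])
  qed (rule fin finT nI cA0 cB0 l1 l2 large(3) load_bc load_b load_c | erule fA fB cA cB bij_\<nu> \<nu>_b special_bc
      | erule (2) generic_\<nu> | erule (1) d3 d4 | simp add: abc_I)+
  show ?thesis by (rule block_stages_hamilton_families[OF S1 S2, where rk = rk]) (rule rk_decreasing)
qed

end

section \<open>Regular bipartite digraphs\<close>

lemma regular_bipartite_sides:
  assumes G: "pair_digraph G" and bp: "bipartition G A B" and reg: "regular_digraph d G"
    and card: "card (pverts G) = 2 * n" and d: "d > 0"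
  shows "finite A" "finite B" "card A = n" "card B = n"
    and "\<And>v. v \<in> A \<Longrightarrow> card {u \<in> B. (v, u) \<in> parcs G} = d" "\<And>v. v \<in> A \<Longrightarrow> card {u \<in> B. (u, v) \<in> parcs G} = d"
    and "\<And>v. v \<in> B \<Longrightarrow> card {u \<in> A. (v, u) \<in> parcs G} = d" "\<And>v. v \<in> B \<Longrightarrow> card {u \<in> A. (u, v) \<in> parcs G} = d"
proof -
  interpret pair_digraph G by (rule G)
  have V: "pverts G = A \<union> B" "A \<inter> B = {}" and arcs: "\<And>x y. (x, y) \<in> parcs G \<Longrightarrow> (x \<in> A \<and> y \<in> B) \<or> (x \<in> B \<and> y \<in> A)"
    using bp unfolding bipartition_def by auto
  show fin: "finite A" "finite B" using pair_finite_verts V by auto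
  have out: "card {u. (v, u) \<in> parcs G} = d" if "v \<in> pverts G" for v
  proof -
    have "out_arcs (with_proj G) v = Pair v ` {u. (v, u) \<in> parcs G}" by (auto simp: out_arcs_def)
    then have "out_degree (with_proj G) v = card {u. (v, u) \<in> parcs G}"
      unfolding out_degree_def by (simp add: card_image inj_on_def)
    then show ?thesis using reg that unfolding regular_digraph_def by simp
  qed
  have inn: "card {u. (u, v) \<in> parcs G} = d" if "v \<in> pverts G" for v
  proof -
    have "in_arcs (with_proj G) v = (\<lambda>u. (u, v)) ` {u. (u, v) \<in> parcs G}" by (auto simp: in_arcs_def)
    then have "in_degree (with_proj G) v = card {u. (u, v) \<in> parcs G}"
      unfolding in_degree_def by (simp add: card_image inj_on_def)
    then show ?thesis using reg that unfolding regular_digraph_def by simp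
  qed
  show AB: "card {u \<in> B. (v, u) \<in> parcs G} = d" if "v \<in> A" for v
    using arcs that V by (subst out[of v, symmetric]) (auto intro!: arg_cong[of _ _ card])
  show "card {u \<in> B. (u, v) \<in> parcs G} = d" if "v \<in> A" for v
    using arcs that V by (subst inn[of v, symmetric]) (auto intro!: arg_cong[of _ _ card])
  show "card {u \<in> A. (v, u) \<in> parcs G} = d" if "v \<in> B" for v
    using arcs that V by (subst out[of v, symmetric]) (auto intro!: arg_cong[of _ _ card])
  show BA: "card {u \<in> A. (u, v) \<in> parcs G} = d" if "v \<in> B" for v
    using arcs that V by (subst inn[of v, symmetric]) (auto intro!: arg_cong[of _ _ card])
  have 1: "card (parcs G \<inter> A \<times> B) = card A * d" using card_arcs_fst[OF fin, of "parcs G"] AB by simp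
  have 2: "card (parcs G \<inter> A \<times> B) = card B * d" using card_arcs_snd[OF fin, of "parcs G"] BA by simp
  have "card A * d = card B * d" using 1[symmetric] 2 by (rule trans)
  then have "card A = card B" using d by simp
  moreover have "card A + card B = 2 * n" using card V fin by (simp add: card_Un_disjoint)
  ultimately show "card A = n" "card B = n" by simp_all
qed

text \<open>The partition is applied to the in- and out-neighbourhoods of the vertices of V'. There
  are at most 2n of them, and n < 2 m N because \<rho> < m and N \<ge> 1.\<close>

lemma regular_block_partition:
  fixes c \<sigma> \<tau> :: real
  assumes m: "m > 0" and s: "0 < \<sigma>" "\<sigma> \<le> 1" and n: "n = m * N + \<rho>" "\<rho> < m" and N: "1 \<le> N"
    and V: "finite V" "card V = n" "finite V'" "card V' = n"
    and degs: "\<forall>v\<in>V'. card {u \<in> V. (v, u) \<in> G} = d \<and> card {u \<in> V. (u, v) \<in> G} = d"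
    and d: "real d = c * real n" and c: "0 \<le> c" "c \<le> 1"
    and \<sigma>\<tau>: "\<sigma> * real N + 3 \<le> \<tau> * real N"
    and small: "2 * real (4 * m * N) * real m * exp (- (\<sigma>\<^sup>2 * real N / 8)) < 1"
  shows "\<exists>f :: 'a \<Rightarrow> int. (\<forall>v\<in>V. f v \<in> insert (-1) {0..<int m}) \<and> card (block f V (-1)) = \<rho> \<and>
     (\<forall>j\<in>{0..<int m}. card (block f V j) = N) \<and>
     (\<forall>v\<in>V'. \<forall>j\<in>{0..<int m}.
       near_degree c \<tau> N (card {u \<in> block f V j. (v, u) \<in> G}) \<and>
       near_degree c \<tau> N (card {u \<in> block f V j. (u, v) \<in> G}))"
proof -
  have deg: "card {u \<in> V. (v, u) \<in> G} = d" "card {u \<in> V. (u, v) \<in> G} = d" if "v \<in> V'" for v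
    using degs that by auto
  define \<S> where "\<S> = (\<lambda>v. {u \<in> V. (v, u) \<in> G}) ` V' \<union> (\<lambda>v. {u \<in> V. (u, v) \<in> G}) ` V'"
  have finS: "finite \<S>" using V by (simp add: \<S>_def)
  have "card \<S> \<le> card ((\<lambda>v. {u \<in> V. (v, u) \<in> G}) ` V') + card ((\<lambda>v. {u \<in> V. (u, v) \<in> G}) ` V')"
    unfolding \<S>_def by (rule card_Un_le)
  also have "\<dots> \<le> card V' + card V'" by (intro add_mono card_image_le V)
  also have "\<dots> = n + n" unfolding V(4) ..
  also have "\<dots> \<le> 4 * m * N"
  proof -
    have "m * 1 \<le> m * N" using N by (intro mult_left_mono) auto
    then have "n + n \<le> 4 * (m * N)" using n by linarith
    then show ?thesis by (simp only: mult.assoc)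
  qed
  finally have cS: "card \<S> \<le> 4 * m * N" .
  obtain f :: "'a \<Rightarrow> int" where f: "\<forall>v\<in>V. f v \<in> insert (-1) {0..<int m}" "card (block f V (-1)) = \<rho>"
     "\<forall>j\<in>{0..<int m}. card (block f V j) = N"
     "\<forall>U\<in>\<S>. \<forall>j\<in>{0..<int m}. \<bar>real (card (U \<inter> block f V j)) - real (card U) / m\<bar> \<le> \<sigma> * N + 1"
  proof -
    have "\<S> \<subseteq> Pow V" by (auto simp: \<S>_def)
    from block_partition[OF m s V(1) _ n(2) finS this cS small, unfolded V(2), OF n(1)] show ?thesis
      by (elim exE conjE) (rule that; assumption)
  qed
  \<comment> \<open>The mean d/m exceeds c N by at most 1. Together with the 1 from
    \<open>block_partition\<close> this is covered by the 3 in the hypothesis relating \<sigma> and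
    \<tau>.\<close>
  have dm: "real d / m = c * N + c * (\<rho> / m)" unfolding d n(1) using m by (simp add: field_simps)
  have "\<rho> / m \<le> 1" using n(2) m by simp
  then have "c * (\<rho> / m) \<le> 1 * 1" using c by (intro mult_mono) auto
  moreover have "0 \<le> c * (\<rho> / m)" using c by simp
  ultimately have bound: "near_degree c \<tau> N x" if "\<bar>real x - real d / m\<bar> \<le> \<sigma> * N + 1" for x
    using that \<sigma>\<tau> unfolding dm near_degree_def by (auto simp: algebra_simps abs_le_iff)
  have "near_degree c \<tau> N (card {u \<in> block f V j. (v, u) \<in> G})"
    if v: "v \<in> V'" and j: "j \<in> {0..<int m}" for v j
  proof -
    have eq: "{u \<in> V. (v, u) \<in> G} \<inter> block f V j = {u \<in> block f V j. (v, u) \<in> G}" by (auto simp: block_def)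
    have "\<bar>real (card ({u \<in> V. (v, u) \<in> G} \<inter> block f V j)) - real (card {u \<in> V. (v, u) \<in> G}) / m\<bar> \<le> \<sigma> * N + 1"
      by (rule f(4)[rule_format, OF _ j]) (use v in \<open>simp add: \<S>_def\<close>)
    then show ?thesis unfolding eq deg(1)[OF v] by (rule bound)
  qed
  moreover have "near_degree c \<tau> N (card {u \<in> block f V j. (u, v) \<in> G})"
    if v: "v \<in> V'" and j: "j \<in> {0..<int m}" for v j
  proof -
    have eq: "{u \<in> V. (u, v) \<in> G} \<inter> block f V j = {u \<in> block f V j. (u, v) \<in> G}" by (auto simp: block_def)
    have "\<bar>real (card ({u \<in> V. (u, v) \<in> G} \<inter> block f V j)) - real (card {u \<in> V. (u, v) \<in> G}) / m\<bar> \<le> \<sigma> * N + 1"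
      by (rule f(4)[rule_format, OF _ j]) (use v in \<open>simp add: \<S>_def\<close>)
    then show ?thesis unfolding eq deg(2)[OF v] by (rule bound)
  qed
  ultimately show ?thesis using f(1-3) by blast
qed

lemma hamilton_families_cycles:
  assumes fin: "finite A" "finite B" "finite T" and disj: "A \<inter> B = {}" and ne: "A \<noteq> {}" and V: "pverts G = A \<union> B"
    and "disjoint_hamilton_matchings A B (parcs G) (parcs G) T M N"
  shows "\<exists>\<C>. edge_disjoint_hamilton_cycles G \<C> \<and> card \<C> = card T"
proof -
  note MN = assms(7)[unfolded disjoint_hamilton_matchings_def, THEN conjunct1]
    assms(7)[unfolded disjoint_hamilton_matchings_def, THEN conjunct2]
  define good where "good t vs \<longleftrightarrow> distinct vs \<and> set vs = A \<union> B \<and>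
    cyclic_arcs vs = (\<lambda>v. (v, M t v)) ` A \<union> (\<lambda>v. (v, N t v)) ` B" for t vs
  define C where "C t = (SOME vs. good t vs)" for t
  have C: "good t (C t)" if "t \<in> T" for t
  proof -
    have "\<exists>vs. good t vs" unfolding good_def
      by (rule alternating_hamilton_list[OF fin(1,2) disj ne]) (use bspec[OF MN(1) that] in blast)+
    from someI_ex[OF this] show ?thesis unfolding C_def .
  qed
  have dj: "cyclic_arcs (C t) \<inter> cyclic_arcs (C t') = {}" if "t \<in> T" "t' \<in> T" "t \<noteq> t'" for t t'
  proof -
    have "M t x \<noteq> M t' x" if "x \<in> A" for x using MN(2) that \<open>t \<in> T\<close> \<open>t' \<in> T\<close> \<open>t \<noteq> t'\<close> by blast
    moreover have "N t y \<noteq> N t' y" if "y \<in> B" for y using MN(2) that \<open>t \<in> T\<close> \<open>t' \<in> T\<close> \<open>t \<noteq> t'\<close> by blast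
    ultimately show ?thesis using C[OF that(1)] C[OF that(2)] disj unfolding good_def by auto
  qed
  \<comment> \<open>Disjoint nonempty arc sets make C injective, so the number of cycles is the
    number of patterns.\<close>
  have nonempty: "cyclic_arcs (C t) \<noteq> {}" if "t \<in> T" for t using C[OF that] ne unfolding good_def by simp
  have inj: "inj_on C T"
  proof (rule inj_onI, rule ccontr)
    fix t t' assume "t \<in> T" "t' \<in> T" "C t = C t'" "t \<noteq> t'"
    then show False using dj[of t t'] nonempty[of t] by simp
  qed
  have "hamilton_cycle G (C t)" if "t \<in> T" for t
    using C[OF that] bspec[OF MN(1) that] V unfolding hamilton_cycle_def good_def by auto
  moreover have "disjoint_family_on cyclic_arcs (C ` T)"
    unfolding disjoint_family_on_def using dj by blast
  ultimately have "edge_disjoint_hamilton_cycles G (C ` T)" using fin unfolding edge_disjoint_hamilton_cycles_def by simp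
  moreover have "card (C ` T) = card T" using inj by (rule card_image)
  ultimately show ?thesis by blast
qed

theorem theorem1p3:
  fixes c \<epsilon> :: real
  assumes "c > 1 / 2" and "\<epsilon> > 0"
  shows "\<exists>n\<^sub>0 :: nat. \<forall>n \<ge> n\<^sub>0. \<forall>(G :: 'a pair_pre_digraph) (d :: nat).
           pair_digraph G \<and> bipartite G \<and> card (pverts G) = 2 * n \<and>
           real d = c * real n \<and> regular_digraph d G \<longrightarrow>
           (\<exists>\<C>. edge_disjoint_hamilton_cycles G \<C> \<and> real (card \<C>) \<ge> (1 - \<epsilon>) * c * real n)"
proof -
  \<comment> \<open>For \<epsilon> \<ge> 1 the empty family is enough. For c > 1 and n \<ge> 1 there
    is no such digraph, since a vertex would have d > n neighbours on a side of size n.\<close>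
  consider "\<epsilon> \<ge> 1" | "c > 1" | "\<epsilon> < 1" "c \<le> 1" by linarith
  then show ?thesis
  proof cases
    case 1
    have "(1 - \<epsilon>) * c * real n \<le> 0" for n using 1 assms by (intro mult_nonpos_nonneg) auto
    moreover have "edge_disjoint_hamilton_cycles G {}" for G :: "'a pair_pre_digraph"
      by (simp add: edge_disjoint_hamilton_cycles_def disjoint_family_on_def)
    ultimately show ?thesis by (intro exI[of _ 0] allI impI exI[of _ "{}"] conjI) auto
  next
    case 2
    have False if n: "n \<ge> 1" and G: "pair_digraph G" "bipartite G" "card (pverts G) = 2 * n" "real d = c * real n" "regular_digraph d G"
      for n d and G :: "'a pair_pre_digraph"
    proof -
      obtain A B where bp: "bipartition G A B" using G(2) unfolding bipartite_def by blast
      have "real d > real n" using G(4) 2 n by simp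
      then have dn: "d > n" "d > 0" by simp_all
      note S = regular_bipartite_sides[OF G(1) bp G(5,3) dn(2)]
      obtain v where "v \<in> A" using S(3) n by fastforce
      then have "d \<le> card B" using S(5)[of v] card_mono[OF S(2), of "{u \<in> B. (v, u) \<in> parcs G}"] by auto
      then show False using S(4) dn by simp
    qed
    then show ?thesis by (intro exI[of _ 1]) blast
  next
    case 3
    obtain \<beta> e \<tau> \<sigma> :: real and m w n1 :: nat where p: "c \<ge> 1/2 + \<beta>" "\<beta> > 0" "e > 0" "e \<le> 1" "5 * \<tau> \<le> e * \<beta>" "\<tau> \<ge> 0"
      "0 < \<sigma>" "\<sigma> \<le> 1" "prime m" "1 \<le> w" "5 * w < m" and
      pN: "\<forall>N\<ge>n1. admissible_block_size c \<epsilon> e \<tau> \<sigma> m w N"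
      using parameters[OF assms(1) 3(2) assms(2) 3(1)] by (elim exE conjE)
    have m0: "m > 0" using p by simp
    show ?thesis
    \<comment> \<open>From this bound on, the block size n div m is at least n1.\<close>
    proof (intro exI[of _ "m * n1"] allI impI, elim conjE)
      fix n d and G :: "'a pair_pre_digraph"
      assume n: "m * n1 \<le> n" and G: "pair_digraph G" "bipartite G" "card (pverts G) = 2 * n" "real d = c * real n" "regular_digraph d G"
      define N where "N = n div m"
      define \<rho> where "\<rho> = n mod m"
      have n_eq: "n = m * N + \<rho>" "\<rho> < m" using m0 by (auto simp: N_def \<rho>_def)
      have "n1 \<le> N" using n m0 unfolding N_def by (simp add: less_eq_div_iff_mult_less_eq mult.commute)
      then obtain k \<mu> where N: "\<sigma> * real N + 3 \<le> \<tau> * real N" "2 * real (4 * m * N) * real m * exp (- (\<sigma>\<^sup>2 * real N / 8)) < 1"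
        "1 \<le> N" and k: "real k \<le> (1 - e) * c * real N" "k \<le> N" "m * w * \<mu> + w * \<mu> \<le> k" and
        large: "\<forall>\<rho><m. real (N + 5 * \<rho> + 2 + 2 * (m * \<mu>)) \<le> 2 * ((c - \<tau>) * real N) \<and>
          real (2 * \<rho> + 1 + m * w * \<mu>) \<le> (c - \<tau>) * real N \<and> 2 * \<rho> + 2 \<le> N"
        and many: "\<forall>n\<le>m * N + m. (1 - \<epsilon>) * c * real n \<le> real ((m - 4 * w\<^sup>2) * (m * w * \<mu>))"
        using pN unfolding admissible_block_size_def by blast
      have "0 < m * N" using N(3) m0 by simp
      then have n0: "n > 0" using n_eq(1) by linarith
      obtain A B where bp: "bipartition G A B" using G(2) unfolding bipartite_def by blast
      have "real d > 0" using G(4) assms n0 by simp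
      then have "d > 0" by simp
      note S = regular_bipartite_sides[OF G(1) bp G(5,3) this]
      have V: "pverts G = A \<union> B" "A \<inter> B = {}" using bp unfolding bipartition_def by auto
      have c01: "0 \<le> c" "c \<le> 1" using 3 assms by auto
      have degA: "\<forall>v\<in>A. card {u \<in> B. (v, u) \<in> parcs G} = d \<and> card {u \<in> B. (u, v) \<in> parcs G} = d"
        and degB: "\<forall>v\<in>B. card {u \<in> A. (v, u) \<in> parcs G} = d \<and> card {u \<in> A. (u, v) \<in> parcs G} = d" using S by auto
      obtain fA :: "'a \<Rightarrow> int" where fA: "\<forall>v\<in>A. fA v \<in> insert (-1) {0..<int m}" "card (block fA A (-1)) = \<rho>"
        "\<forall>j\<in>{0..<int m}. card (block fA A j) = N"
        "\<forall>v\<in>B. \<forall>j\<in>{0..<int m}. near_degree c \<tau> N (card {u \<in> block fA A j. (v, u) \<in> parcs G}) \<and>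
       near_degree c \<tau> N (card {u \<in> block fA A j. (u, v) \<in> parcs G})"
        using regular_block_partition[OF m0 p(7,8) n_eq N(3) S(1,3,2,4) degB G(4) c01 N(1,2)] by (elim exE conjE)
      obtain fB :: "'a \<Rightarrow> int" where fB: "\<forall>v\<in>B. fB v \<in> insert (-1) {0..<int m}" "card (block fB B (-1)) = \<rho>"
        "\<forall>j\<in>{0..<int m}. card (block fB B j) = N"
        "\<forall>v\<in>A. \<forall>j\<in>{0..<int m}. near_degree c \<tau> N (card {u \<in> block fB B j. (v, u) \<in> parcs G}) \<and>
       near_degree c \<tau> N (card {u \<in> block fB B j. (u, v) \<in> parcs G})"
        using regular_block_partition[OF m0 p(7,8) n_eq N(3) S(2,4,1,3) degA G(4) c01 N(1,2)] by (elim exE conjE)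
      interpret P: shift_pattern "int m" "int w" \<mu>
        by unfold_locales (use p in auto)
      have I: "P.I = {0..<int m}" by (simp add: P.I_def)
      have "block_regular c \<tau> N P.I (parcs G) A B fA fB" "block_regular c \<tau> N P.I (parcs G) B A fB fA"
        unfolding block_regular_def I using fA(4) fB(4) by blast+
      note fam = P.hamilton_families[OF S(1,2) _ _ _ _ fA(2) fB(2) this p(1-6) k(1,2)]
      have "\<exists>M N. disjoint_hamilton_matchings A B (parcs G) (parcs G) P.T M N"
        by (rule fam) (use fA fB k(3) large[rule_format, OF n_eq(2)] in \<open>simp_all add: I\<close>)
      then obtain M N' where MN: "disjoint_hamilton_matchings A B (parcs G) (parcs G) P.T M N'" by (elim exE)
      have "A \<noteq> {}" using S(3) n0 by auto
      from hamilton_families_cycles[OF S(1,2) P.finT V(2) this V(1) MN]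
      obtain \<C> where \<C>: "edge_disjoint_hamilton_cycles G \<C>" "card \<C> = card P.T" by blast
      have "(1 - \<epsilon>) * c * real n \<le> real ((m - 4 * w\<^sup>2) * (m * w * \<mu>))"
        by (rule many[rule_format]) (use n_eq in linarith)
      also have "\<dots> \<le> real (card P.T)" using P.card_T by (simp only: of_nat_le_iff nat_int)
      finally show "\<exists>\<C>. edge_disjoint_hamilton_cycles G \<C> \<and> (1 - \<epsilon>) * c * real n \<le> real (card \<C>)" using \<C> by metis
    qed
  qed
qed

end
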